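(* Let $H\in(0,1)$, and let $\Theta_H^{(\mathrm{sym})}(\alpha,C)=\{f\in\Theta_H(\alpha,C):f=-f(1-\cdot)\}$. For any $C>0$, if $\alpha=1/2$ or if $\alpha<1-H$, then the sequences of experiments $\mathcal{E}_{1,n}(\Theta_H^{(\mathrm{sym})}(\alpha,C))$ and $\mathcal{E}_{2,n}(\Theta_H^{(\mathrm{sym})}(\alpha,C))$ are not asymptotically equivalent, i.e. their Le Cam distance does not converge to $0$ as $n\to\infty$: $$\mathcal{E}_{1,n}\big(\Theta_H^{(\mathrm{sym})}(\alpha,C)\big)\not\simeq\mathcal{E}_{2,n}\big(\Theta_H^{(\mathrm{sym})}(\alpha,C)\big).$$
   Context: Fractional Brownian motion (fBM) with Hurst index $H\in(0,1)$: the centered Gaussian process $(B^H_t)_{t\ge0}$ with continuous paths and covariance $\frac12(|t|^{2H}+|s|^{2H}-|t-s|^{2H})$. Fractional Gaussian noise (fGN): the centered stationary Gaussian sequence $(N_i^H)_{i\in\mathbb{N}}$ with autocovariance $\gamma(k)=\frac12(|k+1|^{2H}-2|k|^{2H}+|k-1|^{2H})$. $\mathcal{E}_{1,n}(\Theta)=(\mathbb{R}^n,\mathcal{B}(\mathbb{R}^n),(P_f^n:f\in\Theta))$, where $P_f^n$ is the distribution of $(Y_{1,n},\ldots,Y_{n,n})$ with $Y_{i,n}=f(i/n)+N_i^H$, $i=1,\ldots,n$. $\mathcal{E}_{2,n}(\Theta)=(\mathcal{C}[0,1],\mathcal{B}(\mathcal{C}[0,1]),(Q_f^n:f\in\Theta))$,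 where $Q_f^n$ is the distribution of $Y_t=\int_0^tf(u)\,du+n^{H-1}B_t^H$, $t\in[0,1]$. Let $\cdots<\omega_{-1}<\omega_0:=0<\omega_1<\cdots$ be the ordered real zeros of the Bessel function of the first kind $J_{1-H}$ (so $\omega_{-k}=-\omega_k$). The Sobolev ball $\Theta_H(\alpha,C)$ is the set of functions $f=\sum_{k=-\infty}^\infty\theta_ke^{2i\omega_k\cdot}$ (on $[0,1]$) with $\theta_k=\overline{\theta_{-k}}$ for all $k$ and $\sum_{k=-\infty}^\infty(1+|k|)^{2\alpha}|\theta_k|^2\le C^2$. For two experiments with the same parameter set $\Theta$ on Polish spaces, the deficiency of $(P_f)_f$ with respect to $(Q_f)_f$ is the infimum over Markov kernels $M$ of $\sup_{f\in\Theta}\|MP_f-Q_f\|_{TV}$, and the Le Cam distance $\Delta$ is the maximum of the two deficiencies. Asymptotic equivalence $\simeq$ of two sequences of experiments means that $\Delta\to0$ as $n\to\infty$. *)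

theory Defs
  imports "HOL-Probability.Probability"
begin

section \<open>Gaussian processes\<close>

text \<open>The normal law with mean \<open>\<mu>\<close> and variance \<open>v\<close>; for \<open>v = 0\<close> it is the Dirac measure at \<open>\<mu>\<close>,
  which is needed because fractional Brownian motion is degenerate at time 0.\<close>

definition normal_law :: "real \<Rightarrow> real \<Rightarrow> real measure" where
  "normal_law \<mu> v = (if v = 0 then return borel \<mu> else density lborel (normal_density \<mu> (sqrt v)))"

definition centered_gaussian_process ::
  "'a measure \<Rightarrow> 't set \<Rightarrow> ('t \<Rightarrow> 'a \<Rightarrow> real) \<Rightarrow> ('t \<Rightarrow> 't \<Rightarrow> real) \<Rightarrow> bool" where
  "centered_gaussian_process M T X K \<longleftrightarrow>
     prob_space M \<and>
     (\<forall>t\<in>T. X t \<in> borel_measurable M) \<and>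
     (\<forall>J a. finite J \<and> J \<subseteq> T \<longrightarrow>
        (\<exists>\<mu> v. 0 \<le> v \<and> distr M borel (\<lambda>x. \<Sum>t\<in>J. a t * X t x) = normal_law \<mu> v)) \<and>
     (\<forall>t\<in>T. (\<integral>x. X t x \<partial>M) = 0) \<and>
     (\<forall>s\<in>T. \<forall>t\<in>T. (\<integral>x. X s x * X t x \<partial>M) = K s t)"

definition fractional_brownian_motion ::
  "real \<Rightarrow> 'a measure \<Rightarrow> (real \<Rightarrow> 'a \<Rightarrow> real) \<Rightarrow> bool" where
  "fractional_brownian_motion H M B \<longleftrightarrow>
     centered_gaussian_process M {0..} B
       (\<lambda>s t. (\<bar>t\<bar> powr (2 * H) + \<bar>s\<bar> powr (2 * H) - \<bar>t - s\<bar> powr (2 * H)) / 2) \<and>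
     (\<forall>x\<in>space M. continuous_on {0..} (\<lambda>t. B t x))"

definition fgn_autocovariance :: "real \<Rightarrow> int \<Rightarrow> real" where
  "fgn_autocovariance H k =
     (\<bar>of_int k + 1\<bar> powr (2 * H) - 2 * \<bar>of_int k\<bar> powr (2 * H) + \<bar>of_int k - 1\<bar> powr (2 * H)) / 2"

text \<open>For a centered Gaussian sequence stationarity means that the covariance of \<open>N i\<close> and \<open>N j\<close>
  depends on \<open>i - j\<close> only. The sequence is indexed by the positive integers.\<close>

definition fractional_gaussian_noise ::
  "real \<Rightarrow> 'a measure \<Rightarrow> (nat \<Rightarrow> 'a \<Rightarrow> real) \<Rightarrow> bool" where
  "fractional_gaussian_noise H M N \<longleftrightarrow>
     centered_gaussian_process M {1..} N (\<lambda>i j. fgn_autocovariance H (int i - int j))"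


section \<open>Statistical experiments and the Le Cam distance\<close>

text \<open>Total variation as the supremum over events of the difference of the probabilities; the other
  common normalization is twice this.\<close>

definition tv_dist :: "'a measure \<Rightarrow> 'a measure \<Rightarrow> ennreal" where
  "tv_dist P Q = (SUP A\<in>sets P. ennreal \<bar>measure P A - measure Q A\<bar>)"

text \<open>An experiment with parameter set \<open>\<Theta>\<close> is given by a sample space \<open>\<Omega>\<close>, of which only the
  \<open>\<sigma>\<close>-algebra matters, and a family \<open>P\<close> of probability measures on it. The infimum is over all
  Markov kernels from \<open>\<Omega>\<close> to \<open>\<Omega>'\<close>.\<close>

definition deficiency ::
  "'p set \<Rightarrow> 'x measure \<Rightarrow> ('p \<Rightarrow> 'x measure) \<Rightarrow> 'y measure \<Rightarrow> ('p \<Rightarrow> 'y measure) \<Rightarrow> ennreal" where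
  "deficiency \<Theta> \<Omega> P \<Omega>' Q =
     (INF K\<in>\<Omega> \<rightarrow>\<^sub>M prob_algebra \<Omega>'. SUP f\<in>\<Theta>. tv_dist (Giry_Monad.bind (P f) K) (Q f))"

definition le_cam_distance ::
  "'p set \<Rightarrow> 'x measure \<Rightarrow> ('p \<Rightarrow> 'x measure) \<Rightarrow> 'y measure \<Rightarrow> ('p \<Rightarrow> 'y measure) \<Rightarrow> ennreal" where
  "le_cam_distance \<Theta> \<Omega> P \<Omega>' Q = max (deficiency \<Theta> \<Omega> P \<Omega>' Q) (deficiency \<Theta> \<Omega>' Q \<Omega> P)"

definition asymptotically_equivalent ::
  "'p set \<Rightarrow> (nat \<Rightarrow> 'x measure) \<Rightarrow> (nat \<Rightarrow> 'p \<Rightarrow> 'x measure) \<Rightarrow>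
     (nat \<Rightarrow> 'y measure) \<Rightarrow> (nat \<Rightarrow> 'p \<Rightarrow> 'y measure) \<Rightarrow> bool" where
  "asymptotically_equivalent \<Theta> \<Omega> P \<Omega>' Q \<longleftrightarrow>
     (\<lambda>n. le_cam_distance \<Theta> (\<Omega> n) (P n) (\<Omega>' n) (Q n)) \<longlonglongrightarrow> 0"


section \<open>The two regression experiments\<close>

text \<open>The Borel sets of \<open>\<real>\<^sup>n\<close>, with coordinates indexed by \<open>1, \<dots>, n\<close>.\<close>

definition borel_Rn :: "nat \<Rightarrow> (nat \<Rightarrow> real) measure" where
  "borel_Rn n = PiM {1..n} (\<lambda>_. borel)"

text \<open>The Borel sets of \<open>C[0,1]\<close> with the supremum metric. The points are the continuous functions on
  \<open>[0,1]\<close>, represented by \<open>extensional\<close> functions (equal to \<open>undefined\<close> off \<open>[0,1]\<close>).\<close>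

definition borel_C01 :: "(real \<Rightarrow> real) measure" where
  "borel_C01 =
     (let C01 = cfunspace (top_of_set {0..1::real}) (euclidean_metric :: real metric)
      in sigma (mspace C01) {U. openin (mtopology_of C01) U})"

definition discrete_law ::
  "'a measure \<Rightarrow> (nat \<Rightarrow> 'a \<Rightarrow> real) \<Rightarrow> nat \<Rightarrow> (real \<Rightarrow> real) \<Rightarrow> (nat \<Rightarrow> real) measure" where
  "discrete_law M N n f =
     distr M (borel_Rn n) (\<lambda>x. \<lambda>i\<in>{1..n}. f (real i / real n) + N i x)"

definition continuous_law ::
  "real \<Rightarrow> 'a measure \<Rightarrow> (real \<Rightarrow> 'a \<Rightarrow> real) \<Rightarrow> nat \<Rightarrow> (real \<Rightarrow> real) \<Rightarrow> (real \<Rightarrow> real) measure" where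
  "continuous_law H M B n f =
     distr M borel_C01
       (\<lambda>x. \<lambda>t\<in>{0..1}. (LBINT u:{0..t}. f u) + real n powr (H - 1) * B t x)"


section \<open>Zeros of Bessel functions\<close>

text \<open>The Bessel function of the first kind, with the principal branch of \<open>(z/2) powr \<nu>\<close>. On the
  negative real axis every branch has the same zeros, since the remaining factor is even in \<open>z\<close>.\<close>

definition bessel_J :: "real \<Rightarrow> complex \<Rightarrow> complex" where
  "bessel_J \<nu> z =
     (z / 2) powr of_real \<nu> *
       (\<Sum>m. (-1) ^ m * of_real (rGamma (real m + \<nu> + 1)) / fact m * (z / 2) ^ (2 * m))"

text \<open>For \<open>\<nu> > 0\<close> the point 0 is a zero, and the conditions below determine the sequence \<open>\<omega>\<close>.\<close>

definition ordered_bessel_zeros :: "real \<Rightarrow> (int \<Rightarrow> real) \<Rightarrow> bool" where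
  "ordered_bessel_zeros \<nu> \<omega> \<longleftrightarrow>
     strict_mono \<omega> \<and> \<omega> 0 = 0 \<and> range \<omega> = {x. bessel_J \<nu> (complex_of_real x) = 0}"

lemma strict_mono_int_next:
  fixes f g :: "int \<Rightarrow> real"
  assumes f: "strict_mono f" and g: "strict_mono g" and r: "range f = range g"
    and k: "f k = g k"
  shows "f (k + 1) = g (k + 1)" and "f (k - 1) = g (k - 1)"
proof -
  obtain j where j: "f (k + 1) = g j" using r by (metis rangeE rangeI)
  obtain i where i: "g (k + 1) = f i" using r by (metis rangeE rangeI)
  have "g k < g j" "f k < f i"
    using k j i strict_monoD[OF f, of k "k + 1"] strict_monoD[OF g, of k "k + 1"] by auto
  then have "k + 1 \<le> j" "k + 1 \<le> i"
    using strict_mono_less[OF f, of k i] strict_mono_less[OF g, of k j] by auto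
  then have "g (k + 1) \<le> g j" "f (k + 1) \<le> f i"
    using strict_mono_less_eq[OF f] strict_mono_less_eq[OF g] by auto
  then show "f (k + 1) = g (k + 1)" using i j by simp
  obtain j where j: "f (k - 1) = g j" using r by (metis rangeE rangeI)
  obtain i where i: "g (k - 1) = f i" using r by (metis rangeE rangeI)
  have "g j < g k" "f i < f k"
    using k j i strict_monoD[OF f, of "k - 1" k] strict_monoD[OF g, of "k - 1" k] by auto
  then have "j \<le> k - 1" "i \<le> k - 1"
    using strict_mono_less[OF f, of i k] strict_mono_less[OF g, of j k] by auto
  then have "g j \<le> g (k - 1)" "f i \<le> f (k - 1)"
    using strict_mono_less_eq[OF f] strict_mono_less_eq[OF g] by auto
  then show "f (k - 1) = g (k - 1)" using i j by simp
qed

lemma ordered_bessel_zeros_unique: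
  assumes "ordered_bessel_zeros \<nu> \<omega>" "ordered_bessel_zeros \<nu> \<omega>'"
  shows "\<omega> = \<omega>'"
proof
  fix k :: int
  have sm: "strict_mono \<omega>" "strict_mono \<omega>'" "range \<omega> = range \<omega>'"
    using assms by (auto simp: ordered_bessel_zeros_def)
  show "\<omega> k = \<omega>' k"
  proof (induction k rule: int_induct[where k = 0])
    case base
    show ?case using assms by (simp add: ordered_bessel_zeros_def)
  qed (simp_all add: strict_mono_int_next[OF sm])
qed


section \<open>Sobolev balls\<close>

text \<open>The functions on \<open>[0,1]\<close> are represented as \<open>extensional\<close> ones. Since the experiments involve
  both point values and the antiderivative of \<open>f\<close>, the two-sided series is required to converge to \<open>f\<close>
  at every point of \<open>[0,1]\<close> (along symmetric partial sums), and \<open>f\<close> to be integrable. Integrability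
  is automatic for \<open>\<alpha> \<ge> 0\<close>, where the series also converges in \<open>L\<^sup>2\<close>; for \<open>\<alpha> > 1/2\<close> it converges
  absolutely, so that pointwise convergence is automatic as well.\<close>

definition sobolev_ball :: "(int \<Rightarrow> real) \<Rightarrow> real \<Rightarrow> real \<Rightarrow> (real \<Rightarrow> real) set" where
  "sobolev_ball \<omega> \<alpha> C =
     {f. f \<in> extensional {0..1} \<and> set_integrable lborel {0..1} f \<and>
        (\<exists>\<theta> :: int \<Rightarrow> complex.
           (\<forall>k. \<theta> k = cnj (\<theta> (- k))) \<and>
           (\<lambda>k. (1 + \<bar>real_of_int k\<bar>) powr (2 * \<alpha>) * (cmod (\<theta> k))\<^sup>2) summable_on UNIV \<and>
           (\<Sum>\<^sub>\<infinity>k. (1 + \<bar>real_of_int k\<bar>) powr (2 * \<alpha>) * (cmod (\<theta> k))\<^sup>2) \<le> C\<^sup>2 \<and>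
           (\<forall>t\<in>{0..1}.
              (\<lambda>n. \<Sum>k\<in>{- int n..int n}. \<theta> k * exp (2 * \<i> * of_real (\<omega> k) * of_real t))
                \<longlonglongrightarrow> complex_of_real (f t)))}"

definition sobolev_ball_sym :: "(int \<Rightarrow> real) \<Rightarrow> real \<Rightarrow> real \<Rightarrow> (real \<Rightarrow> real) set" where
  "sobolev_ball_sym \<omega> \<alpha> C = {f \<in> sobolev_ball \<omega> \<alpha> C. \<forall>t\<in>{0..1}. f t = - f (1 - t)}"

end

(* Le Cam equivalence is refuted by comparing a single non-zero function with the zero function.
   Consecutive positive zeros of the Bessel function have distance pi + O(1/j^2) (Sturm comparison with
   the harmonic oscillator), so that omega_(j+n) = omega_j + pi n + O(1/j) uniformly in n. Hence
     f(t) = a (sin (omega_(j+n) (2t-1)) - (-1)^n sin (omega_j (2t-1)))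
   is of size O(a/j) at the sampling points i/n, although its two summands are not small.

   Discrete experiment: if the covariance matrix of the noise is at least l > 0, the laws for f and for 0
   differ in total variation by at most a function of |f|^2 / l that vanishes at 0. For H >= 1/2 one may
   take l constant (the autocovariance is convex, Polya), for H < 1/2 one takes l = 2 H n^(2H-1) (diagonal
   dominance). Continuous experiment: an alternating sum of increments at the scale of one of the two
   frequencies detects that frequency. For H >= 1/2 this is the high frequency, with a^2 of order 1/n,
   for H < 1/2 the low one, with a of order n^(H-1), which alpha < 1 - H permits. Letting j be large makes
   the discrete laws as close as desired while the power of the continuous test stays bounded below. *)

theory Submission
  imports Defs
begin

section \<open>Zeros of Bessel functions\<close>

text \<open>The obstacle is the order of the choices. The gain \<kappa> of the continuous test must
  not depend on the tolerance \<delta> for the discrete laws: j is fixed by \<delta>, then n tends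
  to infinity, and the signal-to-noise ratio has to stay bounded below for every such j. For H >=
  1/2, with n alternating increments of length about 1/n, both the resonant signal and the noise are
  of order n^(-1/2), and the low frequency, off resonance, contributes only O(a/\<omega>_j). For H <
  1/2 the amplitude has to grow with j: a single increment of length of order 1/\<omega>_j sees a
  signal of order a/\<omega>_j against noise of order n^(H-1) \<omega>_j^(-H), which forces a of
  order n^(H-1) \<omega>_j^(1-H). The discrete side then costs n (a/j)^2 / n^(2H-1), which is of
  order j^(-2H) and still tends to 0. The ball enters only through the weights at j and j + n: a^2
  n^(2\<alpha>) stays bounded for \<alpha> <= 1/2 in the first case and, for \<alpha> >= 0, vanishes
  for \<alpha> < 1 - H in the second. Sines of \<omega>(2t - 1) are odd about 1/2, which gives the
  antisymmetry.\<close>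

text \<open>The Wronskian u'w - uw' has derivative (r - q)uw >= 0 and starts at u'(a)w(a) >= 0, so
  u/w cannot decrease where w is positive; yet u/w is positive inside and 0 at b. At a only
  nonnegativity of w is asked, so that w may share that zero with u.\<close>

lemma sturm_comparison:
  fixes u u' w w' q r :: "real \<Rightarrow> real"
  assumes ab: "a < b"
    and u: "\<And>x. x \<in> {a..b} \<Longrightarrow> (u has_real_derivative u' x) (at x)"
      "\<And>x. x \<in> {a..b} \<Longrightarrow> (u' has_real_derivative - q x * u x) (at x)"
    and w: "\<And>x. x \<in> {a..b} \<Longrightarrow> (w has_real_derivative w' x) (at x)"
      "\<And>x. x \<in> {a..b} \<Longrightarrow> (w' has_real_derivative - r x * w x) (at x)"
    and qr: "\<And>x. x \<in> {a..b} \<Longrightarrow> q x \<le> r x"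
    and z: "u a = 0" "u b = 0" and pos: "\<And>x. x \<in> {a<..<b} \<Longrightarrow> 0 < u x"
    and wpos: "0 \<le> w a" "\<And>x. x \<in> {a<..b} \<Longrightarrow> 0 < w x"
  shows False
proof -
  have nonneg: "0 \<le> u x" "0 \<le> w x" if "x \<in> {a..b}" for x
    using pos[of x] z wpos(1) wpos(2)[of x] that
    by (cases "x = a"; cases "x = b"; simp add: less_imp_le)+
  have u'a: "0 \<le> u' a"
  proof (rule ccontr)
    assume "\<not> 0 \<le> u' a"
    then obtain e where e: "e > 0" "\<And>h. 0 < h \<Longrightarrow> h < e \<Longrightarrow> u (a + h) < u a"
      using DERIV_neg_dec_right[OF u(1)[of a]] ab by auto
    have "u (a + min (e/2) (b - a)) < u a" using e ab by (intro e(2)) auto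
    moreover have "a + min (e/2) (b - a) \<le> b" by (simp add: min_def)
    ultimately show False using nonneg(1)[of "a + min (e/2) (b - a)"] z e(1) ab by auto
  qed
  define W where "W x = u' x * w x - u x * w' x" for x
  have Wd: "(W has_real_derivative (r x - q x) * (u x * w x)) (at x)" if "x \<in> {a..b}" for x
    unfolding W_def
    by (rule derivative_eq_intros u[OF that] w[OF that] refl)+ (simp add: algebra_simps)
  have Wpos: "0 \<le> W x" if x: "x \<in> {a..b}" for x
  proof -
    have "W a \<le> W x"
    proof (rule DERIV_nonneg_imp_nondecreasing[where f = W])
      show "a \<le> x" using x by simp
      fix y assume y: "a \<le> y" "y \<le> x"
      then have yy: "y \<in> {a..b}" using x by auto
      have "0 \<le> (r y - q y) * (u y * w y)"
        using qr[OF yy] nonneg[OF yy] by (intro mult_nonneg_nonneg) auto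
      then show "\<exists>l. DERIV W y :> l \<and> 0 \<le> l" using Wd[OF yy] by blast
    qed
    moreover have "0 \<le> W a" using u'a wpos(1) z by (simp add: W_def)
    ultimately show ?thesis by simp
  qed
  define c where "c = (a + b) / 2"
  have c: "c \<in> {a<..<b}" using ab by (auto simp: c_def)
  have "u c / w c \<le> u b / w b"
  proof (rule DERIV_nonneg_imp_nondecreasing[where f = "\<lambda>x. u x / w x"])
    show "c \<le> b" using c by simp
    fix y assume y: "c \<le> y" "y \<le> b"
    then have yy: "y \<in> {a..b}" "y \<in> {a<..b}" using c by auto
    have "((\<lambda>x. u x / w x) has_real_derivative W y / (w y * w y)) (at y)"
      unfolding W_def using wpos(2)[OF yy(2)] by (intro DERIV_divide u[OF yy(1)] w[OF yy(1)]) auto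
    then show "\<exists>l. ((\<lambda>x. u x / w x) has_real_derivative l) (at y) \<and> 0 \<le> l"
      using Wpos[OF yy(1)] by (intro exI[of _ "W y / (w y * w y)"]) (auto intro!: divide_nonneg_nonneg)
  qed
  moreover have "0 < u c / w c" using pos[OF c] wpos(2)[of c] c by simp
  ultimately show False using z by simp
qed

lemma sine_ode:
  fixes Q a d :: real
  shows "((\<lambda>x. sin (Q * (x - a) + d)) has_real_derivative Q * cos (Q * (x - a) + d)) (at x)"
    and "((\<lambda>x. Q * cos (Q * (x - a) + d)) has_real_derivative - Q\<^sup>2 * sin (Q * (x - a) + d)) (at x)"
  by (auto intro!: derivative_eq_intros simp: power2_eq_square)

text \<open>If the gap were shorter than pi/Q, some sine of frequency Q would stay positive on all
  of [a, b] and could serve as w in the comparison.\<close>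

lemma sturm_gap_lower:
  fixes u u' q :: "real \<Rightarrow> real"
  assumes ab: "a < b" and Q: "0 < Q"
    and u: "\<And>x. x \<in> {a..b} \<Longrightarrow> (u has_real_derivative u' x) (at x)"
      "\<And>x. x \<in> {a..b} \<Longrightarrow> (u' has_real_derivative - q x * u x) (at x)"
    and q: "\<And>x. x \<in> {a..b} \<Longrightarrow> q x \<le> Q\<^sup>2"
    and z: "u a = 0" "u b = 0" and pos: "\<And>x. x \<in> {a<..<b} \<Longrightarrow> 0 < u x"
  shows "pi / Q \<le> b - a"
proof (rule ccontr)
  assume "\<not> pi / Q \<le> b - a"
  then have lt: "Q * (b - a) < pi" using Q by (simp add: field_simps)
  \<comment> \<open>The phase \<open>d\<close> splits the slack pi - Q(b - a) evenly between the two
    ends.\<close>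
  define d where "d = (pi - Q * (b - a)) / 2"
  have d: "0 < d" "Q * (b - a) + d < pi" using lt by (auto simp: d_def field_simps)
  have wpos: "0 < sin (Q * (x - a) + d)" if "x \<in> {a..b}" for x
  proof -
    have "Q * (x - a) \<le> Q * (b - a)" "0 \<le> Q * (x - a)" using that Q by auto
    then show ?thesis using d by (intro sin_gt_zero) auto
  qed
  show False
    using wpos[of a] wpos ab
    by (intro sturm_comparison[OF ab u sine_ode[of Q a d] q z pos]) (auto simp: less_imp_le)
qed

text \<open>The roles are exchanged: the sine of frequency Q, with zeros at a and a + pi/Q, is now
  the slower solution, and u is the one that stays positive too long.\<close>

lemma sturm_gap_upper:
  fixes u u' q :: "real \<Rightarrow> real"
  assumes Q: "0 < Q"
    and u: "\<And>x. x \<in> {a..b} \<Longrightarrow> (u has_real_derivative u' x) (at x)"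
      "\<And>x. x \<in> {a..b} \<Longrightarrow> (u' has_real_derivative - q x * u x) (at x)"
    and q: "\<And>x. x \<in> {a..b} \<Longrightarrow> Q\<^sup>2 \<le> q x"
    and z: "u a = 0" and pos: "\<And>x. x \<in> {a<..<b} \<Longrightarrow> 0 < u x"
  shows "b - a \<le> pi / Q"
proof (rule ccontr)
  assume lt: "\<not> b - a \<le> pi / Q"
  define c where "c = a + pi / Q"
  have c: "a < c" "c < b" "Q * (c - a) = pi" using lt Q by (auto simp: c_def)
  have wpos: "0 < sin (Q * (x - a) + 0)" if "x \<in> {a<..<c}" for x
  proof -
    have "Q * (x - a) < Q * (c - a)" "0 < Q * (x - a)" using that Q by auto
    then show ?thesis using c(3) by (intro sin_gt_zero) auto
  qed
  show False
    by (rule sturm_comparison[OF c(1) sine_ode[of Q a 0] u q _ _ wpos]) (use c z pos in auto)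
qed

section \<open>The Bessel equation in normal form\<close>

text \<open>The coefficients, in the variable y = x^2/4, of the entire function that remains when
  (x/2)^\<nu> is split off from J_\<nu>; in this variable no branch of a power is involved.\<close>

definition bessel_coeff :: "real \<Rightarrow> nat \<Rightarrow> real" where
  "bessel_coeff \<nu> m = (-1) ^ m * rGamma (real m + \<nu> + 1) / fact m"

lemma bessel_coeff_Suc:
  "real (Suc m) * (real m + \<nu> + 1) * bessel_coeff \<nu> (Suc m) = - bessel_coeff \<nu> m"
proof -
  have "bessel_coeff \<nu> (Suc m) = - ((-1) ^ m * rGamma (real m + \<nu> + 2)) / (real (Suc m) * fact m)"
    by (simp add: bessel_coeff_def algebra_simps)
  then have "real (Suc m) * (real m + \<nu> + 1) * bessel_coeff \<nu> (Suc m)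
      = - ((-1) ^ m * ((real m + \<nu> + 1) * rGamma (real m + \<nu> + 1 + 1)) / fact m)"
    by (simp add: add_ac del: of_nat_Suc)
  then show ?thesis by (simp only: rGamma_plus1 bessel_coeff_def)
qed

lemma summable_bessel_coeff:
  assumes "0 < \<nu>"
  shows "summable (\<lambda>m. bessel_coeff \<nu> m * y ^ m)"
proof (rule summable_ratio_test[where c = "1/2" and N = "nat \<lceil>2 * \<bar>y\<bar>\<rceil>"])
  fix m assume m: "nat \<lceil>2 * \<bar>y\<bar>\<rceil> \<le> m"
  have my: "2 * \<bar>y\<bar> \<le> real m" using m by linarith
  define D where "D = real (Suc m) * (real m + \<nu> + 1)"
  have "real m * 1 \<le> D" unfolding D_def using assms by (intro mult_mono) auto
  then have D: "2 * \<bar>y\<bar> \<le> D" "0 < D" using my assms unfolding D_def by auto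
  have c: "bessel_coeff \<nu> (Suc m) = - bessel_coeff \<nu> m / D"
    using bessel_coeff_Suc[of m \<nu>] D(2) unfolding D_def[symmetric] by (simp add: field_simps)
  have "norm (bessel_coeff \<nu> (Suc m) * y ^ Suc m) = (\<bar>y\<bar> / D) * norm (bessel_coeff \<nu> m * y ^ m)"
    using D(2) by (simp add: c abs_mult)
  also have "\<dots> \<le> 1/2 * norm (bessel_coeff \<nu> m * y ^ m)"
    using D by (intro mult_right_mono) (auto simp: field_simps)
  finally show "norm (bessel_coeff \<nu> (Suc m) * y ^ Suc m) \<le> 1/2 * norm (bessel_coeff \<nu> m * y ^ m)" .
qed simp

definition bessel_series :: "real \<Rightarrow> real \<Rightarrow> real" where
  "bessel_series \<nu> y = (\<Sum>m. bessel_coeff \<nu> m * y ^ m)"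

text \<open>Termwise differentiation turns the recursion \<open>bessel_coeff_Suc\<close> into a
  differential equation. Multiplying \<open>G''\<close> by y shifts its coefficients by one place,
  so that all three series can be compared at y^m.\<close>

lemma bessel_series_ode:
  assumes \<nu>: "0 < \<nu>"
  obtains G' G'' where
    "\<And>y. (bessel_series \<nu> has_real_derivative G' y) (at y)"
    "\<And>y. (G' has_real_derivative G'' y) (at y)"
    "\<And>y. y * G'' y + (\<nu> + 1) * G' y + bessel_series \<nu> y = 0"
proof
  let ?c = "bessel_coeff \<nu>"
  define G' where "G' = (\<lambda>y. \<Sum>m. diffs ?c m * y ^ m)"
  define G'' where "G'' = (\<lambda>y. \<Sum>m. diffs (diffs ?c) m * y ^ m)"
  have s0: "summable (\<lambda>m. ?c m * y ^ m)" for y by (rule summable_bessel_coeff[OF \<nu>])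
  have s1: "summable (\<lambda>m. diffs ?c m * y ^ m)" for y by (rule termdiff_converges_all[OF s0])
  have s2: "summable (\<lambda>m. diffs (diffs ?c) m * y ^ m)" for y by (rule termdiff_converges_all[OF s1])
  show "(bessel_series \<nu> has_real_derivative G' y) (at y)" for y
    unfolding bessel_series_def[abs_def] G'_def
    by (rule termdiffs_strong_converges_everywhere[OF s0])
  show "(G' has_real_derivative G'' y) (at y)" for y
    unfolding G'_def G''_def by (rule termdiffs_strong_converges_everywhere[OF s1])
  fix y :: real
  have "(\<lambda>m. diffs (diffs ?c) m * y ^ m) sums G'' y"
    unfolding G''_def using s2 by (rule summable_sums)
  then have "(\<lambda>m. diffs (diffs ?c) m * y ^ m * y) sums (G'' y * y)" by (rule sums_mult2)
  then have "(\<lambda>m. real (Suc m) * diffs ?c (Suc m) * y ^ Suc m) sums (G'' y * y)"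
    by (simp add: diffs_def mult_ac)
  then have A: "(\<lambda>m. real m * diffs ?c m * y ^ m) sums (G'' y * y)"
    using sums_Suc_iff[of "\<lambda>m. real m * diffs ?c m * y ^ m"] by simp
  have B: "(\<lambda>m. (\<nu> + 1) * (diffs ?c m * y ^ m)) sums ((\<nu> + 1) * G' y)"
    unfolding G'_def using s1 by (intro sums_mult summable_sums)
  have C: "(\<lambda>m. ?c m * y ^ m) sums bessel_series \<nu> y"
    unfolding bessel_series_def using s0 by (rule summable_sums)
  have "(\<lambda>m. real m * diffs ?c m * y ^ m + (\<nu> + 1) * (diffs ?c m * y ^ m) + ?c m * y ^ m)
      sums (G'' y * y + (\<nu> + 1) * G' y + bessel_series \<nu> y)"
    by (intro sums_add A B C)
  moreover have "real m * diffs ?c m * y ^ m + (\<nu> + 1) * (diffs ?c m * y ^ m) + ?c m * y ^ m = 0" for m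
  proof -
    have "real m * diffs ?c m * y ^ m + (\<nu> + 1) * (diffs ?c m * y ^ m) + ?c m * y ^ m
        = (real (Suc m) * (real m + \<nu> + 1) * ?c (Suc m) + ?c m) * y ^ m"
      by (simp add: diffs_def algebra_simps)
    then show ?thesis unfolding bessel_coeff_Suc by simp
  qed
  ultimately show "y * G'' y + (\<nu> + 1) * G' y + bessel_series \<nu> y = 0"
    by (simp add: sums_iff mult.commute)
qed

text \<open>The power factor does not vanish on either side of 0, and what remains depends on x^2
  only. This also yields the symmetry of the set of zeros.\<close>

lemma bessel_J_of_real_eq_0_iff:
  assumes "0 < \<nu>" "x \<noteq> 0"
  shows "bessel_J \<nu> (complex_of_real x) = 0 \<longleftrightarrow> bessel_series \<nu> (x\<^sup>2 / 4) = 0"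
proof -
  have "(\<lambda>m. (-1) ^ m * of_real (rGamma (real m + \<nu> + 1)) / fact m * (complex_of_real x / 2) ^ (2 * m))
      = (\<lambda>m. complex_of_real (bessel_coeff \<nu> m * (x\<^sup>2 / 4) ^ m))"
    by (rule ext) (simp add: bessel_coeff_def power_mult power_divide)
  then have "bessel_J \<nu> (complex_of_real x)
      = (complex_of_real x / 2) powr of_real \<nu> * complex_of_real (bessel_series \<nu> (x\<^sup>2 / 4))"
    unfolding bessel_J_def bessel_series_def
    by (simp only: suminf_of_real[OF summable_bessel_coeff[OF assms(1)], symmetric])
  then show ?thesis using assms(2) by simp
qed

text \<open>Liouville normal form: x^(\<nu> + 1/2) times the series at x^2/4 is a constant multiple
  of sqrt x J_\<nu>(x), and the factor sqrt x removes the first-order term from Bessel's equation.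
  The remaining potential tends to 1, that of the sine.\<close>

lemma bessel_normal_form:
  assumes \<nu>: "0 < \<nu>"
  obtains u u' where
    "\<And>x. 0 < x \<Longrightarrow> (u has_real_derivative u' x) (at x)"
    "\<And>x. 0 < x \<Longrightarrow> (u' has_real_derivative - (1 + (1/4 - \<nu>\<^sup>2) / x\<^sup>2) * u x) (at x)"
    "\<And>x. 0 < x \<Longrightarrow> u x = 0 \<longleftrightarrow> bessel_J \<nu> (complex_of_real x) = 0"
proof -
  obtain G' G'' where
    G: "\<And>y. (bessel_series \<nu> has_real_derivative G' y) (at y)" and
    G': "\<And>y. (G' has_real_derivative G'' y) (at y)" and
    ode: "\<And>y. y * G'' y + (\<nu> + 1) * G' y + bessel_series \<nu> y = 0"
    using bessel_series_ode[OF \<nu>] by blast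
  define b where "b = \<nu> + 1/2"
  define u where "u x = x powr b * bessel_series \<nu> (x\<^sup>2 / 4)" for x
  define u' where "u' x = b * x powr (b - 1) * bessel_series \<nu> (x\<^sup>2 / 4)
      + x powr b * (G' (x\<^sup>2 / 4) * (x / 2))" for x
  show ?thesis
  proof
    fix x :: real assume x: "0 < x"
    have p1: "x powr b = x * x powr (b - 1)" "x powr (b - 1) = x * x powr (b - 2)"
      using powr_mult_base[of x "b - 1"] powr_mult_base[of x "b - 2"] x by auto
    have sq: "((\<lambda>x. x\<^sup>2 / 4) has_real_derivative x / 2) (at x)"
      by (auto intro!: derivative_eq_intros)
    have Gx: "((\<lambda>x. bessel_series \<nu> (x\<^sup>2 / 4)) has_real_derivative G' (x\<^sup>2 / 4) * (x / 2)) (at x)"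
      by (rule DERIV_chain2[OF G sq])
    have G'x: "((\<lambda>x. G' (x\<^sup>2 / 4)) has_real_derivative G'' (x\<^sup>2 / 4) * (x / 2)) (at x)"
      by (rule DERIV_chain2[OF G' sq])
    have P: "((\<lambda>x. x powr r) has_real_derivative r * x powr (r - 1)) (at x)" for r
      using x by (rule has_real_derivative_powr)
    show "(u has_real_derivative u' x) (at x)"
      unfolding u_def[abs_def] u'_def
      by (rule derivative_eq_intros P Gx refl)+ simp
    let ?g = "bessel_series \<nu> (x\<^sup>2 / 4)" and ?g1 = "G' (x\<^sup>2 / 4)" and ?g2 = "G'' (x\<^sup>2 / 4)"
    let ?u2 = "b * ((b - 1) * x powr (b - 2)) * ?g
        + b * x powr (b - 1) * (?g1 * (x / 2)) + b * x powr (b - 1) * (?g1 * (x / 2))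
        + x powr b * (?g2 * (x / 2) * (x / 2) + ?g1 / 2)"
    have "(u' has_real_derivative
        ?u2) (at x)"
      unfolding u'_def[abs_def]
      by (rule DERIV_cong[OF DERIV_add[OF DERIV_mult[OF DERIV_cmult[OF P] Gx]
            DERIV_mult[OF P DERIV_mult[OF G'x DERIV_cdivide[OF DERIV_ident]]]]])
        (simp add: algebra_simps p1(1))
    moreover have "?u2
        = - (1 + (1/4 - \<nu>\<^sup>2) / x\<^sup>2) * u x"
    proof -
      have g: "x\<^sup>2 / 4 * ?g2 = - (\<nu> + 1) * ?g1 - ?g" using ode[of "x\<^sup>2 / 4"] by linarith
      have "?u2
        = x powr (b - 2) * (b * (b - 1) * ?g + b * x\<^sup>2 * ?g1 + x\<^sup>2 * (x\<^sup>2 / 4 * ?g2 + ?g1 / 2))"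
        unfolding p1 by (simp add: field_simps power2_eq_square)
      \<comment> \<open>The differential equation of the series eliminates \<open>?g2\<close>; the
        terms with \<open>?g1\<close> then cancel because b = \<nu> + 1/2.\<close>
      also have "\<dots> = x powr (b - 2) * ((b * (b - 1) - x\<^sup>2) * ?g)"
        unfolding g by (simp add: b_def algebra_simps)
      also have "\<dots> = - (1 + (1/4 - \<nu>\<^sup>2) / x\<^sup>2) * (x\<^sup>2 * x powr (b - 2) * ?g)"
        using x by (simp add: b_def field_simps power2_eq_square)
      also have "x\<^sup>2 * x powr (b - 2) * ?g = u x"
        unfolding u_def p1 by (simp add: power2_eq_square)
      finally show ?thesis .
    qed
    ultimately show "(u' has_real_derivative - (1 + (1/4 - \<nu>\<^sup>2) / x\<^sup>2) * u x) (at x)" by simp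
    show "u x = 0 \<longleftrightarrow> bessel_J \<nu> (complex_of_real x) = 0"
      using x \<nu> by (simp add: u_def bessel_J_of_real_eq_0_iff)
  qed
qed


section \<open>Symmetry and spacing of the zeros\<close>

text \<open>The set of zeros is symmetric, so the reversed and negated sequence enumerates it in
  increasing order as well, and such an enumeration is unique.\<close>

lemma ordered_bessel_zeros_odd:
  assumes \<nu>: "0 < \<nu>" and \<omega>: "ordered_bessel_zeros \<nu> \<omega>"
  shows "\<omega> (- k) = - \<omega> k"
proof -
  let ?Z = "{x. bessel_J \<nu> (complex_of_real x) = 0}"
  have sym: "bessel_J \<nu> (complex_of_real (- x)) = 0 \<longleftrightarrow> bessel_J \<nu> (complex_of_real x) = 0" for x
    by (cases "x = 0") (simp_all only: bessel_J_of_real_eq_0_iff[OF \<nu>] neg_equal_0_iff_equal power2_minus minus_zero simp_thms)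
  have w: "strict_mono \<omega>" "\<omega> 0 = 0" "range \<omega> = ?Z"
    using \<omega> by (auto simp: ordered_bessel_zeros_def)
  have "ordered_bessel_zeros \<nu> (\<lambda>k. - \<omega> (- k))"
    unfolding ordered_bessel_zeros_def
  proof (intro conjI)
    show "strict_mono (\<lambda>k. - \<omega> (- k))"
      by (rule strict_monoI) (simp add: strict_monoD[OF w(1)])
    show "- \<omega> (- 0) = 0" using w(2) by simp
    show "range (\<lambda>k. - \<omega> (- k)) = ?Z"
    proof (intro set_eqI iffI)
      fix x assume "x \<in> range (\<lambda>k. - \<omega> (- k))"
      then obtain k where "- x = \<omega> (- k)" by auto
      then have "- x \<in> range \<omega>" by auto
      then show "x \<in> ?Z" using w(3) sym[of x] by auto
    next
      fix x assume "x \<in> ?Z"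
      then have "- x \<in> range \<omega>" using w(3) sym[of x] by auto
      then obtain k where "- x = \<omega> k" by auto
      then have "x = - \<omega> (- (- k))" by simp
      then show "x \<in> range (\<lambda>k. - \<omega> (- k))" by blast
    qed
  qed
  from ordered_bessel_zeros_unique[OF \<omega> this] have "\<omega> = (\<lambda>k. - \<omega> (- k))" .
  then have "\<omega> k = - \<omega> (- k)" by (rule fun_cong)
  then show ?thesis by simp
qed

text \<open>The potential of the normal form lies within 1/\<omega>_k^2 of 1 beyond \<omega>_k. The
  Sturm bounds ask for the square of a frequency; 1 + 1/\<omega>_k^2 and 1 - 1/\<omega>_k^2 are
  taken as the frequencies themselves, since squaring only moves them further away from 1, and no
  square roots appear.\<close>

lemma bessel_zero_gap:
  assumes \<nu>: "0 < \<nu>" "\<nu> < 1" and \<omega>: "ordered_bessel_zeros \<nu> \<omega>" and k: "1 \<le> k"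
  shows "pi / (1 + 1 / (\<omega> k)\<^sup>2) \<le> \<omega> (k + 1) - \<omega> k"
    and "1 < \<omega> k \<Longrightarrow> \<omega> (k + 1) - \<omega> k \<le> pi / (1 - 1 / (\<omega> k)\<^sup>2)"
proof -
  let ?a = "\<omega> k" let ?b = "\<omega> (k + 1)"
  have w: "strict_mono \<omega>" "\<omega> 0 = 0" "range \<omega> = {x. bessel_J \<nu> (complex_of_real x) = 0}"
    using \<omega> by (auto simp: ordered_bessel_zeros_def)
  have a0: "0 < ?a" using strict_monoD[OF w(1), of 0 k] w(2) k by simp
  have ab: "?a < ?b" using strict_monoD[OF w(1), of k "k + 1"] by simp
  obtain u u' where
    u: "\<And>x. 0 < x \<Longrightarrow> (u has_real_derivative u' x) (at x)" and
    u': "\<And>x. 0 < x \<Longrightarrow> (u' has_real_derivative - (1 + (1/4 - \<nu>\<^sup>2) / x\<^sup>2) * u x) (at x)" and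
    z: "\<And>x. 0 < x \<Longrightarrow> u x = 0 \<longleftrightarrow> bessel_J \<nu> (complex_of_real x) = 0"
    using bessel_normal_form[OF \<nu>(1)] by blast
  have zab: "u ?a = 0" "u ?b = 0" using z[of ?a] z[of ?b] a0 ab w(3) by auto
  have nz: "u x \<noteq> 0" if x: "x \<in> {?a<..<?b}" for x
  proof
    assume "u x = 0"
    then have "x \<in> range \<omega>" using z[of x] x a0 w(3) by auto
    then obtain i where "x = \<omega> i" by auto
    then have "k < i" "i < k + 1" using x strict_mono_less[OF w(1)] by auto
    then show False by simp
  qed
  have cont: "continuous_on {x..y} u" if "x \<in> {?a<..<?b}" for x y
    using that a0 by (intro continuous_at_imp_continuous_on ballI DERIV_isCont[OF u]) auto
  define m where "m = (?a + ?b) / 2"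
  have m: "m \<in> {?a<..<?b}" using ab by (auto simp: m_def)
  \<comment> \<open>The comparison wants a positive solution, so u is multiplied by its sign at the
    midpoint; by the intermediate value theorem this sign persists between the two zeros.\<close>
  define s where "s = sgn (u m)"
  have s: "s \<noteq> 0" using nz[OF m] by (simp add: s_def sgn_if)
  have pos: "0 < s * u x" if x: "x \<in> {?a<..<?b}" for x
  proof (rule ccontr)
    assume neg: "\<not> 0 < s * u x"
    have "0 < s * u m" using nz[OF m] by (simp add: s_def sgn_if)
    then have "\<exists>y. min x m \<le> y \<and> y \<le> max x m \<and> s * u y = 0"
      using neg IVT'[of "\<lambda>y. s * u y" x 0 m, OF _ _ _ continuous_on_mult_left[OF cont[OF x]]]
        IVT2'[of "\<lambda>y. s * u y" x 0 m, OF _ _ _ continuous_on_mult_left[OF cont[OF m]]]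
      by (cases "x \<le> m") (simp_all add: min_def max_def)
    then obtain y where y: "min x m \<le> y" "y \<le> max x m" "s * u y = 0" by blast
    then have "y \<in> {?a<..<?b}" using x m by (auto simp: min_def max_def split: if_splits)
    then show False using nz[of y] y(3) s by simp
  qed
  have q: "\<bar>(1/4 - \<nu>\<^sup>2) / x\<^sup>2\<bar> \<le> 1 / ?a\<^sup>2" if x: "x \<in> {?a..?b}" for x
  proof -
    have "\<nu>\<^sup>2 \<le> 1" using \<nu> power_mono[of \<nu> 1 2] by simp
    then have "\<bar>1/4 - \<nu>\<^sup>2\<bar> \<le> 1" using zero_le_power2[of \<nu>] by linarith
    moreover have "?a\<^sup>2 \<le> x\<^sup>2" using x a0 by (intro power_mono) auto
    ultimately show ?thesis using a0 by (simp add: abs_divide) (intro frac_le, auto)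
  qed
  have su: "((\<lambda>x. s * u x) has_real_derivative s * u' x) (at x)"
    and su': "((\<lambda>x. s * u' x) has_real_derivative - (1 + (1/4 - \<nu>\<^sup>2) / x\<^sup>2) * (s * u x)) (at x)"
    if "x \<in> {?a..?b}" for x
    using that a0 DERIV_cmult[OF u, of x s] DERIV_cmult[OF u', of x s] by (auto simp: mult_ac)
  show "pi / (1 + 1 / ?a\<^sup>2) \<le> ?b - ?a"
  proof (rule sturm_gap_lower[OF ab _ su su' _ _ _ pos])
    fix x assume "x \<in> {?a..?b}"
    from q[OF this] have "1 + (1/4 - \<nu>\<^sup>2) / x\<^sup>2 \<le> 1 + 1 / ?a\<^sup>2" by linarith
    also have "\<dots> \<le> (1 + 1 / ?a\<^sup>2)\<^sup>2" by (rule self_le_power) auto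
    finally show "1 + (1/4 - \<nu>\<^sup>2) / x\<^sup>2 \<le> (1 + 1 / ?a\<^sup>2)\<^sup>2" .
  qed (use zab in \<open>auto intro: add_pos_nonneg\<close>)
  assume a1: "1 < ?a"
  then have r: "0 < 1 - 1 / ?a\<^sup>2" by (simp add: one_less_power)
  show "?b - ?a \<le> pi / (1 - 1 / ?a\<^sup>2)"
  proof (rule sturm_gap_upper[OF r su su' _ _ pos])
    fix x assume "x \<in> {?a..?b}"
    from q[OF this] have "1 - 1 / ?a\<^sup>2 \<le> 1 + (1/4 - \<nu>\<^sup>2) / x\<^sup>2" by linarith
    moreover have "(1 - 1 / ?a\<^sup>2)\<^sup>2 \<le> 1 - 1 / ?a\<^sup>2"
      using power_decreasing[of 1 2 "1 - 1 / ?a\<^sup>2"] r by simp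
    ultimately show "(1 - 1 / ?a\<^sup>2)\<^sup>2 \<le> 1 + (1/4 - \<nu>\<^sup>2) / x\<^sup>2" by linarith
  qed (use zab in auto)
qed

lemma bessel_zero_linear_lower:
  assumes \<nu>: "0 < \<nu>" "\<nu> < 1" and \<omega>: "ordered_bessel_zeros \<nu> \<omega>"
  obtains g where "0 < g" "\<And>k. 1 \<le> k \<Longrightarrow> g * real_of_int k \<le> \<omega> k"
proof
  have w: "strict_mono \<omega>" "\<omega> 0 = 0"
    using \<omega> by (auto simp: ordered_bessel_zeros_def)
  have w1: "0 < \<omega> 1" using strict_monoD[OF w(1), of 0 1] w(2) by simp
  \<comment> \<open>The lower bound for a gap increases with \<omega>_k, so its value at k = 1
    serves for all later gaps; the minimum with \<omega>_1 starts the induction.\<close>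
  define g where "g = min (\<omega> 1) (pi / (1 + 1 / (\<omega> 1)\<^sup>2))"
  show "0 < g" using w1 by (auto simp: g_def intro!: divide_pos_pos add_pos_nonneg)
  fix k :: int assume "1 \<le> k"
  then show "g * real_of_int k \<le> \<omega> k"
  proof (induction k rule: int_ge_induct)
    case base
    then show ?case by (simp add: g_def)
  next
    case (step k)
    have "\<omega> 1 \<le> \<omega> k" using step(1) strict_mono_less_eq[OF w(1)] by simp
    then have "1 / (\<omega> k)\<^sup>2 \<le> 1 / (\<omega> 1)\<^sup>2" using w1 by (intro divide_left_mono power_mono) auto
    then have "pi / (1 + 1 / (\<omega> 1)\<^sup>2) \<le> pi / (1 + 1 / (\<omega> k)\<^sup>2)"
      by (intro divide_left_mono mult_pos_pos) (auto intro: add_pos_nonneg)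
    also have "\<dots> \<le> \<omega> (k + 1) - \<omega> k" by (rule bessel_zero_gap(1)[OF \<nu> \<omega> step(1)])
    finally have "g \<le> \<omega> (k + 1) - \<omega> k" by (simp add: g_def)
    then show ?case using step(2) by (simp add: algebra_simps)
  qed
qed

text \<open>The error of aliasing. Raising the frequency in sin(\<omega>(2t - 1)) by exactly pi n
  changes the phase at t = i/n by 2 pi i - pi n, which amounts to the sign (-1)^n.\<close>

abbreviation zero_drift :: "(int \<Rightarrow> real) \<Rightarrow> nat \<Rightarrow> nat \<Rightarrow> real" where
  "zero_drift \<omega> j n \<equiv> \<omega> (int j + int n) - \<omega> (int j) - pi * real n"

text \<open>Each gap differs from pi by O(1/k^2), and from j on these deviations add up to O(1/j)
  whatever n is, because 1/x^2 <= 1/(x - 1) - 1/x telescopes.\<close>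

lemma bessel_zero_spacing:
  assumes \<nu>: "0 < \<nu>" "\<nu> < 1" and \<omega>: "ordered_bessel_zeros \<nu> \<omega>"
  obtains D k0 where "0 < D" "1 \<le> k0"
    "\<And>j n :: nat. k0 \<le> j \<Longrightarrow> \<bar>\<omega> (int j + int n) - \<omega> (int j) - pi * real n\<bar> \<le> D / real j"
proof -
  obtain g where g: "0 < g" "\<And>k. 1 \<le> k \<Longrightarrow> g * real_of_int k \<le> \<omega> k"
    using bessel_zero_linear_lower[OF \<nu> \<omega>] by blast
  \<comment> \<open>From \<open>k0\<close> on the zeros are at least 2, so that e = 1/\<omega>_k^2
    <= 1/4 and both bounds on a gap are within 2 pi e of pi. This accounts for D/2 per gap; the
    other factor 2 in \<open>D\<close> pays for 1/(j - 1) <= 2/j.\<close>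
  define k0 where "k0 = max 2 (nat \<lceil>2 / g\<rceil>)"
  define D where "D = 4 * pi / g\<^sup>2"
  have gap: "\<bar>\<omega> (int k + 1) - \<omega> (int k) - pi\<bar> \<le> (D / 2) / (real k)\<^sup>2" if k: "k0 \<le> k" for k
  proof -
    let ?a = "\<omega> (int k)"
    have k2: "2 \<le> k" "2 / g \<le> real k" using k by (simp_all add: k0_def)
    have "2 \<le> g * real k" using k2(2) g(1) by (simp add: field_simps)
    then have a: "2 \<le> ?a" "g * real k \<le> ?a" using g(2)[of "int k"] k2(1) by auto
    define e where "e = 1 / ?a\<^sup>2"
    have e: "0 < e" "e \<le> 1 / 4"
      using a(1) power_mono[of 2 ?a 2] by (auto simp: e_def field_simps)
    have e': "e \<le> 1 / (g\<^sup>2 * (real k)\<^sup>2)"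
      unfolding e_def power_mult_distrib[symmetric]
      using a g(1) k2 by (intro divide_left_mono power_mono) auto
    have "pi / (1 + e) \<le> \<omega> (int k + 1) - ?a" "\<omega> (int k + 1) - ?a \<le> pi / (1 - e)"
      unfolding e_def using bessel_zero_gap[OF \<nu> \<omega>, of "int k"] k2 a(1) by auto
    moreover have "pi - pi * (2 * e) \<le> pi / (1 + e)"
    proof -
      have "(1 - 2 * e) * (1 + e) \<le> 1" using e by (auto simp: algebra_simps)
      then have "pi * ((1 - 2 * e) * (1 + e)) \<le> pi * 1" by (intro mult_left_mono) auto
      then show ?thesis using e by (simp add: field_simps)
    qed
    moreover have "pi / (1 - e) \<le> pi + pi * (2 * e)"
    proof -
      have "2 * e * e \<le> 1 * e" using e by (intro mult_right_mono) auto
      then have "1 \<le> (1 + 2 * e) * (1 - e)" by (simp add: algebra_simps)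
      then have "pi * 1 \<le> pi * ((1 + 2 * e) * (1 - e))" by (intro mult_left_mono) auto
      then show ?thesis using e by (simp add: field_simps)
    qed
    ultimately have "\<bar>\<omega> (int k + 1) - ?a - pi\<bar> \<le> pi * (2 * e)" by linarith
    also have "\<dots> \<le> pi * (2 * (1 / (g\<^sup>2 * (real k)\<^sup>2)))" using e' by (intro mult_left_mono) auto
    finally show ?thesis by (simp add: D_def mult.commute)
  qed
  have sum: "\<bar>zero_drift \<omega> j n\<bar> \<le> D / 2 * (1 / (real j - 1) - 1 / (real j + real n - 1))"
    if j: "k0 \<le> j" for j n
  proof (induction n)
    case (Suc n)
    have j2: "2 \<le> j" using j by (simp add: k0_def)
    define x where "x = real j + real n"
    have x: "2 \<le> x" using j2 by (simp add: x_def)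
    have "\<bar>\<omega> (int j + int (Suc n)) - \<omega> (int j) - pi * real (Suc n)\<bar>
        \<le> \<bar>\<omega> (int j + int n) - \<omega> (int j) - pi * real n\<bar> + \<bar>\<omega> (int (j + n) + 1) - \<omega> (int (j + n)) - pi\<bar>"
      by (simp add: algebra_simps)
    also have "\<dots> \<le> D / 2 * (1 / (real j - 1) - 1 / (x - 1)) + (D / 2) / x\<^sup>2"
      using Suc gap[of "j + n"] j by (intro add_mono) (auto simp: x_def)
    also have "(D / 2) / x\<^sup>2 \<le> D / 2 * (1 / (x - 1) - 1 / x)"
    proof -
      have "1 / x\<^sup>2 \<le> 1 / (x - 1) - 1 / x" using x by (simp add: field_simps power2_eq_square)
      then have "D / 2 * (1 / x\<^sup>2) \<le> D / 2 * (1 / (x - 1) - 1 / x)" using g by (intro mult_left_mono) (auto simp: D_def)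
      then show ?thesis by simp
    qed
    finally show ?case by (simp add: x_def algebra_simps)
  qed simp
  show ?thesis
  proof
    show "0 < D" using g by (simp add: D_def)
    show "1 \<le> k0" by (simp add: k0_def)
    fix j n :: nat assume j: "k0 \<le> j"
    have j2: "2 \<le> j" using j by (simp add: k0_def)
    note sum[OF j, of n]
    also have "D / 2 * (1 / (real j - 1) - 1 / (real j + real n - 1)) \<le> D / 2 * (2 / real j)"
    proof (intro mult_left_mono)
      have "1 / (real j - 1) \<le> 2 / real j" using j2 by (simp add: field_simps)
      moreover have "0 \<le> 1 / (real j + real n - 1)" using j2 by simp
      ultimately show "1 / (real j - 1) - 1 / (real j + real n - 1) \<le> 2 / real j" by linarith
    qed (use g in \<open>simp add: D_def\<close>)
    finally show "\<bar>zero_drift \<omega> j n\<bar> \<le> D / real j" by simp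
  qed
qed

section \<open>The autocovariance of fractional Gaussian noise\<close>

text \<open>The two unit increments are mean values of a nondecreasing derivative. The derivative is
  asked for in the open interval only, because x^p with p < 1 has none at 0.\<close>

lemma second_difference_nonneg:
  fixes f f' :: "real \<Rightarrow> real"
  assumes cont: "continuous_on {a..a + 2} f"
    and der: "\<And>x. a < x \<Longrightarrow> x < a + 2 \<Longrightarrow> (f has_real_derivative f' x) (at x)"
    and mono: "\<And>x y. a < x \<Longrightarrow> x \<le> y \<Longrightarrow> y < a + 2 \<Longrightarrow> f' x \<le> f' y"
  shows "0 \<le> f a - 2 * f (a + 1) + f (a + 2)"
proof -
  have diff: "f differentiable (at x)" if "a < x" "x < a + 2" for x
    using der[OF that] unfolding real_differentiable_def by blast
  have "\<exists>l z. a < z \<and> z < a + 1 \<and> DERIV f z :> l \<and> f (a + 1) - f a = (a + 1 - a) * l"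
    using diff by (intro MVT continuous_on_subset[OF cont]) auto
  then obtain l z where z: "a < z" "z < a + 1" "DERIV f z :> l" "f (a + 1) - f a = l" by auto
  have "\<exists>l z. a + 1 < z \<and> z < a + 2 \<and> DERIV f z :> l \<and> f (a + 2) - f (a + 1) = (a + 2 - (a + 1)) * l"
    using diff by (intro MVT continuous_on_subset[OF cont]) auto
  then obtain m w where w: "a + 1 < w" "w < a + 2" "DERIV f w :> m" "f (a + 2) - f (a + 1) = m" by auto
  have "l = f' z" by (rule DERIV_unique[OF z(3) der]) (use z in auto)
  moreover have "m = f' w" by (rule DERIV_unique[OF w(3) der]) (use w in auto)
  ultimately have "l \<le> m" using mono[of z w] z w by simp
  then show ?thesis using z w by simp
qed

lemma nondecreasing_on_pos:
  fixes f f' :: "real \<Rightarrow> real"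
  assumes "0 < x" "x \<le> y"
    and "\<And>x. 0 < x \<Longrightarrow> (f has_real_derivative f' x) (at x)" "\<And>x. 0 < x \<Longrightarrow> 0 \<le> f' x"
  shows "f x \<le> f y"
proof (rule DERIV_nonneg_imp_nondecreasing[OF assms(2)])
  fix z assume "x \<le> z"
  then have "0 < z" using assms(1) by simp
  then show "\<exists>l. DERIV f z :> l \<and> 0 \<le> l" using assms(3,4) by blast
qed

lemma DERIV_powr_shift:
  fixes x :: real
  assumes "0 < x" "0 \<le> c"
  shows "((\<lambda>x. (x + c) powr r) has_real_derivative r * (x + c) powr (r - 1)) (at x)"
  using assms by (auto intro!: derivative_eq_intros)

lemma continuous_on_powr_shift:
  fixes a c r :: real
  assumes "0 \<le> a" "0 \<le> c" "0 < r"
  shows "continuous_on {a..b} (\<lambda>x. (x + c) powr r)"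
  using assms by (intro continuous_on_powr' continuous_intros) auto

context
  fixes p a :: real
  assumes p: "1 \<le> p" "p < 2" and a: "0 \<le> a"
begin

lemma powr_second_difference_nonneg: "0 \<le> a powr p - 2 * (a + 1) powr p + (a + 2) powr p"
proof (rule second_difference_nonneg[where f = "\<lambda>x. x powr p" and f' = "\<lambda>x. p * x powr (p - 1)"])
  show "continuous_on {a..a + 2} (\<lambda>x. x powr p)"
    using continuous_on_powr_shift[of a 0 p] a p by simp
  fix x assume x: "a < x"
  show "((\<lambda>x. x powr p) has_real_derivative p * x powr (p - 1)) (at x)"
    using DERIV_powr_shift[of x 0 p] a x by simp
  show "p * x powr (p - 1) \<le> p * y powr (p - 1)" if "x \<le> y" for y
    using that p a x by (intro mult_left_mono powr_mono2) auto
qed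

text \<open>The third difference is minus the second difference of x^p - (x + 1)^p, which is convex
  because x^(p-2) decreases.\<close>

lemma powr_third_difference_nonpos:
  "(a + 3) powr p - 3 * (a + 2) powr p + 3 * (a + 1) powr p - a powr p \<le> 0"
proof -
  define f where "f x = (x + 0) powr p - (x + 1) powr p" for x :: real
  define f' where "f' x = p * (x + 0) powr (p - 1) - p * (x + 1) powr (p - 1)" for x :: real
  have "0 \<le> f a - 2 * f (a + 1) + f (a + 2)"
  proof (rule second_difference_nonneg[where f' = f'])
    show "continuous_on {a..a + 2} f"
      unfolding f_def using a p by (intro continuous_intros continuous_on_powr_shift) auto
    fix x assume x: "a < x"
    show "(f has_real_derivative f' x) (at x)"
      unfolding f_def f'_def using a x by (intro DERIV_diff DERIV_powr_shift) auto
    fix y assume y: "x \<le> y"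
    show "f' x \<le> f' y"
    proof (rule nondecreasing_on_pos[OF _ y])
      show "0 < x" using a x by simp
      fix z :: real assume z: "0 < z"
      show "(f' has_real_derivative p * ((p - 1) * (z + 0) powr (p - 1 - 1))
          - p * ((p - 1) * (z + 1) powr (p - 1 - 1))) (at z)"
        unfolding f'_def using z by (intro DERIV_diff DERIV_cmult DERIV_powr_shift) auto
      have "(z + 1) powr (p - 1 - 1) \<le> (z + 0) powr (p - 1 - 1)"
        using z p by (intro powr_mono2') auto
      then have "p * ((p - 1) * (z + 1) powr (p - 1 - 1)) \<le> p * ((p - 1) * (z + 0) powr (p - 1 - 1))"
        using p by (intro mult_left_mono) auto
      then show "0 \<le> p * ((p - 1) * (z + 0) powr (p - 1 - 1)) - p * ((p - 1) * (z + 1) powr (p - 1 - 1))"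
        by simp
    qed
  qed
  then show ?thesis by (simp add: f_def add_ac)
qed

text \<open>With \<open>D p\<close> the second difference of x^p, two derivatives give p(p - 1)
  times the second difference of the convex function x^(p-2); hence \<open>D p\<close> is itself
  convex.\<close>

lemma powr_fourth_difference_nonneg:
  "0 \<le> (a + 4) powr p - 4 * (a + 3) powr p + 6 * (a + 2) powr p - 4 * (a + 1) powr p + a powr p"
proof -
  define D where "D r x = (x + 2) powr r - 2 * (x + 1) powr r + (x + 0) powr r" for r x :: real
  have D: "(D r has_real_derivative r * D (r - 1) x) (at x)" if "0 < x" for r x
    unfolding D_def using that
    by (auto intro!: derivative_eq_intros DERIV_powr_shift simp: algebra_simps)
  have "0 \<le> D p a - 2 * D p (a + 1) + D p (a + 2)"
  proof (rule second_difference_nonneg[where f' = "\<lambda>x. p * D (p - 1) x"])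
    show "continuous_on {a..a + 2} (D p)"
      unfolding D_def using a p by (intro continuous_intros continuous_on_powr_shift) auto
    fix x assume x: "a < x"
    show "(D p has_real_derivative p * D (p - 1) x) (at x)" using D a x by simp
    fix y assume y: "x \<le> y"
    have "D (p - 1) x \<le> D (p - 1) y"
    proof (rule nondecreasing_on_pos[OF _ y D])
      show "0 < x" using a x by simp
      fix z :: real assume z: "0 < z"
      have "0 \<le> z powr (p - 2) - 2 * (z + 1) powr (p - 2) + (z + 2) powr (p - 2)"
      proof (rule second_difference_nonneg[where f = "\<lambda>x. x powr (p - 2)" and f' = "\<lambda>x. (p - 2) * x powr (p - 2 - 1)"])
        show "continuous_on {z..z + 2} (\<lambda>x. x powr (p - 2))"
          using z by (intro continuous_intros) auto
        fix x assume x: "z < x"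
        show "((\<lambda>x. x powr (p - 2)) has_real_derivative (p - 2) * x powr (p - 2 - 1)) (at x)"
          using z x by (auto intro!: derivative_eq_intros)
        show "(p - 2) * x powr (p - 2 - 1) \<le> (p - 2) * y powr (p - 2 - 1)" if "x \<le> y" for y
          using that z x p by (intro mult_left_mono_neg powr_mono2') auto
      qed
      then show "0 \<le> (p - 1) * D (p - 1 - 1) z" using p by (intro mult_nonneg_nonneg) (auto simp: D_def)
    qed
    then show "p * D (p - 1) x \<le> p * D (p - 1) y" using p by simp
  qed
  then show ?thesis by (simp add: D_def add_ac)
qed

end

text \<open>For p = 2H this is twice \<open>\<gamma> 0 - 2 * \<gamma> 1 + \<gamma> 2\<close>, the
  constant of the long-memory bound. It vanishes at p = 2, so it suffices that 4 * 2^p - 3^p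
  increases up to there.\<close>

lemma four_mult_two_powr_less:
  fixes p :: real
  assumes "1 \<le> p" "p < 2"
  shows "0 < 7 - 4 * 2 powr p + 3 powr p"
proof -
  define g where "g p = 4 * 2 powr p - 3 powr p" for p :: real
  have "g p < g 2"
  proof (rule DERIV_pos_imp_increasing[OF assms(2)])
    fix x :: real assume x: "p \<le> x" "x \<le> 2"
    have "(3::real) powr x = 2 powr x * (3/2) powr x"
      by (simp add: powr_mult[symmetric])
    also have "\<dots> \<le> 2 powr x * (3/2) powr 2" using x by (intro mult_left_mono powr_mono) auto
    finally have A: "3 powr x \<le> (9/4) * 2 powr x" by (simp add: power2_eq_square powr_numeral)
    \<comment> \<open>With 3^x <= (9/4) 2^x the derivative of g is positive as soon as 16 ln 2 > 9
      ln 3, that is 2^16 = 65536 > 3^9 = 19683.\<close>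
    have "9 * ln 3 = ln (3 ^ 9 :: real)" by (subst ln_realpow) auto
    also have "\<dots> < ln (2 ^ 16 :: real)" by (subst ln_less_cancel_iff) auto
    also have "\<dots> = 16 * ln 2" by (subst ln_realpow) auto
    finally have B: "9 * ln 3 < 16 * ln (2::real)" .
    have "ln 3 * 3 powr x \<le> ln 3 * ((9/4) * 2 powr x)" using A by (intro mult_left_mono) auto
    also have "\<dots> = (9 * ln 3) * (2 powr x / 4)" by simp
    also have "\<dots> < (16 * ln 2) * (2 powr x / 4)" using B by (intro mult_strict_right_mono) auto
    finally have "0 < 4 * (ln 2 * 2 powr x) - ln 3 * 3 powr x" by simp
    moreover have "DERIV g x :> 4 * (ln 2 * 2 powr x) - ln 3 * 3 powr x"
      unfolding g_def by (auto intro!: derivative_eq_intros simp: powr_def)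
    ultimately show "\<exists>l. DERIV g x :> l \<and> 0 < l" by blast
  qed
  then show ?thesis by (simp add: g_def powr_numeral)
qed

section \<open>Sign, monotonicity and convexity of the autocovariance\<close>

lemma fgn_autocovariance_minus: "fgn_autocovariance H (- k) = fgn_autocovariance H k"
  by (simp add: fgn_autocovariance_def abs_minus_commute add.commute)

lemma fgn_autocovariance_0: "fgn_autocovariance H 0 = 1"
  by (simp add: fgn_autocovariance_def)

lemma fgn_autocovariance_Suc:
  "fgn_autocovariance H (int (Suc k))
    = ((real k + 2) powr (2 * H) - 2 * (real k + 1) powr (2 * H) + real k powr (2 * H)) / 2"
  by (simp add: fgn_autocovariance_def add_ac)

lemma fgn_autocovariance_nonneg:
  assumes "1/2 \<le> H" "H < 1"
  shows "0 \<le> fgn_autocovariance H (int (Suc k))"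
  using powr_second_difference_nonneg[of "2 * H" "real k"] assms
  unfolding fgn_autocovariance_Suc by simp

lemma fgn_autocovariance_decreasing:
  assumes "1/2 \<le> H" "H < 1"
  shows "fgn_autocovariance H (int (Suc (Suc k))) \<le> fgn_autocovariance H (int (Suc k))"
  using powr_third_difference_nonpos[of "2 * H" "real k"] assms
  unfolding fgn_autocovariance_Suc by (simp add: add_ac)

lemma fgn_autocovariance_convex:
  assumes "1/2 \<le> H" "H < 1"
  shows "0 \<le> fgn_autocovariance H (int (Suc k)) - 2 * fgn_autocovariance H (int (Suc (Suc k)))
      + fgn_autocovariance H (int (Suc (Suc (Suc k))))"
  using powr_fourth_difference_nonneg[of "2 * H" "real k"] assms
  unfolding fgn_autocovariance_Suc by (simp add: field_simps)

lemma fgn_autocovariance_nonpos: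
  assumes "0 < H" "H < 1/2"
  shows "fgn_autocovariance H (int (Suc k)) \<le> 0"
proof -
  let ?p = "2 * H"
  have "0 \<le> - (real k powr ?p) - 2 * - ((real k + 1) powr ?p) + - ((real k + 2) powr ?p)"
  proof (rule second_difference_nonneg[where f = "\<lambda>x. - (x powr ?p)" and f' = "\<lambda>x. - (?p * x powr (?p - 1))"])
    show "continuous_on {real k..real k + 2} (\<lambda>x. - (x powr ?p))"
      using continuous_on_minus[OF continuous_on_powr_shift[of "real k" 0 ?p]] assms by simp
    fix x assume x: "real k < x"
    show "((\<lambda>x. - (x powr ?p)) has_real_derivative - (?p * x powr (?p - 1))) (at x)"
      using DERIV_minus[OF DERIV_powr_shift[of x 0 ?p]] x by simp
    show "- (?p * x powr (?p - 1)) \<le> - (?p * y powr (?p - 1))" if "x \<le> y" for y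
      using that assms x by (intro le_imp_neg_le mult_left_mono powr_mono2') auto
  qed
  then show ?thesis unfolding fgn_autocovariance_Suc by simp
qed

section \<open>Quadratic forms of the noise covariance\<close>

text \<open>The variance of the sum of a_t X_t over J when X is centered with covariance K.\<close>

definition cov_form :: "('t \<Rightarrow> 't \<Rightarrow> real) \<Rightarrow> 't set \<Rightarrow> ('t \<Rightarrow> real) \<Rightarrow> real" where
  "cov_form K J a = (\<Sum>s\<in>J. \<Sum>t\<in>J. a s * a t * K s t)"

abbreviation fgn_cov :: "real \<Rightarrow> nat \<Rightarrow> nat \<Rightarrow> real" where
  "fgn_cov H i k \<equiv> fgn_autocovariance H (int i - int k)"

text \<open>The distance |i - k| as a natural number, so that truncated subtraction makes j -
  \<open>nat_dist\<close> i k the triangular kernel max(j - |i - k|, 0).\<close>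

definition nat_dist :: "nat \<Rightarrow> nat \<Rightarrow> nat" where
  "nat_dist i k = (i - k) + (k - i)"

lemma fgn_autocovariance_nat_dist:
  "fgn_cov H i k = fgn_autocovariance H (int (nat_dist i k))"
  using fgn_autocovariance_minus[of H "int i - int k"]
  by (cases "i \<le> k") (auto simp: nat_dist_def of_nat_diff)

text \<open>The kernel counts the integers common to [i, i + j) and [k, k + j), so it is a Gram
  matrix of indicator functions, \<open>w i\<close> being that of [i, i + j).\<close>

lemma triangular_kernel_psd:
  fixes v :: "nat \<Rightarrow> real"
  shows "0 \<le> (\<Sum>i\<in>{1..n}. \<Sum>k\<in>{1..n}. v i * v k * real (j - nat_dist i k))"
proof -
  define w :: "nat \<Rightarrow> nat \<Rightarrow> real" where "w i z = of_bool (i \<le> z \<and> z < i + j)" for i z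
  have w: "real (j - nat_dist i k) = (\<Sum>z<n + j. w i z * w k z)" if "i \<in> {1..n}" "k \<in> {1..n}" for i k
  proof -
    have "(\<Sum>z<n + j. w i z * w k z) = (\<Sum>z<n + j. of_bool (z \<in> {max i k..<min i k + j}))"
      by (intro sum.cong) (auto simp: w_def)
    also have "\<dots> = real (card {max i k..<min i k + j})"
    proof -
      have "{..<n + j} \<inter> {z. z \<in> {max i k..<min i k + j}} = {max i k..<min i k + j}" using that by auto
      then show ?thesis by (simp only: sum_of_bool_eq finite_lessThan)
    qed
    also have "card {max i k..<min i k + j} = j - nat_dist i k"
      by (auto simp: nat_dist_def max_def min_def)
    finally show ?thesis by simp
  qed
  have "(\<Sum>i\<in>{1..n}. \<Sum>k\<in>{1..n}. v i * v k * real (j - nat_dist i k))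
      = (\<Sum>i\<in>{1..n}. \<Sum>k\<in>{1..n}. \<Sum>z<n + j. (v i * w i z) * (v k * w k z))"
    by (intro sum.cong refl) (simp add: w sum_distrib_left mult_ac)
  also have "\<dots> = (\<Sum>i\<in>{1..n}. \<Sum>z<n + j. \<Sum>k\<in>{1..n}. (v i * w i z) * (v k * w k z))"
    by (intro sum.cong refl sum.swap)
  also have "\<dots> = (\<Sum>z<n + j. \<Sum>i\<in>{1..n}. \<Sum>k\<in>{1..n}. (v i * w i z) * (v k * w k z))"
    by (rule sum.swap)
  also have "\<dots> = (\<Sum>z<n + j. (\<Sum>i\<in>{1..n}. v i * w i z)\<^sup>2)"
    by (simp add: power2_eq_square sum_product)
  also have "0 \<le> \<dots>" by (intro sum_nonneg) auto
  finally show ?thesis .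
qed

text \<open>Polya's criterion: a convex sequence decreasing to a nonnegative limit is a mixture of triangular kernels.\<close>

lemma convex_kernel_lower_bound:
  fixes \<gamma> :: "nat \<Rightarrow> real" and v :: "nat \<Rightarrow> real"
  assumes nonneg: "\<And>k. 0 \<le> \<gamma> (Suc k)" and dec: "\<And>k. \<gamma> (Suc (Suc k)) \<le> \<gamma> (Suc k)"
    and conv: "\<And>k. 0 \<le> \<gamma> (Suc k) - 2 * \<gamma> (Suc (Suc k)) + \<gamma> (Suc (Suc (Suc k)))"
  shows "(\<gamma> 0 - 2 * \<gamma> 1 + \<gamma> 2) * (\<Sum>i\<in>{1..n}. (v i)\<^sup>2)
      \<le> (\<Sum>i\<in>{1..n}. \<Sum>k\<in>{1..n}. v i * v k * \<gamma> (nat_dist i k))"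
proof (cases "n = 0")
  case False
  define c where "c j = \<gamma> (j - 1) - 2 * \<gamma> j + \<gamma> (j + 1)" for j
  define T where "T j = (\<Sum>i\<in>{1..n}. \<Sum>k\<in>{1..n}. v i * v k * real (j - nat_dist i k))" for j
  have T: "0 \<le> T j" for j unfolding T_def by (rule triangular_kernel_psd)
  have c: "0 \<le> c j" if "2 \<le> j" for j
  proof -
    from le_Suc_ex[OF that] obtain k where "j = 2 + k" by blast
    then have "j = Suc (Suc k)" by simp
    with conv[of k] show ?thesis unfolding c_def by simp
  qed
  \<comment> \<open>Two summations by parts, written as an induction on m from m = d: \<gamma> is a
    constant plus triangular kernels whose weights are the second differences \<open>c j\<close>, up
    to a last triangle with a first difference as weight.\<close>
  have rep: "\<gamma> d = \<gamma> m + real (m - d) * (\<gamma> m - \<gamma> (Suc m)) + (\<Sum>j\<in>{1..m}. c j * real (j - d))"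
    if "d \<le> m" for d m
    using that
  proof (induction m rule: dec_induct)
    case base
    show ?case by simp
  next
    case (step m)
    have "real (Suc m - d) = real (m - d) + 1" using step by simp
    then show ?case using step(3) by (simp add: c_def algebra_simps)
  qed
  have "(\<Sum>i\<in>{1..n}. \<Sum>k\<in>{1..n}. v i * v k * \<gamma> (nat_dist i k))
      = (\<Sum>i\<in>{1..n}. \<Sum>k\<in>{1..n}. \<gamma> n * (v i * v k) + (\<gamma> n - \<gamma> (Suc n)) * (v i * v k * real (n - nat_dist i k))
          + (\<Sum>j\<in>{1..n}. c j * (v i * v k * real (j - nat_dist i k))))"
  proof (intro sum.cong refl)
    fix i k assume "i \<in> {1..n}" "k \<in> {1..n}"
    then have "nat_dist i k \<le> n" by (auto simp: nat_dist_def)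
    from rep[OF this] show "v i * v k * \<gamma> (nat_dist i k) = \<gamma> n * (v i * v k)
        + (\<gamma> n - \<gamma> (Suc n)) * (v i * v k * real (n - nat_dist i k))
        + (\<Sum>j\<in>{1..n}. c j * (v i * v k * real (j - nat_dist i k)))"
      by (simp add: distrib_left distrib_right sum_distrib_left mult_ac)
  qed
  also have "\<dots> = \<gamma> n * (\<Sum>i\<in>{1..n}. v i)\<^sup>2 + (\<gamma> n - \<gamma> (Suc n)) * T n + (\<Sum>j\<in>{1..n}. c j * T j)"
  proof -
    have "(\<Sum>i\<in>{1..n}. \<Sum>k\<in>{1..n}. \<Sum>j\<in>{1..n}. c j * (v i * v k * real (j - nat_dist i k)))
        = (\<Sum>i\<in>{1..n}. \<Sum>j\<in>{1..n}. \<Sum>k\<in>{1..n}. c j * (v i * v k * real (j - nat_dist i k)))"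
      by (intro sum.cong refl sum.swap)
    also have "\<dots> = (\<Sum>j\<in>{1..n}. \<Sum>i\<in>{1..n}. \<Sum>k\<in>{1..n}. c j * (v i * v k * real (j - nat_dist i k)))"
      by (rule sum.swap)
    moreover have "(\<Sum>i\<in>{1..n}. \<Sum>k\<in>{1..n}. \<gamma> n * (v i * v k)) = \<gamma> n * (\<Sum>i\<in>{1..n}. v i)\<^sup>2"
      unfolding power2_eq_square sum_product by (simp add: sum_distrib_left)
    ultimately show ?thesis
      by (simp add: sum.distrib T_def sum_distrib_left)
  qed
  finally have eq: "(\<Sum>i\<in>{1..n}. \<Sum>k\<in>{1..n}. v i * v k * \<gamma> (nat_dist i k)) = \<dots>" .
  \<comment> \<open>Every term except j = 1 is nonnegative and is dropped. The triangular kernel for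
    j = 1 is the identity matrix; its weight \<open>c 1\<close> is kept with whatever sign it
    has.\<close>
  have "c 1 * T 1 + (\<Sum>j\<in>{2..n}. c j * T j) = (\<Sum>j\<in>{1..n}. c j * T j)"
    using False by (simp add: sum.atLeast_Suc_atMost numeral_2_eq_2)
  moreover have "0 \<le> (\<Sum>j\<in>{2..n}. c j * T j)" using c T by (intro sum_nonneg mult_nonneg_nonneg) auto
  moreover have "0 \<le> \<gamma> n * (\<Sum>i\<in>{1..n}. v i)\<^sup>2" "0 \<le> (\<gamma> n - \<gamma> (Suc n)) * T n"
    using nonneg[of "n - 1"] dec[of "n - 1"] T False by auto
  ultimately have "c 1 * T 1 \<le> (\<Sum>i\<in>{1..n}. \<Sum>k\<in>{1..n}. v i * v k * \<gamma> (nat_dist i k))"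
    unfolding eq by linarith
  moreover have "T 1 = (\<Sum>i\<in>{1..n}. (v i)\<^sup>2)"
  proof -
    have "v i * v k * real (1 - nat_dist i k) = (if i = k then (v i)\<^sup>2 else 0)" for i k
      by (auto simp: nat_dist_def power2_eq_square)
    then show ?thesis unfolding T_def by simp
  qed
  ultimately show ?thesis by (simp add: c_def numeral_2_eq_2)
qed simp

text \<open>Convexity among the lags from 1 on comes from the fourth difference of powers; the
  second difference centered at lag 1, which involves the variance, becomes the constant.\<close>

lemma fgn_form_lower_bound_long_memory:
  assumes H: "1/2 \<le> H" "H < 1"
  obtains l where "0 < l" "\<And>n v. l * (\<Sum>i\<in>{1..n}. (v i)\<^sup>2)
      \<le> cov_form (fgn_cov H) {1..n} v"
proof
  define \<gamma> where "\<gamma> k = fgn_autocovariance H (int k)" for k :: nat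
  show "0 < \<gamma> 0 - 2 * \<gamma> 1 + \<gamma> 2"
    using four_mult_two_powr_less[of "2 * H"] H fgn_autocovariance_Suc[of H 0] fgn_autocovariance_Suc[of H 1]
    by (simp add: \<gamma>_def fgn_autocovariance_0 numeral_2_eq_2 field_simps)
  fix n and v :: "nat \<Rightarrow> real"
  show "(\<gamma> 0 - 2 * \<gamma> 1 + \<gamma> 2) * (\<Sum>i\<in>{1..n}. (v i)\<^sup>2)
      \<le> cov_form (fgn_cov H) {1..n} v"
    unfolding cov_form_def fgn_autocovariance_nat_dist \<gamma>_def[symmetric]
    using fgn_autocovariance_nonneg[OF H] fgn_autocovariance_decreasing[OF H] fgn_autocovariance_convex[OF H]
    by (intro convex_kernel_lower_bound) (simp_all add: \<gamma>_def)
qed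

lemma powr_increment_lower:
  assumes p: "0 < p" "p < 1" and m: "1 \<le> m" "m \<le> n"
  shows "p * real n powr (p - 1) \<le> real m powr p - (real m - 1) powr p"
proof -
  have "\<exists>l z. real m - 1 < z \<and> z < real m \<and> ((\<lambda>x. x powr p) has_real_derivative l) (at z)
      \<and> real m powr p - (real m - 1) powr p = (real m - (real m - 1)) * l"
  proof (rule MVT)
    show "continuous_on {real m - 1..real m} (\<lambda>x. x powr p)"
      using continuous_on_powr_shift[of "real m - 1" 0 p "real m"] m p by simp
    fix x assume "real m - 1 < x" "x < real m"
    then have "0 < x" using m by linarith
    then show "(\<lambda>x. x powr p) differentiable (at x)"
      using DERIV_powr_shift[of x 0 p] by (auto simp: real_differentiable_def)
  qed simp
  then obtain l z where z: "real m - 1 < z" "z < real m" "((\<lambda>x. x powr p) has_real_derivative l) (at z)"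
    "real m powr p - (real m - 1) powr p = l" by auto
  have z0: "0 < z" using z m by linarith
  have "l = p * z powr (p - 1)" using DERIV_unique[OF z(3)] DERIV_powr_shift[of z 0 p] z0 by simp
  moreover have "real n powr (p - 1) \<le> z powr (p - 1)" using z0 z m p by (intro powr_mono2') auto
  ultimately show ?thesis using z(4) p by simp
qed

text \<open>Off the diagonal the covariances are nonpositive, so v_i v_k <= (v_i^2 + v_k^2)/2 bounds
  the form below by row sums times v_i^2, and each row sum is at least 2H n^(2H-1).\<close>

lemma fgn_form_lower_bound_short_memory:
  assumes H: "0 < H" "H < 1/2"
  shows "2 * H * real n powr (2 * H - 1) * (\<Sum>i\<in>{1..n}. (v i)\<^sup>2)
      \<le> cov_form (fgn_cov H) {1..n} v"
proof -
  let ?p = "2 * H"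
  \<comment> \<open>The entries of a row are second differences of |x|^(2H)/2 and telescope to one
    increment at each end of the row. The absolute values let the induction on n pass through n <
    i.\<close>
  have row: "2 * (\<Sum>k\<in>{1..n}. fgn_cov H i k) = real i powr ?p - (real i - 1) powr ?p
      + (\<bar>real n - real i + 1\<bar> powr ?p - \<bar>real n - real i\<bar> powr ?p)" if i: "1 \<le> i" for i n
  proof (induction n)
    case (Suc n)
    define x where "x = real n - real i"
    have "2 * fgn_cov H i (Suc n) = \<bar>x\<bar> powr ?p - 2 * \<bar>x + 1\<bar> powr ?p + \<bar>x + 2\<bar> powr ?p"
    proof -
      have "\<bar>real_of_int (int i - int (Suc n)) + 1\<bar> = \<bar>x\<bar>" "\<bar>real_of_int (int i - int (Suc n))\<bar> = \<bar>x + 1\<bar>"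
        "\<bar>real_of_int (int i - int (Suc n)) - 1\<bar> = \<bar>x + 2\<bar>" by (simp_all add: x_def)
      then show ?thesis by (simp add: fgn_autocovariance_def)
    qed
    moreover have e: "real (Suc n) - real i = x + 1" by (simp add: x_def)
    ultimately show ?case using Suc unfolding e x_def[symmetric] by (simp add: add.commute)
  qed (use i in simp)
  have row': "?p * real n powr (?p - 1) \<le> (\<Sum>k\<in>{1..n}. fgn_cov H i k)" if i: "i \<in> {1..n}" for i
  proof -
    have "?p * real n powr (?p - 1) \<le> real i powr ?p - (real i - 1) powr ?p"
      using i H by (intro powr_increment_lower) auto
    moreover have "?p * real n powr (?p - 1) \<le> real (n - i + 1) powr ?p - (real (n - i + 1) - 1) powr ?p"
      using i H by (intro powr_increment_lower) auto
    ultimately show ?thesis using row[of i n] i by (simp add: of_nat_diff add_ac)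
  qed
  have sym: "fgn_cov H i k = fgn_cov H k i" for i k using fgn_autocovariance_minus[of H "int i - int k"] by simp
  have ge: "fgn_cov H i k * ((v i)\<^sup>2 + (v k)\<^sup>2) / 2 \<le> v i * v k * fgn_cov H i k" for i k
  proof (cases "i = k")
    case False
    then obtain d where "nat_dist i k = Suc d" by (cases "nat_dist i k") (auto simp: nat_dist_def)
    then have "fgn_cov H i k \<le> 0" using fgn_autocovariance_nonpos[OF H, of d] by (simp add: fgn_autocovariance_nat_dist)
    moreover have "v i * v k \<le> ((v i)\<^sup>2 + (v k)\<^sup>2) / 2" using sum_squares_bound[of "v i" "v k"] by simp
    ultimately have "fgn_cov H i k * (((v i)\<^sup>2 + (v k)\<^sup>2) / 2) \<le> fgn_cov H i k * (v i * v k)" by (intro mult_left_mono_neg)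
    then show ?thesis by (simp add: mult_ac)
  qed (simp add: power2_eq_square)
  have "2 * H * real n powr (2 * H - 1) * (\<Sum>i\<in>{1..n}. (v i)\<^sup>2)
      \<le> (\<Sum>i\<in>{1..n}. (\<Sum>k\<in>{1..n}. fgn_cov H i k) * (v i)\<^sup>2)"
    unfolding sum_distrib_left using row' by (intro sum_mono mult_right_mono) auto
  also have "\<dots> = (\<Sum>i\<in>{1..n}. \<Sum>k\<in>{1..n}. fgn_cov H i k * ((v i)\<^sup>2 + (v k)\<^sup>2) / 2)"
  proof -
    have "(\<Sum>i\<in>{1..n}. \<Sum>k\<in>{1..n}. fgn_cov H i k * (v k)\<^sup>2 / 2) = (\<Sum>i\<in>{1..n}. \<Sum>k\<in>{1..n}. fgn_cov H i k * (v i)\<^sup>2 / 2)"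
      by (subst sum.swap) (simp add: sym)
    moreover have "(\<Sum>i\<in>{1..n}. (\<Sum>k\<in>{1..n}. fgn_cov H i k) * (v i)\<^sup>2)
        = (\<Sum>i\<in>{1..n}. \<Sum>k\<in>{1..n}. fgn_cov H i k * (v i)\<^sup>2 / 2) + (\<Sum>i\<in>{1..n}. \<Sum>k\<in>{1..n}. fgn_cov H i k * (v i)\<^sup>2 / 2)"
      by (simp add: sum_distrib_right flip: sum.distrib add_divide_distrib) (simp add: mult.commute)
    ultimately show ?thesis by (simp add: distrib_left add_divide_distrib sum.distrib)
  qed
  also have "\<dots> \<le> (\<Sum>i\<in>{1..n}. \<Sum>k\<in>{1..n}. v i * v k * fgn_cov H i k)"
    by (intro sum_mono ge)
  finally show ?thesis unfolding cov_form_def .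
qed

text \<open>Positive correlation helps alternating sums: a new row adds the variance 1 and twice an
  alternating sum of a nonnegative decreasing sequence that starts with a minus sign, hence is at
  most 0.\<close>

lemma fgn_alternating_form_le:
  assumes H: "1/2 \<le> H" "H < 1"
  shows "(\<Sum>i<J. \<Sum>k<J. (-1) ^ i * (-1) ^ k * fgn_cov H i k) \<le> real J"
proof (induction J)
  case (Suc J)
  let ?S = "\<lambda>J. \<Sum>i<J. \<Sum>k<J. (-1) ^ i * (-1) ^ k * fgn_cov H i k"
  have sym: "fgn_cov H i k = fgn_cov H k i" for i k using fgn_autocovariance_minus[of H "int i - int k"] by simp
  define A where "A m = (\<Sum>d<m. (-1) ^ Suc d * fgn_autocovariance H (int (Suc d)))" for m
  \<comment> \<open>The sharper bound for odd m leaves room for the positive term that comes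
    next.\<close>
  have A: "A m \<le> 0 \<and> (odd m \<longrightarrow> A m \<le> - fgn_autocovariance H (int m))" for m
  proof (induction m)
    case (Suc m)
    show ?case
    proof (cases "even m")
      case True
      then show ?thesis using Suc fgn_autocovariance_nonneg[OF H, of m] by (simp add: A_def)
    next
      case False
      then obtain l where "m = Suc l" by (cases m) auto
      then show ?thesis using Suc False fgn_autocovariance_decreasing[OF H, of l] by (simp add: A_def)
    qed
  qed (simp add: A_def)
  have "(\<Sum>i<J. (-1) ^ i * (-1) ^ J * fgn_cov H i J) = (\<Sum>d<J. (-1) ^ (J - Suc d) * (-1) ^ J * fgn_cov H (J - Suc d) J)"
    by (rule sum.nat_diff_reindex[symmetric])
  also have "\<dots> = A J"
    unfolding A_def
  proof (intro sum.cong refl)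
    fix d assume "d \<in> {..<J}"
    then have J: "J = (J - Suc d) + Suc d" by simp
    have "(-1) ^ (J - Suc d) * (-1) ^ J = ((-1) ^ Suc d :: real)"
      by (subst (2) J) (simp only: power_add mult.assoc[symmetric] power_mult_distrib[symmetric], simp)
    moreover have "int (J - Suc d) - int J = - int (Suc d)" using J by linarith
    ultimately show "(-1) ^ (J - Suc d) * (-1) ^ J * fgn_cov H (J - Suc d) J = (-1) ^ Suc d * fgn_autocovariance H (int (Suc d))"
      by (simp only: fgn_autocovariance_minus)
  qed
  finally have B: "(\<Sum>i<J. (-1) ^ i * (-1) ^ J * fgn_cov H i J) = A J" .
  have "?S (Suc J) = ?S J + (\<Sum>i<J. (-1) ^ i * (-1) ^ J * fgn_cov H i J) + (\<Sum>k<J. (-1) ^ J * (-1) ^ k * fgn_cov H J k) + fgn_cov H J J"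
    by (simp add: sum.distrib)
  also have "(\<Sum>k<J. (-1) ^ J * (-1) ^ k * fgn_cov H J k) = A J"
    unfolding B[symmetric] by (intro sum.cong refl) (simp add: sym mult_ac)
  finally show ?case using B Suc A[of J] by (simp add: fgn_autocovariance_0)
qed simp

section \<open>Gaussian processes\<close>

abbreviation std_normal :: "real measure" where
  "std_normal \<equiv> std_normal_distribution"

text \<open>As affine images of one standard normal variable, the Dirac law at v = 0 and the laws
  with a density can be treated alike from here on.\<close>

lemma normal_law_eq_distr:
  assumes "0 \<le> v"
  shows "normal_law \<mu> v = distr std_normal borel (\<lambda>x. \<mu> + sqrt v * x)"
proof -
  interpret G: real_distribution std_normal by (rule real_dist_normal_dist)
  show ?thesis
  proof (cases "v = 0")
    case True
    then show ?thesis by (simp add: normal_law_def G.distr_const)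
  next
    case False
    have "distributed std_normal lborel (\<lambda>x. x) std_normal_density"
      unfolding distributed_def by (auto intro!: distr_id2)
    from G.normal_density_affine[OF this, of "sqrt v" \<mu>]
    have "distributed std_normal lborel (\<lambda>x. \<mu> + sqrt v * x) (normal_density \<mu> (sqrt v))"
      using False assms by simp
    then have "distr std_normal lborel (\<lambda>x. \<mu> + sqrt v * x) = density lborel (normal_density \<mu> (sqrt v))"
      by (simp add: distributed_def)
    moreover have "distr std_normal lborel (\<lambda>x. \<mu> + sqrt v * x)
        = distr std_normal borel (\<lambda>x. \<mu> + sqrt v * x)"
      by (rule distr_cong) auto
    ultimately show ?thesis using False by (simp add: normal_law_def)
  qed
qed

lemma normal_law_moments:
  assumes "0 \<le> v"
  shows "integrable (normal_law \<mu> v) (\<lambda>x. x)" "(\<integral>x. x \<partial>normal_law \<mu> v) = \<mu>"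
    and "integrable (normal_law \<mu> v) (\<lambda>x. x\<^sup>2)" "(\<integral>x. x\<^sup>2 \<partial>normal_law \<mu> v) = \<mu>\<^sup>2 + v"
proof -
  interpret G: real_distribution std_normal by (rule real_dist_normal_dist)
  have i: "integrable std_normal (\<lambda>x. x)" "integrable std_normal (\<lambda>x. x\<^sup>2)"
    using integrable_std_normal_distribution_moment[of 1] integrable_std_normal_distribution_moment[of 2] by simp_all
  have m: "(\<integral>x. x \<partial>std_normal) = 0" "(\<integral>x. x\<^sup>2 \<partial>std_normal) = 1"
    using integral_std_normal_distribution_moment_odd[of 1] std_normal_distribution_even_moments(1)[of 1] by simp_all
  have sq: "(\<mu> + sqrt v * x)\<^sup>2 = \<mu>\<^sup>2 + (2 * \<mu> * sqrt v) * x + v * x\<^sup>2" for x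
    using assms by (simp add: power2_sum power_mult_distrib algebra_simps)
  have u: "G.prob UNIV = 1" using G.prob_space by simp
  have c: "integrable std_normal (\<lambda>x. c)" "(\<integral>x. c \<partial>std_normal) = c" for c :: real
    using u by (simp_all add: G.emeasure_finite)
  show "integrable (normal_law \<mu> v) (\<lambda>x. x)" "(\<integral>x. x \<partial>normal_law \<mu> v) = \<mu>"
    "integrable (normal_law \<mu> v) (\<lambda>x. x\<^sup>2)" "(\<integral>x. x\<^sup>2 \<partial>normal_law \<mu> v) = \<mu>\<^sup>2 + v"
    unfolding normal_law_eq_distr[OF assms]
    by (simp_all add: integrable_distr_eq integral_distr sq i m c u)
qed

lemma integral_iexp_normal_law:
  assumes "0 \<le> v"
  shows "(CLINT x|normal_law 0 v. iexp (c * x)) = exp (- (c\<^sup>2 * v) / 2)"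
proof -
  have "(CLINT x|normal_law 0 v. iexp (c * x)) = (CLINT x|std_normal. iexp ((c * sqrt v) * x))"
    unfolding normal_law_eq_distr[OF assms] by (subst integral_distr) (auto simp: mult_ac)
  also have "\<dots> = char std_normal (c * sqrt v)" by (simp add: char_def)
  finally show ?thesis using assms by (simp add: char_std_normal_distribution power_mult_distrib)
qed

context
  fixes M :: "'a measure" and T :: "'t set" and X :: "'t \<Rightarrow> 'a \<Rightarrow> real" and K :: "'t \<Rightarrow> 't \<Rightarrow> real"
  assumes X: "centered_gaussian_process M T X K"
begin

lemma gaussian_prob_space: "prob_space M"
  using X by (simp add: centered_gaussian_process_def)

lemma gaussian_measurable: "t \<in> T \<Longrightarrow> X t \<in> borel_measurable M"
  using X by (simp add: centered_gaussian_process_def)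

lemma gaussian_mean: "t \<in> T \<Longrightarrow> (\<integral>x. X t x \<partial>M) = 0"
  using X unfolding centered_gaussian_process_def by (elim conjE) (rule bspec)

lemma gaussian_cov: "s \<in> T \<Longrightarrow> t \<in> T \<Longrightarrow> (\<integral>x. X s x * X t x \<partial>M) = K s t"
  using X unfolding centered_gaussian_process_def by (elim conjE) (drule (1) bspec, erule (1) bspec)

lemma gaussian_combination:
  assumes "finite J" "J \<subseteq> T"
  obtains \<mu> v where "0 \<le> v" "distr M borel (\<lambda>x. \<Sum>t\<in>J. a t * X t x) = normal_law \<mu> v"
proof -
  from X have "\<forall>J a. finite J \<and> J \<subseteq> T \<longrightarrow>
      (\<exists>\<mu> v. 0 \<le> v \<and> distr M borel (\<lambda>x. \<Sum>t\<in>J. a t * X t x) = normal_law \<mu> v)"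
    unfolding centered_gaussian_process_def by (elim conjE)
  from this[rule_format, of J a] assms that show ?thesis by blast
qed

lemma gaussian_integrable:
  assumes t: "t \<in> T"
  shows "integrable M (X t)" "integrable M (\<lambda>x. (X t x)\<^sup>2)"
proof -
  note [measurable] = gaussian_measurable[OF t]
  obtain \<mu> v where v: "0 \<le> v" "distr M borel (X t) = normal_law \<mu> v"
  proof (rule gaussian_combination[of "{t}" "\<lambda>_. 1"])
    fix \<mu> v assume "0 \<le> v" "distr M borel (\<lambda>x. \<Sum>t\<in>{t}. 1 * X t x) = normal_law \<mu> v"
    then show thesis using that by simp
  qed (use t in auto)
  have "integrable (distr M borel (X t)) (\<lambda>x. x)" "integrable (distr M borel (X t)) (\<lambda>x. x\<^sup>2)"
    unfolding v(2) by (rule normal_law_moments[OF v(1)])+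
  then show "integrable M (X t)" "integrable M (\<lambda>x. (X t x)\<^sup>2)"
    by (simp_all add: integrable_distr_eq)
qed

lemma gaussian_integrable_mult:
  assumes "s \<in> T" "t \<in> T"
  shows "integrable M (\<lambda>x. X s x * X t x)"
proof (rule Bochner_Integration.integrable_bound)
  show "integrable M (\<lambda>x. (X s x)\<^sup>2 + (X t x)\<^sup>2)"
    using gaussian_integrable assms by (intro Bochner_Integration.integrable_add) auto
  show "(\<lambda>x. X s x * X t x) \<in> borel_measurable M"
    using gaussian_measurable assms by (intro borel_measurable_times) auto
  have "\<bar>a * b\<bar> \<le> \<bar>a\<^sup>2 + b\<^sup>2\<bar>" for a b :: real
  proof -
    have "2 * (\<bar>a\<bar> * \<bar>b\<bar>) \<le> a\<^sup>2 + b\<^sup>2" using sum_squares_bound[of "\<bar>a\<bar>" "\<bar>b\<bar>"] by simp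
    moreover have "0 \<le> \<bar>a\<bar> * \<bar>b\<bar>" by simp
    ultimately have "\<bar>a\<bar> * \<bar>b\<bar> \<le> a\<^sup>2 + b\<^sup>2" by linarith
    then show ?thesis by (simp add: abs_mult)
  qed
  then show "AE x in M. norm (X s x * X t x) \<le> norm ((X s x)\<^sup>2 + (X t x)\<^sup>2)" by simp
qed

text \<open>A Gaussian process is only required to have some normal law for each combination; the
  two parameters are read off from the first two moments.\<close>

lemma gaussian_linear_law:
  assumes J: "finite J" "J \<subseteq> T"
  shows "distr M borel (\<lambda>x. \<Sum>t\<in>J. a t * X t x) = normal_law 0 (cov_form K J a)" "0 \<le> cov_form K J a"
proof -
  let ?Y = "\<lambda>x. \<Sum>t\<in>J. a t * X t x"
  have Y[measurable]: "?Y \<in> borel_measurable M"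
    using J gaussian_measurable by (intro borel_measurable_sum borel_measurable_times borel_measurable_const) auto
  obtain \<mu> v where v: "0 \<le> v" "distr M borel ?Y = normal_law \<mu> v"
    using gaussian_combination[OF J] by blast
  have "(\<integral>x. x \<partial>distr M borel ?Y) = \<mu>" unfolding v(2) by (rule normal_law_moments[OF v(1)])
  then have "(\<integral>x. ?Y x \<partial>M) = \<mu>" by (simp add: integral_distr)
  moreover have "(\<integral>x. ?Y x \<partial>M) = (\<Sum>t\<in>J. a t * (\<integral>x. X t x \<partial>M))"
    using J gaussian_integrable by (subst Bochner_Integration.integral_sum) (auto simp: subset_eq)
  moreover have "(\<integral>x. X t x \<partial>M) = 0" if "t \<in> J" for t
    using J that by (intro gaussian_mean) auto
  ultimately have \<mu>: "\<mu> = 0" by simp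
  have "(\<integral>x. x\<^sup>2 \<partial>distr M borel ?Y) = \<mu>\<^sup>2 + v" unfolding v(2) by (rule normal_law_moments[OF v(1)])
  then have "v = (\<integral>x. (?Y x)\<^sup>2 \<partial>M)" by (simp add: integral_distr \<mu>)
  also have "\<dots> = (\<integral>x. (\<Sum>s\<in>J. \<Sum>t\<in>J. a s * a t * (X s x * X t x)) \<partial>M)"
    by (simp add: power2_eq_square sum_product mult_ac)
  also have "\<dots> = (\<Sum>s\<in>J. \<Sum>t\<in>J. a s * a t * (\<integral>x. X s x * X t x \<partial>M))"
    using J gaussian_integrable_mult
    by (simp add: Bochner_Integration.integral_sum Bochner_Integration.integrable_sum subset_eq)
  also have "\<dots> = cov_form K J a"
    unfolding cov_form_def using J
    by (intro sum.cong refl) (simp add: gaussian_cov subset_eq)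
  finally have "v = cov_form K J a" .
  then show "distr M borel ?Y = normal_law 0 (cov_form K J a)" "0 \<le> cov_form K J a" using v \<mu> by auto
qed

lemma gaussian_char:
  assumes J: "finite J" "J \<subseteq> T"
  shows "(CLINT x|M. iexp (c * (\<Sum>t\<in>J. a t * X t x))) = exp (- (c\<^sup>2 * cov_form K J a) / 2)"
proof -
  have [measurable]: "(\<lambda>x. \<Sum>t\<in>J. a t * X t x) \<in> borel_measurable M"
    using J gaussian_measurable by (intro borel_measurable_sum borel_measurable_times borel_measurable_const) auto
  have "(CLINT x|M. iexp (c * (\<Sum>t\<in>J. a t * X t x))) = (CLINT y|distr M borel (\<lambda>x. \<Sum>t\<in>J. a t * X t x). iexp (c * y))"
    by (subst integral_distr) auto
  then show ?thesis
    unfolding gaussian_linear_law(1)[OF J] using integral_iexp_normal_law[OF gaussian_linear_law(2)[OF J]] by simp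
qed

lemma gaussian_cov_sym: "s \<in> T \<Longrightarrow> t \<in> T \<Longrightarrow> K s t = K t s"
  using gaussian_cov[of s t] gaussian_cov[of t s] by (simp add: mult.commute)

text \<open>Serves to regard the increments of fractional Brownian motion, which combine its values
  at finitely many times, as a Gaussian process of their own.\<close>

lemma gaussian_combinations:
  assumes S: "finite S" "S \<subseteq> T"
  shows "centered_gaussian_process M I (\<lambda>i x. \<Sum>t\<in>S. a i t * X t x)
     (\<lambda>i k. \<Sum>s\<in>S. \<Sum>t\<in>S. a i s * a k t * K s t)"
  unfolding centered_gaussian_process_def
proof (intro conjI ballI allI impI)
  show "prob_space M" by (rule gaussian_prob_space)
  show "(\<lambda>x. \<Sum>t\<in>S. a i t * X t x) \<in> borel_measurable M" for i
    using S gaussian_measurable by (intro borel_measurable_sum borel_measurable_times borel_measurable_const) auto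
  fix J b assume J: "finite J \<and> J \<subseteq> I"
  have "(\<Sum>i\<in>J. b i * (\<Sum>t\<in>S. a i t * X t x)) = (\<Sum>t\<in>S. (\<Sum>i\<in>J. b i * a i t) * X t x)" for x
    by (simp add: sum_distrib_left sum_distrib_right mult_ac) (rule sum.swap)
  then show "\<exists>\<mu> v. 0 \<le> v \<and> distr M borel (\<lambda>x. \<Sum>i\<in>J. b i * (\<Sum>t\<in>S. a i t * X t x)) = normal_law \<mu> v"
    using gaussian_linear_law[OF S, of "\<lambda>t. \<Sum>i\<in>J. b i * a i t"] by auto
next
  fix i
  have "(\<integral>x. (\<Sum>t\<in>S. a i t * X t x) \<partial>M) = (\<Sum>t\<in>S. a i t * (\<integral>x. X t x \<partial>M))"
    using S gaussian_integrable by (subst Bochner_Integration.integral_sum) (auto simp: subset_eq)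
  moreover have "(\<integral>x. X t x \<partial>M) = 0" if "t \<in> S" for t
    using S that by (intro gaussian_mean) auto
  ultimately show "(\<integral>x. (\<Sum>t\<in>S. a i t * X t x) \<partial>M) = 0" by simp
next
  fix i k
  have "(\<integral>x. (\<Sum>s\<in>S. a i s * X s x) * (\<Sum>t\<in>S. a k t * X t x) \<partial>M)
      = (\<integral>x. (\<Sum>s\<in>S. \<Sum>t\<in>S. a i s * a k t * (X s x * X t x)) \<partial>M)"
    by (simp add: sum_product mult_ac)
  also have "\<dots> = (\<Sum>s\<in>S. \<Sum>t\<in>S. a i s * a k t * (\<integral>x. X s x * X t x \<partial>M))"
    using S gaussian_integrable_mult
    by (simp add: Bochner_Integration.integral_sum Bochner_Integration.integrable_sum subset_eq)
  also have "\<dots> = (\<Sum>s\<in>S. \<Sum>t\<in>S. a i s * a k t * K s t)"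
    using S by (intro sum.cong refl) (simp add: gaussian_cov subset_eq)
  finally show "(\<integral>x. (\<Sum>s\<in>S. a i s * X s x) * (\<Sum>t\<in>S. a k t * X t x) \<partial>M)
      = (\<Sum>s\<in>S. \<Sum>t\<in>S. a i s * a k t * K s t)" .
qed

end

section \<open>Uniqueness of finite-dimensional laws\<close>

text \<open>Levy uniqueness for weighted laws: the equation at t = 0 shows that both weights have
  the same mass c. If c > 0, division by c makes them probability densities; if c = 0, both sides
  vanish.\<close>

lemma integral_indicator_eqI_char:
  fixes w :: "'a \<Rightarrow> real" and w' :: "'b \<Rightarrow> real"
  assumes M: "prob_space M" "prob_space M'"
    and meas[measurable]: "w \<in> borel_measurable M" "w' \<in> borel_measurable M'"
      "Z \<in> borel_measurable M" "Z' \<in> borel_measurable M'"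
    and w: "\<And>x. 0 \<le> w x" "\<And>x. w x \<le> b" "\<And>x. 0 \<le> w' x" "\<And>x. w' x \<le> b"
    and eq: "\<And>t. (CLINT x|M. of_real (w x) * iexp (t * Z x)) = (CLINT x|M'. of_real (w' x) * iexp (t * Z' x))"
    and A[measurable]: "A \<in> sets borel"
  shows "(LINT x|M. w x * indicator A (Z x)) = (LINT x|M'. w' x * indicator A (Z' x))"
proof -
  interpret M: prob_space M by fact
  interpret M': prob_space M' by fact
  have int: "integrable M w" "integrable M' w'"
    using w by (auto intro!: M.integrable_const_bound[of _ b] M'.integrable_const_bound[of _ b])
  have iwA: "integrable M (\<lambda>x. w x * indicator A (Z x))" "integrable M' (\<lambda>x. w' x * indicator A (Z' x))"
    using w order_trans[OF w(1) w(2)]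
    by (auto intro!: M.integrable_const_bound[of _ b] M'.integrable_const_bound[of _ b] simp: indicator_def)
  define c where "c = (LINT x|M. w x)"
  have "complex_of_real c = (CLINT x|M. of_real (w x))" unfolding c_def by simp
  also have "\<dots> = (CLINT x|M'. of_real (w' x))" using eq[of 0] by simp
  also have "\<dots> = complex_of_real (LINT x|M'. w' x)" by simp
  finally have c': "c = (LINT x|M'. w' x)" by (simp only: of_real_eq_iff)
  have c0: "0 \<le> c" unfolding c_def using w by (intro Bochner_Integration.integral_nonneg) auto
  show ?thesis
  proof (cases "c = 0")
    case True
    have "(LINT x|M. w x * indicator A (Z x)) \<le> (LINT x|M. w x)"
      using int iwA w by (intro Bochner_Integration.integral_mono) (auto simp: indicator_def)
    moreover have "(LINT x|M'. w' x * indicator A (Z' x)) \<le> (LINT x|M'. w' x)"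
      using int iwA w by (intro Bochner_Integration.integral_mono) (auto simp: indicator_def)
    moreover have "0 \<le> (LINT x|M. w x * indicator A (Z x))" "0 \<le> (LINT x|M'. w' x * indicator A (Z' x))"
      using w by (auto intro!: Bochner_Integration.integral_nonneg)
    ultimately show ?thesis using True c' c_def by simp
  next
    case False
    then have cpos: "0 < c" using c0 by simp
    have *: "real_distribution (distr (density P (\<lambda>x. ennreal (v x / c))) borel Y)"
      "\<And>t. char (distr (density P (\<lambda>x. ennreal (v x / c))) borel Y) t = (CLINT x|P. of_real (v x) * iexp (t * Y x)) / c"
      "measure (distr (density P (\<lambda>x. ennreal (v x / c))) borel Y) A = (LINT x|P. v x * indicator A (Y x)) / c"
      if P: "prob_space P" and [measurable]: "v \<in> borel_measurable P" "Y \<in> borel_measurable P"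
        and v: "\<And>x. 0 \<le> v x" "integrable P v" "(LINT x|P. v x) = c"
      for P :: "'z measure" and v Y
    proof -
      let ?D = "density P (\<lambda>x. ennreal (v x / c))"
      have "emeasure ?D (space ?D) = (\<integral>\<^sup>+x. ennreal (v x / c) \<partial>P)"
        by (simp add: emeasure_density cong: nn_integral_cong)
      also have "\<dots> = ennreal (LINT x|P. v x / c)"
        using v cpos by (intro nn_integral_eq_integral) auto
      also have "\<dots> = 1" using v cpos by simp
      finally have D: "prob_space ?D" by (rule prob_spaceI)
      then interpret D: prob_space ?D .
      show rd: "real_distribution (distr ?D borel Y)" by (rule D.real_distribution_distr) simp
      then interpret R: real_distribution "distr ?D borel Y" .
      show "char (distr ?D borel Y) t = (CLINT x|P. of_real (v x) * iexp (t * Y x)) / c" for t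
      proof -
        have "char (distr ?D borel Y) t = (CLINT x|?D. iexp (t * Y x))"
          unfolding char_def by (subst integral_distr) auto
        also have "\<dots> = (CLINT x|P. (v x / c) *\<^sub>R iexp (t * Y x))"
          using v cpos by (subst integral_density) auto
        also have "\<dots> = (CLINT x|P. (of_real (v x) * iexp (t * Y x)) / c)"
          by (simp add: scaleR_conv_of_real)
        finally show ?thesis by simp
      qed
      have "measure (distr ?D borel Y) A = (LINT x|distr ?D borel Y. indicator A x)"
        by (simp add: measure_distr)
      also have "\<dots> = (LINT x|?D. indicator A (Y x))" by (subst integral_distr) auto
      also have "\<dots> = (LINT x|P. (v x / c) *\<^sub>R indicator A (Y x))"
        using v cpos by (subst integral_density) auto
      also have "\<dots> = (LINT x|P. (v x * indicator A (Y x)) / c)" by simp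
      finally show "measure (distr ?D borel Y) A = (LINT x|P. v x * indicator A (Y x)) / c" by simp
    qed
    note P = *[OF M(1) meas(1,3) w(1) int(1) c_def[symmetric]]
    note Q = *[OF M(2) meas(2,4) w(3) int(2) c'[symmetric]]
    have "distr (density M (\<lambda>x. ennreal (w x / c))) borel Z = distr (density M' (\<lambda>x. ennreal (w' x / c))) borel Z'"
      by (intro Levy_uniqueness P(1) Q(1) ext) (simp only: P(2) Q(2) eq)
    then show ?thesis using P(3) Q(3) cpos by simp
  qed
qed

text \<open>Replaces the character in the coordinate Z by an indicator while other coordinates stay
  in the phase \<theta>. The complex weight W e^(i\<theta>) is no density, so the uniqueness lemma
  is applied to the nonnegative weights W(1 + cos(\<theta> + \<phi>)), whose transforms combine the
  hypothesis at c = 0, 1 and -1.\<close>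

lemma cramer_wold_step:
  fixes W :: "'a \<Rightarrow> real" and W' :: "'b \<Rightarrow> real"
  assumes M: "prob_space M" "prob_space M'"
    and meas[measurable]: "W \<in> borel_measurable M" "W' \<in> borel_measurable M'"
      "\<theta> \<in> borel_measurable M" "\<theta>' \<in> borel_measurable M'"
      "Z \<in> borel_measurable M" "Z' \<in> borel_measurable M'"
    and W: "\<And>x. 0 \<le> W x" "\<And>x. W x \<le> 1" "\<And>x. 0 \<le> W' x" "\<And>x. W' x \<le> 1"
    and eq: "\<And>c t. (CLINT x|M. of_real (W x) * iexp (c * \<theta> x + t * Z x))
      = (CLINT x|M'. of_real (W' x) * iexp (c * \<theta>' x + t * Z' x))"
    and A[measurable]: "A \<in> sets borel"
  shows "(CLINT x|M. of_real (W x * indicator A (Z x)) * iexp (\<theta> x))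
      = (CLINT x|M'. of_real (W' x * indicator A (Z' x)) * iexp (\<theta>' x))"
proof -
  interpret M: prob_space M by fact
  interpret M': prob_space M' by fact
  have iexp_cos: "complex_of_real (v * (1 + cos (th + \<phi>))) * iexp r
      = of_real v * iexp (0 * th + r) + (iexp \<phi> / 2) * (of_real v * iexp (1 * th + r))
        + (iexp (- \<phi>) / 2) * (of_real v * iexp ((-1) * th + r))" for v th \<phi> r :: real
  proof -
    have "complex_of_real (cos (th + \<phi>)) = (iexp th * iexp \<phi> + iexp (- th) * iexp (- \<phi>)) / 2"
      by (simp add: cos_exp_eq exp_add[symmetric] algebra_simps flip: cos_of_real)
    moreover have "iexp (0 * th + r) = iexp r" "iexp (1 * th + r) = iexp th * iexp r"
      "iexp ((-1) * th + r) = iexp (- th) * iexp r"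
      by (simp_all add: distrib_left right_diff_distrib exp_add[symmetric])
    moreover have "V * (1 + (a * p + b * q) / 2) * R = V * R + p / 2 * (V * (a * R)) + q / 2 * (V * (b * R))"
      for V a p b q R :: complex by (simp add: field_simps)
    ultimately show ?thesis by (simp only: of_real_mult of_real_add of_real_1)
  qed
  have w: "(LINT x|M. W x * (1 + cos (\<theta> x + \<phi>)) * indicator A (Z x))
      = (LINT x|M'. W' x * (1 + cos (\<theta>' x + \<phi>)) * indicator A (Z' x))" for \<phi>
  proof (rule integral_indicator_eqI_char[OF M, where b = 2])
    have "0 \<le> v * (1 + cos r)" "v * (1 + cos r) \<le> 2" if "0 \<le> v" "v \<le> 1" for v r :: real
    proof -
      have "0 \<le> 1 + cos r" "1 + cos r \<le> 2" using cos_ge_minus_one[of r] cos_le_one[of r] by linarith+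
      then show "0 \<le> v * (1 + cos r)" "v * (1 + cos r) \<le> 2"
        using that mult_mono[of v 1 "1 + cos r" 2] by auto
    qed
    then show "0 \<le> W x * (1 + cos (\<theta> x + \<phi>))" "W x * (1 + cos (\<theta> x + \<phi>)) \<le> 2"
      "0 \<le> W' y * (1 + cos (\<theta>' y + \<phi>))" "W' y * (1 + cos (\<theta>' y + \<phi>)) \<le> 2" for x y
      using W by auto
    fix t
    have i: "integrable M (\<lambda>x. of_real (W x) * iexp (c * \<theta> x + t * Z x))" for c
      using W by (intro M.integrable_const_bound[of _ 1]) (auto simp: norm_mult)
    have i': "integrable M' (\<lambda>x. of_real (W' x) * iexp (c * \<theta>' x + t * Z' x))" for c
      using W by (intro M'.integrable_const_bound[of _ 1]) (auto simp: norm_mult)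
    show "(CLINT x|M. of_real (W x * (1 + cos (\<theta> x + \<phi>))) * iexp (t * Z x))
        = (CLINT x|M'. of_real (W' x * (1 + cos (\<theta>' x + \<phi>))) * iexp (t * Z' x))"
      unfolding iexp_cos using i i'
      by (simp only: Bochner_Integration.integral_add Bochner_Integration.integrable_add
          integrable_mult_right integral_mult_right_zero eq)
  qed measurable
  have bound: "integrable P (\<lambda>x. V x * (1 + cos (th x + \<phi>)) * indicator A (Y x))"
    if "prob_space P" and V: "\<And>x. 0 \<le> V x" "\<And>x. V x \<le> 1"
      and [measurable]: "V \<in> borel_measurable P" "th \<in> borel_measurable P" "Y \<in> borel_measurable P"
    for P and V th Y :: "'z \<Rightarrow> real" and \<phi>
  proof -
    interpret P: prob_space P by fact
    have "\<bar>V x * (1 + cos (th x + \<phi>)) * indicator A (Y x)\<bar> \<le> 1 * 2 * 1" for x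
      unfolding abs_mult using V cos_ge_minus_one[of "th x + \<phi>"] cos_le_one[of "th x + \<phi>"]
      by (intro mult_mono) (auto simp: indicator_def simp del: cos_le_one cos_ge_minus_one)
    then show ?thesis by (intro P.integrable_const_bound[of _ 2]) auto
  qed
  note iw = bound[OF M(1) W(1,2) meas(1,3,5)] and iw' = bound[OF M(2) W(3,4) meas(2,4,6)]
  \<comment> \<open>The phases \<phi> and \<phi> + pi give cosines of opposite sign, so half the
    difference of their weights removes the constant 1.\<close>
  have half: "v * cos r * a = (v * (1 + cos r) * a - v * (1 + cos (r + pi)) * a) / 2" for v r a :: real
    by (simp add: algebra_simps)
  have c: "(LINT x|M. W x * cos (\<theta> x + \<phi>) * indicator A (Z x))
      = (LINT x|M'. W' x * cos (\<theta>' x + \<phi>) * indicator A (Z' x))" for \<phi>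
    unfolding half add.assoc
    by (simp only: integral_divide_zero Bochner_Integration.integral_diff[OF iw iw]
        Bochner_Integration.integral_diff[OF iw' iw'] w)
  have ic: "integrable M (\<lambda>x. W x * cos (\<theta> x + \<phi>) * indicator A (Z x))"
    "integrable M' (\<lambda>x. W' x * cos (\<theta>' x + \<phi>) * indicator A (Z' x))" for \<phi>
    unfolding half add.assoc by (intro integrable_divide Bochner_Integration.integrable_diff iw iw')+
  \<comment> \<open>The phases 0 and -pi/2 supply the real and the imaginary part.\<close>
  have split: "complex_of_real (v * a) * iexp r
      = of_real (v * cos (r + 0) * a) + \<i> * of_real (v * cos (r + (- pi/2)) * a)" for v a r :: real
    by (simp add: exp_Euler cos_diff sin_of_real cos_of_real algebra_simps)
  show ?thesis
    unfolding split using ic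
    by (simp only: Bochner_Integration.integral_add integrable_mult_right integrable_of_real
        integral_mult_right_zero integral_complex_of_real c)
qed

text \<open>The coordinates are moved one at a time from the exponent into indicators; once all are
  moved, the probabilities of boxes agree, and these determine the law.\<close>

lemma cramer_wold:
  fixes X :: "'t \<Rightarrow> 'a \<Rightarrow> real" and Y :: "'t \<Rightarrow> 'b \<Rightarrow> real"
  assumes M: "prob_space M" "prob_space M'" and I: "finite I"
    and X: "\<And>i. i \<in> I \<Longrightarrow> X i \<in> borel_measurable M" and Y: "\<And>i. i \<in> I \<Longrightarrow> Y i \<in> borel_measurable M'"
    and eq: "\<And>u. (CLINT x|M. iexp (\<Sum>i\<in>I. u i * X i x)) = (CLINT x|M'. iexp (\<Sum>i\<in>I. u i * Y i x))"
  shows "distr M (PiM I (\<lambda>_. borel)) (\<lambda>x. \<lambda>i\<in>I. X i x) = distr M' (PiM I (\<lambda>_. borel)) (\<lambda>x. \<lambda>i\<in>I. Y i x)"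
proof -
  let ?R = "PiM I (\<lambda>_. borel :: real measure)"
  interpret M: prob_space M by fact
  interpret M': prob_space M' by fact
  have P: "(CLINT x|M. of_real (\<Prod>j\<in>J. indicator (A j) (X j x)) * iexp (\<Sum>i\<in>I - J. u i * X i x))
      = (CLINT x|M'. of_real (\<Prod>j\<in>J. indicator (A j) (Y j x)) * iexp (\<Sum>i\<in>I - J. u i * Y i x))"
    if "finite J" "J \<subseteq> I" "\<forall>j\<in>J. A j \<in> sets borel" for J u and A :: "'t \<Rightarrow> real set"
    using that
  proof (induction J arbitrary: u rule: finite_induct)
    case empty
    then show ?case using eq by simp
  next
    case (insert j J)
    have j: "j \<in> I" and J: "J \<subseteq> I" and Aj[measurable]: "A j \<in> sets borel" using insert by auto
    have ind: "(\<lambda>x. \<Prod>j\<in>J. indicat_real (A j) (X j x)) \<in> borel_measurable M"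
      "(\<lambda>x. \<Prod>j\<in>J. indicat_real (A j) (Y j x)) \<in> borel_measurable M'"
      using insert.prems X Y J
      by (auto intro!: borel_measurable_prod measurable_compose[OF _ borel_measurable_indicator] simp: subset_eq)
    have IJ: "finite (I - insert j J)" "I - J = insert j (I - insert j J)" "j \<notin> I - insert j J"
      using I j insert(2) by auto
    have "(CLINT x|M. of_real ((\<Prod>j\<in>J. indicator (A j) (X j x)) * indicator (A j) (X j x))
          * iexp (\<Sum>i\<in>I - insert j J. u i * X i x))
        = (CLINT x|M'. of_real ((\<Prod>j\<in>J. indicator (A j) (Y j x)) * indicator (A j) (Y j x))
          * iexp (\<Sum>i\<in>I - insert j J. u i * Y i x))"
    proof (rule cramer_wold_step[OF M ind])
      show "(\<lambda>x. \<Sum>i\<in>I - insert j J. u i * X i x) \<in> borel_measurable M"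
        using X by (intro borel_measurable_sum borel_measurable_times) auto
      show "(\<lambda>x. \<Sum>i\<in>I - insert j J. u i * Y i x) \<in> borel_measurable M'"
        using Y by (intro borel_measurable_sum borel_measurable_times) auto
      show "X j \<in> borel_measurable M" "Y j \<in> borel_measurable M'" using X Y j by auto
      show "0 \<le> (\<Prod>j\<in>J. indicator (A j) (X j x) :: real)" "(\<Prod>j\<in>J. indicator (A j) (X j x) :: real) \<le> 1" for x
        by (auto intro!: prod_nonneg prod_le_1 simp: indicator_def)
      show "0 \<le> (\<Prod>j\<in>J. indicator (A j) (Y j x) :: real)" "(\<Prod>j\<in>J. indicator (A j) (Y j x) :: real) \<le> 1" for x
        by (auto intro!: prod_nonneg prod_le_1 simp: indicator_def)
      fix c t
      \<comment> \<open>The induction hypothesis holds for all frequency vectors, so the scaling c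
        of the remaining phase and the frequency t of the coordinate j fit into a single
        one.\<close>
      define u' where "u' i = (if i = j then t else c * u i)" for i
      have "(\<Sum>i\<in>I - J. u' i * z i) = c * (\<Sum>i\<in>I - insert j J. u i * z i) + t * z j" for z
      proof -
        have "(\<Sum>i\<in>I - insert j J. u' i * z i) = c * (\<Sum>i\<in>I - insert j J. u i * z i)"
          unfolding sum_distrib_left by (intro sum.cong) (auto simp: u'_def)
        moreover have "(\<Sum>i\<in>I - J. u' i * z i) = u' j * z j + (\<Sum>i\<in>I - insert j J. u' i * z i)"
          by (subst IJ(2), rule sum.insert[OF IJ(1,3)])
        ultimately show ?thesis by (simp add: u'_def)
      qed
      then show "(CLINT x|M. of_real (\<Prod>j\<in>J. indicator (A j) (X j x)) * iexp (c * (\<Sum>i\<in>I - insert j J. u i * X i x) + t * X j x))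
        = (CLINT x|M'. of_real (\<Prod>j\<in>J. indicator (A j) (Y j x)) * iexp (c * (\<Sum>i\<in>I - insert j J. u i * Y i x) + t * Y j x))"
        using insert.IH[of u'] insert.prems by simp
    qed (rule Aj)
    then show ?case using insert(1,2) by (simp add: mult.commute)
  qed
  have mX: "(\<lambda>x. \<lambda>i\<in>I. X i x) \<in> measurable M ?R"
    using X by (rule measurable_restrict)
  have mY: "(\<lambda>x. \<lambda>i\<in>I. Y i x) \<in> measurable M' ?R"
    using Y by (rule measurable_restrict)
  have cyl: "measure (distr P ?R (\<lambda>x. \<lambda>i\<in>I. V i x)) (Pi\<^sub>E I A)
      = (LINT x|P. (\<Prod>j\<in>I. indicator (A j) (V j x)))"
    if P: "prob_space P" and V: "(\<lambda>x. \<lambda>i\<in>I. V i x) \<in> measurable P ?R"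
      and A: "\<And>i. i \<in> I \<Longrightarrow> A i \<in> sets borel"
    for P :: "'z measure" and V and A :: "'t \<Rightarrow> real set"
  proof -
    have S: "Pi\<^sub>E I A \<in> sets ?R" using A I by (intro sets_PiM_I_finite) auto
    have "measure (distr P ?R (\<lambda>x. \<lambda>i\<in>I. V i x)) (Pi\<^sub>E I A)
        = (LINT y|distr P ?R (\<lambda>x. \<lambda>i\<in>I. V i x). indicator (Pi\<^sub>E I A) y)"
      using S by (simp add: Int_absorb1 sets.sets_into_space)
    also have "\<dots> = (LINT x|P. indicator (Pi\<^sub>E I A) (\<lambda>i\<in>I. V i x))"
      using S by (intro integral_distr V) auto
    also have "\<dots> = (LINT x|P. (\<Prod>j\<in>I. indicator (A j) (V j x)))"
    proof (intro Bochner_Integration.integral_cong refl)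
      fix x
      show "indicator (Pi\<^sub>E I A) (\<lambda>i\<in>I. V i x) = (\<Prod>j\<in>I. indicator (A j) (V j x) :: real)"
        using I by (auto simp: indicator_def PiE_iff)
    qed
    finally show ?thesis .
  qed
  show ?thesis
  proof (rule measure_eqI_PiM_finite[OF I])
    let ?D = "distr M ?R (\<lambda>x. \<lambda>i\<in>I. X i x)"
    let ?D' = "distr M' ?R (\<lambda>x. \<lambda>i\<in>I. Y i x)"
    interpret D: prob_space ?D by (rule M.prob_space_distr[OF mX])
    interpret D': prob_space ?D' by (rule M'.prob_space_distr[OF mY])
    fix A :: "'t \<Rightarrow> real set" assume A: "\<And>i. i \<in> I \<Longrightarrow> A i \<in> sets borel"
    have "complex_of_real (LINT x|M. (\<Prod>j\<in>I. indicator (A j) (X j x))) = of_real (LINT x|M'. (\<Prod>j\<in>I. indicator (A j) (Y j x)))"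
      using P[of I A] I A by (simp del: of_real_prod)
    then have "(LINT x|M. (\<Prod>j\<in>I. indicat_real (A j) (X j x))) = (LINT x|M'. (\<Prod>j\<in>I. indicat_real (A j) (Y j x)))"
      by (simp only: of_real_eq_iff)
    moreover have "measure ?D (Pi\<^sub>E I A) = (LINT x|M. (\<Prod>j\<in>I. indicator (A j) (X j x)))"
      by (rule cyl[OF M(1) mX]) (rule A)
    moreover have "measure ?D' (Pi\<^sub>E I A) = (LINT x|M'. (\<Prod>j\<in>I. indicator (A j) (Y j x)))"
      by (rule cyl[OF M(2) mY]) (rule A)
    ultimately have "measure ?D (Pi\<^sub>E I A) = measure ?D' (Pi\<^sub>E I A)"
      by simp
    then show "emeasure ?D (Pi\<^sub>E I A) = emeasure ?D' (Pi\<^sub>E I A)"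
      by (simp only: D.emeasure_eq_measure D'.emeasure_eq_measure)
  next
    show "range (\<lambda>_::nat. Pi\<^sub>E I (\<lambda>_. UNIV :: real set)) \<subseteq> prod_algebra I (\<lambda>_. borel)"
      using I by (auto intro!: prod_algebraI_finite)
    show "(\<Union>i::nat. Pi\<^sub>E I (\<lambda>_. UNIV :: real set)) = space ?R" by (simp add: space_PiM)
    have "prob_space (distr M ?R (\<lambda>x. \<lambda>i\<in>I. X i x))" by (rule M.prob_space_distr[OF mX])
    then show "emeasure (distr M ?R (\<lambda>x. \<lambda>i\<in>I. X i x)) (Pi\<^sub>E I (\<lambda>_. UNIV)) \<noteq> \<infinity>"
      by (metis ennreal_top_neq_one finite_measure.finite_emeasure_space finite_measure.emeasure_finite infinity_ennreal_def prob_space.finite_measure)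
  qed simp_all
qed

section \<open>Shifting a Gaussian vector\<close>

text \<open>Gaussian elimination by induction on the index set: the pivot K p p is positive, and its
  Schur complement \<open>K'\<close> is again positive definite.\<close>

lemma positive_definite_solvable:
  fixes K :: "'t \<Rightarrow> 't \<Rightarrow> real"
  assumes "finite I" and "\<And>v. \<exists>i\<in>I. v i \<noteq> 0 \<Longrightarrow> 0 < (\<Sum>i\<in>I. \<Sum>k\<in>I. v i * v k * K i k)"
  shows "\<exists>v. \<forall>i\<in>I. (\<Sum>k\<in>I. K i k * v k) = s i"
  using assms
proof (induction I arbitrary: K s rule: finite_induct)
  case (insert p I)
  define d where "d = K p p"
  define e where "e i = (if i = p then 1 else 0 :: real)" for i
  have e: "e p = 1" "\<And>i. i \<in> I \<Longrightarrow> e i = 0" using insert(2) by (auto simp: e_def)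
  have "0 < (\<Sum>i\<in>insert p I. \<Sum>k\<in>insert p I. e i * e k * K i k)"
    by (rule insert.prems) (simp add: e)
  also have "\<dots> = d" using insert(1,2) by (simp add: d_def e)
  finally have d: "0 < d" .
  define K' where "K' i k = K i k - K i p * K p k / d" for i k
  have pd: "0 < (\<Sum>i\<in>I. \<Sum>k\<in>I. w i * w k * K' i k)" if w: "\<exists>i\<in>I. w i \<noteq> 0" for w
  proof -
    define a where "a = (\<Sum>i\<in>I. w i * K i p)"
    define b where "b = (\<Sum>k\<in>I. w k * K p k)"
    define S where "S = (\<Sum>i\<in>I. \<Sum>k\<in>I. w i * w k * K i k)"
    \<comment> \<open>With this value at the pivot, the form of the enlarged vector equals the Schur
      complement form of w.\<close>
    define v where "v i = (if i = p then - b / d else w i)" for i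
    have v: "v i = w i" if "i \<in> I" for i using that insert(2) by (auto simp: v_def)
    have vp: "v p = - b / d" by (simp add: v_def)
    have "0 < (\<Sum>i\<in>insert p I. \<Sum>k\<in>insert p I. v i * v k * K i k)"
      using w v by (intro insert.prems) auto
    also have "\<dots> = v p * v p * d + v p * b + (v p * a + S)"
      using insert(1,2)
      by (simp add: v sum.distrib d_def a_def b_def S_def sum_distrib_left mult_ac)
    also have "\<dots> = S - a * b / d" using d by (simp add: vp field_simps)
    also have "\<dots> = (\<Sum>i\<in>I. \<Sum>k\<in>I. w i * w k * K' i k)"
    proof -
      have "a * b / d = (\<Sum>i\<in>I. \<Sum>k\<in>I. w i * w k * (K i p * K p k / d))"
        unfolding a_def b_def sum_product sum_divide_distrib by (intro sum.cong refl) (simp add: mult_ac)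
      then show ?thesis by (simp add: K'_def S_def right_diff_distrib sum_subtractf)
    qed
    finally show ?thesis .
  qed
  obtain v where v: "\<And>i. i \<in> I \<Longrightarrow> (\<Sum>k\<in>I. K' i k * v k) = s i - K i p * s p / d"
    using insert.IH[of K' "\<lambda>i. s i - K i p * s p / d", OF pd] by blast
  define c where "c = (s p - (\<Sum>k\<in>I. K p k * v k)) / d"
  define v' where "v' i = (if i = p then c else v i)" for i
  have v': "(\<Sum>k\<in>insert p I. K i k * v' k) = K i p * c + (\<Sum>k\<in>I. K i k * v k)" for i
  proof -
    have "(\<Sum>k\<in>I. K i k * v' k) = (\<Sum>k\<in>I. K i k * v k)"
      using insert(2) by (intro sum.cong) (auto simp: v'_def)
    then show ?thesis using insert(1,2) by (simp add: v'_def)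
  qed
  have "(\<Sum>k\<in>insert p I. K i k * v' k) = s i" if "i \<in> insert p I" for i
  proof (cases "i = p")
    case True
    then show ?thesis using d unfolding v' by (simp add: c_def flip: d_def)
  next
    case False
    then have "i \<in> I" using that by simp
    have "(\<Sum>k\<in>I. K i k * v k) = (\<Sum>k\<in>I. K' i k * v k) + K i p / d * (\<Sum>k\<in>I. K p k * v k)"
      unfolding sum_distrib_left sum.distrib[symmetric]
      by (intro sum.cong refl) (simp add: K'_def algebra_simps)
    then show ?thesis
      unfolding v' v[OF \<open>i \<in> I\<close>] by (simp add: c_def diff_divide_distrib right_diff_distrib)
  qed
  then show ?case by blast
qed simp

text \<open>The bound is the square root of the chi-square divergence between two unit normal laws
  at distance \<tau>. Instead of Cauchy-Schwarz, the inequality between geometric and arithmetic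
  mean is used pointwise, with a weight \<open>e\<close> chosen such that both halves integrate to
  the same value.\<close>

lemma std_normal_shift:
  fixes g :: "real \<Rightarrow> real"
  assumes g[measurable]: "g \<in> borel_measurable borel" and g01: "\<And>x. 0 \<le> g x" "\<And>x. g x \<le> 1"
  shows "\<bar>(LINT x|std_normal. g (x + \<tau>)) - (LINT x|std_normal. g x)\<bar>
      \<le> sqrt (exp (\<tau>\<^sup>2) - 1)"
proof (cases "\<tau> = 0")
  case False
  let ?N = "\<lambda>m. normal_density m 1"
  define e where "e = sqrt (exp (\<tau>\<^sup>2) - 1)"
  have e: "0 < e" using False by (simp add: e_def)
  have N: "integrable lborel (?N m)" "(LINT x|lborel. ?N m x) = 1" for m
    by (simp_all add: integrable_normal_density integral_normal_density)
  have Ng: "integrable lborel (\<lambda>x. ?N m x * g x)" for m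
    by (rule Bochner_Integration.integrable_bound[OF N(1)[of m]])
      (use g01 in \<open>auto simp: abs_mult intro!: mult_left_le\<close>)
  have std: "(LINT x|std_normal. h x) = (LINT x|lborel. ?N 0 x * h x)"
    if [measurable]: "h \<in> borel_measurable borel" for h :: "real \<Rightarrow> real"
    by (subst integral_density) auto
  have shift: "(LINT x|lborel. ?N 0 x * g (x + \<tau>)) = (LINT x|lborel. ?N \<tau> x * g x)"
    by (subst lborel_integral_real_affine[where c = 1 and t = \<tau>]) (simp_all add: normal_density_def add.commute)
  \<comment> \<open>The squared difference of the two densities divided by the standard one;
    completing the square turns the first quotient into a multiple of the normal density centered at
    2\<tau>.\<close>
  define D where "D x = exp (\<tau>\<^sup>2) * ?N (2 * \<tau>) x - 2 * ?N \<tau> x + ?N 0 x" for x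
  have D: "integrable lborel D" "(LINT x|lborel. D x) = exp (\<tau>\<^sup>2) - 1"
    unfolding D_def using N by simp_all
  have ND: "(?N \<tau> x - ?N 0 x)\<^sup>2 = ?N 0 x * D x" for x
  proof -
    have "exp (\<tau>\<^sup>2) * ?N (2 * \<tau>) x * ?N 0 x = (?N \<tau> x)\<^sup>2"
    proof -
      have "exp (\<tau>\<^sup>2) * exp (- (x - 2 * \<tau>)\<^sup>2 / 2) * exp (- x\<^sup>2 / 2) = (exp (- (x - \<tau>)\<^sup>2 / 2))\<^sup>2"
        unfolding power2_eq_square[of "exp _"] exp_add[symmetric] by (simp add: power2_eq_square field_simps)
      then show ?thesis by (simp add: normal_density_def power_mult_distrib power_divide field_simps)
    qed
    then show ?thesis by (simp add: D_def power2_eq_square algebra_simps)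
  qed
  have bound: "\<bar>?N \<tau> x - ?N 0 x\<bar> \<le> (e * ?N 0 x + D x / e) / 2" for x
  proof -
    let ?a = "?N 0 x"
    have a: "0 < ?a" by (simp add: normal_density_pos)
    have D0: "0 \<le> D x" using ND[of x] a by (metis zero_le_power2 zero_le_mult_iff not_le)
    have "\<bar>?N \<tau> x - ?a\<bar> = sqrt ((e * ?a) * (D x / e))"
      using e by (simp flip: ND)
    also have "\<dots> \<le> (e * ?a + D x / e) / 2"
      using e a D0 by (intro arith_geo_mean_sqrt) auto
    finally show ?thesis .
  qed
  have "\<bar>(LINT x|lborel. ?N \<tau> x * g x) - (LINT x|lborel. ?N 0 x * g x)\<bar>
      = \<bar>LINT x|lborel. (?N \<tau> x - ?N 0 x) * g x\<bar>"
    by (simp add: left_diff_distrib Ng)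
  also have "\<dots> \<le> (LINT x|lborel. \<bar>(?N \<tau> x - ?N 0 x) * g x\<bar>)"
    by (rule integral_abs_bound)
  also have "\<dots> \<le> (LINT x|lborel. (e * ?N 0 x + D x / e) / 2)"
  proof (rule Bochner_Integration.integral_mono)
    show "integrable lborel (\<lambda>x. \<bar>(?N \<tau> x - ?N 0 x) * g x\<bar>)"
      using Ng by (simp add: left_diff_distrib)
    show "integrable lborel (\<lambda>x. (e * ?N 0 x + D x / e) / 2)" using N D by simp
    fix x
    have "\<bar>(?N \<tau> x - ?N 0 x) * g x\<bar> \<le> \<bar>?N \<tau> x - ?N 0 x\<bar>"
      using g01 by (simp add: abs_mult mult_left_le)
    then show "\<bar>(?N \<tau> x - ?N 0 x) * g x\<bar> \<le> (e * ?N 0 x + D x / e) / 2" using bound[of x] by linarith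
  qed
  also have "\<dots> = (e + (exp (\<tau>\<^sup>2) - 1) / e) / 2" using N D by simp
  also have "exp (\<tau>\<^sup>2) - 1 = e * e" by (simp add: e_def)
  finally show ?thesis using e by (simp add: std shift e_def[symmetric])
qed simp

text \<open>With \<open>\<Gamma>\<close> the covariance matrix, \<open>\<Gamma> v = s\<close> and \<open>Z = v \<bullet> X\<close>, the vector
  \<open>X - (Z / Var Z) s\<close> is independent of \<open>Z\<close>, so that shifting \<open>X\<close> by \<open>s\<close> amounts to shifting
  the real variable \<open>Z\<close> by its variance.\<close>

lemma gaussian_shift:
  assumes X: "centered_gaussian_process M T X K" and I: "finite I" "I \<subseteq> T"
    and l: "0 < l" "\<And>v. l * (\<Sum>i\<in>I. (v i)\<^sup>2) \<le> cov_form K I v"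
    and \<phi>[measurable]: "\<phi> \<in> borel_measurable (PiM I (\<lambda>_. borel))" and \<phi>01: "\<And>y. 0 \<le> \<phi> y" "\<And>y. \<phi> y \<le> (1::real)"
  shows "\<bar>(LINT x|M. \<phi> (\<lambda>i\<in>I. s i + X i x)) - (LINT x|M. \<phi> (\<lambda>i\<in>I. X i x))\<bar>
      \<le> sqrt (exp ((\<Sum>i\<in>I. (s i)\<^sup>2) / l) - 1)"
proof -
  let ?R = "PiM I (\<lambda>_. borel :: real measure)"
  interpret M: prob_space M by (rule gaussian_prob_space[OF X])
  interpret MM: pair_prob_space M M ..
  have Xm[measurable]: "X i \<in> borel_measurable M" if "i \<in> I" for i
    using gaussian_measurable[OF X] I that by auto
  have "\<exists>v. \<forall>i\<in>I. (\<Sum>k\<in>I. K i k * v k) = s i"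
  proof (rule positive_definite_solvable[OF I(1)])
    fix v :: "_ \<Rightarrow> real" assume "\<exists>i\<in>I. v i \<noteq> 0"
    then have "0 < (\<Sum>i\<in>I. (v i)\<^sup>2)" using I(1) by (metis sum_pos2 zero_le_power2 zero_less_power2)
    then have "0 < l * (\<Sum>i\<in>I. (v i)\<^sup>2)" using l(1) by simp
    also have "\<dots> \<le> cov_form K I v" by (rule l)
    finally show "0 < (\<Sum>i\<in>I. \<Sum>k\<in>I. v i * v k * K i k)" by (simp add: cov_form_def)
  qed
  then obtain v where v: "\<And>i. i \<in> I \<Longrightarrow> (\<Sum>k\<in>I. K i k * v k) = s i" by blast
  define V where "V = (\<Sum>i\<in>I. v i * s i)"
  have form: "(\<Sum>i\<in>I. \<Sum>k\<in>I. a i * v k * K i k) = (\<Sum>i\<in>I. a i * s i)" for a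
    using v by (intro sum.cong refl) (simp add: v[symmetric] sum_distrib_left mult_ac)
  have Vq: "cov_form K I v = V" unfolding cov_form_def V_def by (rule form)
  define A where "A = (\<Sum>i\<in>I. (v i)\<^sup>2)"
  define S where "S = (\<Sum>i\<in>I. (s i)\<^sup>2)"
  have lA: "l * A \<le> V" using l(2)[of v] by (simp add: Vq A_def)
  have A0: "0 \<le> A" "0 \<le> S" by (auto simp: A_def S_def intro: sum_nonneg)
  \<comment> \<open>V is the form of the inverse covariance matrix at s. The inequality of means
    bounds 2V by l |v|^2 + |s|^2/l, and l |v|^2 <= V is absorbed on the left.\<close>
  have VS: "V \<le> S / l"
  proof -
    have "2 * V \<le> (\<Sum>i\<in>I. l * (v i)\<^sup>2 + (s i)\<^sup>2 / l)"
      unfolding V_def sum_distrib_left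
    proof (rule sum_mono)
      fix i
      have "2 * (sqrt l * v i) * (s i / sqrt l) \<le> (sqrt l * v i)\<^sup>2 + (s i / sqrt l)\<^sup>2"
        by (rule sum_squares_bound)
      then show "2 * (v i * s i) \<le> l * (v i)\<^sup>2 + (s i)\<^sup>2 / l"
        using l(1) by (simp add: power_mult_distrib power_divide)
    qed
    also have "\<dots> = l * A + S / l" by (simp add: sum.distrib A_def S_def sum_distrib_left sum_divide_distrib)
    finally show ?thesis using lA by linarith
  qed
  have V0: "0 \<le> V" using lA A0 l(1) by (meson mult_nonneg_nonneg less_imp_le order_trans)
  have "\<bar>(LINT x|M. \<phi> (\<lambda>i\<in>I. s i + X i x)) - (LINT x|M. \<phi> (\<lambda>i\<in>I. X i x))\<bar> \<le> sqrt (exp V - 1)"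
  proof (cases "V = 0")
    case True
    then have "A = 0" using lA l(1) A0 by (simp add: mult_le_0_iff)
    then have "v i = 0" if "i \<in> I" for i using that I(1) by (simp add: A_def sum_nonneg_eq_0_iff)
    then have "s i = 0" if "i \<in> I" for i using v[OF that] by simp
    then have "(\<lambda>i\<in>I. s i + X i x) = (\<lambda>i\<in>I. X i x)" for x by (intro restrict_ext) simp
    then show ?thesis using True by simp
  next
    case False
    then have Vpos: "0 < V" using V0 by simp
    define Z where "Z x = (\<Sum>k\<in>I. v k * X k x)" for x
    have Zm[measurable]: "Z \<in> borel_measurable M"
      unfolding Z_def using Xm by (intro borel_measurable_sum borel_measurable_times) auto
    define R where "R i x = X i x - s i / V * Z x" for i x
    have Rm[measurable]: "R i \<in> borel_measurable M" if "i \<in> I" for i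
      unfolding R_def using Xm[OF that] by measurable
    \<comment> \<open>The independence of R and Z is expressed on the product space: Z is replaced
      by its copy at the second point, and the law of X must not change.\<close>
    define Y where "Y i = (\<lambda>(x, y). R i x + s i / V * Z y)" for i
    have Ym: "Y i \<in> borel_measurable (M \<Otimes>\<^sub>M M)" if "i \<in> I" for i
      unfolding Y_def using Rm[OF that] by measurable
    have law: "distr M ?R (\<lambda>x. \<lambda>i\<in>I. X i x)
        = distr (M \<Otimes>\<^sub>M M) ?R (\<lambda>z. \<lambda>i\<in>I. Y i z)"
    proof (rule cramer_wold[OF M.prob_space_axioms MM.prob_space_axioms I(1) Xm Ym])
      fix u
      define b where "b = (\<Sum>i\<in>I. u i * s i)"
      define c where "c = b / V"
      define a where "a i = u i - c * v i" for i
      have uR: "(\<Sum>i\<in>I. u i * R i x) = (\<Sum>i\<in>I. a i * X i x)" for x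
      proof -
        have "(\<Sum>i\<in>I. u i * R i x) = (\<Sum>i\<in>I. u i * X i x) - c * Z x"
          by (simp add: R_def right_diff_distrib sum_subtractf c_def b_def sum_distrib_right sum_divide_distrib mult.assoc)
        also have "\<dots> = (\<Sum>i\<in>I. a i * X i x)"
          by (simp add: a_def Z_def left_diff_distrib sum_subtractf sum_distrib_left mult.assoc)
        finally show ?thesis .
      qed
      have uY: "(\<Sum>i\<in>I. u i * Y i (x, y)) = (\<Sum>i\<in>I. a i * X i x) + c * Z y" for x y
        unfolding uR[symmetric]
        by (simp add: Y_def distrib_left sum.distrib c_def b_def sum_distrib_right sum_divide_distrib mult.assoc)
      have form': "(\<Sum>i\<in>I. \<Sum>k\<in>I. v i * u k * K i k) = b"
      proof -
        have "(\<Sum>i\<in>I. \<Sum>k\<in>I. v i * u k * K i k) = (\<Sum>k\<in>I. \<Sum>i\<in>I. v i * u k * K i k)" by (rule sum.swap)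
        also have "\<dots> = (\<Sum>k\<in>I. \<Sum>i\<in>I. u k * v i * K k i)"
          using I gaussian_cov_sym[OF X] by (intro sum.cong refl) (auto simp: mult.commute subset_eq)
        also have "\<dots> = b" unfolding b_def by (rule form)
        finally show ?thesis .
      qed
      have "cov_form K I a = cov_form K I u - c * b - c * b + c * c * V"
      proof -
        have "a i * a k * K i k = u i * u k * K i k - c * (u i * v k * K i k) - c * (v i * u k * K i k)
            + c * c * (v i * v k * K i k)" for i k
          by (simp add: a_def algebra_simps)
        then have "cov_form K I a = cov_form K I u - c * (\<Sum>i\<in>I. \<Sum>k\<in>I. u i * v k * K i k)
            - c * (\<Sum>i\<in>I. \<Sum>k\<in>I. v i * u k * K i k) + c * c * cov_form K I v"
          by (simp add: cov_form_def sum.distrib sum_subtractf sum_distrib_left)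
        then show ?thesis by (simp only: form form' Vq b_def[symmetric])
      qed
      moreover have "c * b = c\<^sup>2 * V" using Vpos by (simp add: c_def power2_eq_square)
      \<comment> \<open>The combination of X with weights \<open>a\<close> is the one with weights u
        minus c Z; it is uncorrelated with Z, so the variances add.\<close>
      ultimately have q: "cov_form K I u = cov_form K I a + c\<^sup>2 * V"
        by (simp add: power2_eq_square)
      have m[measurable]: "(\<lambda>x. \<Sum>i\<in>I. a i * X i x) \<in> borel_measurable M"
        using Xm by (intro borel_measurable_sum borel_measurable_times) auto
      have "(CLINT z|(M \<Otimes>\<^sub>M M). iexp (\<Sum>i\<in>I. u i * Y i z))
          = (CLINT z|(M \<Otimes>\<^sub>M M). iexp (\<Sum>i\<in>I. a i * X i (fst z)) * iexp (c * Z (snd z)))"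
      proof (intro Bochner_Integration.integral_cong refl)
        fix z
        show "iexp (\<Sum>i\<in>I. u i * Y i z) = iexp (\<Sum>i\<in>I. a i * X i (fst z)) * iexp (c * Z (snd z))"
          using uY[of "fst z" "snd z"] by (simp only: prod.collapse of_real_add distrib_left exp_add)
      qed
      also have "\<dots> = (CLINT x|M. CLINT y|M. iexp (\<Sum>i\<in>I. a i * X i x) * iexp (c * Z y))"
      proof -
        have "integrable (M \<Otimes>\<^sub>M M) (\<lambda>z. iexp (\<Sum>i\<in>I. a i * X i (fst z)) * iexp (c * Z (snd z)))"
          by (rule MM.integrable_const_bound[of _ 1]) (auto simp: norm_mult)
        from MM.integral_fst'[OF this] show ?thesis by simp
      qed
      also have "\<dots> = (CLINT x|M. iexp (1 * (\<Sum>i\<in>I. a i * X i x))) * (CLINT y|M. iexp (c * Z y))"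
        by simp
      also have "\<dots> = exp (- (1\<^sup>2 * cov_form K I a) / 2) * exp (- (c\<^sup>2 * cov_form K I v) / 2)"
        unfolding Z_def gaussian_char[OF X I] by (simp only: of_real_mult)
      also have "\<dots> = exp (- (1\<^sup>2 * cov_form K I u) / 2)"
        unfolding of_real_mult[symmetric] exp_add[symmetric] q Vq by (simp add: add_divide_distrib)
      also have "\<dots> = (CLINT x|M. iexp (1 * (\<Sum>i\<in>I. u i * X i x)))"
        by (rule gaussian_char[OF X I, symmetric])
      finally show "(CLINT x|M. iexp (\<Sum>i\<in>I. u i * X i x)) = (CLINT z|(M \<Otimes>\<^sub>M M). iexp (\<Sum>i\<in>I. u i * Y i z))"
        by simp
    qed
    have Zlaw: "distr M borel Z = distr std_normal borel (\<lambda>\<xi>. sqrt V * \<xi>)"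
      using gaussian_linear_law(1)[OF X I, of v] normal_law_eq_distr[OF V0, of 0]
      by (simp add: Vq Z_def[abs_def])
    define F where "F x \<xi> = \<phi> (\<lambda>i\<in>I. R i x + s i / V * (sqrt V * \<xi>))" for x \<xi>
    have Fm[measurable]: "case_prod F \<in> borel_measurable (M \<Otimes>\<^sub>M borel)"
      unfolding F_def split_def using Rm by measurable
    have Fx[measurable]: "F x \<in> borel_measurable borel" if "x \<in> space M" for x
      using measurable_Pair2[OF Fm that] by simp
    let ?N = "\<lambda>\<psi> x. LINT \<xi>|std_normal. \<psi> (\<lambda>i\<in>I. R i x + s i / V * (sqrt V * \<xi>)) :: real"
    have rep: "(LINT x|M. \<psi> (\<lambda>i\<in>I. X i x)) = (LINT x|M. ?N \<psi> x)"
      if \<psi>[measurable]: "\<psi> \<in> borel_measurable ?R" and \<psi>01: "\<And>y. 0 \<le> \<psi> y" "\<And>y. \<psi> y \<le> (1::real)" for \<psi>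
    proof -
      have "(LINT x|M. \<psi> (\<lambda>i\<in>I. X i x)) = (LINT y|distr M ?R (\<lambda>x. \<lambda>i\<in>I. X i x). \<psi> y)"
        using Xm by (intro integral_distr[symmetric] measurable_restrict) auto
      also have "\<dots> = (LINT z|(M \<Otimes>\<^sub>M M). \<psi> (\<lambda>i\<in>I. Y i z))"
        unfolding law using Ym by (intro integral_distr measurable_restrict) auto
      also have "\<dots> = (LINT x|M. LINT y|M. \<psi> (\<lambda>i\<in>I. Y i (x, y)))"
      proof -
        have "integrable (M \<Otimes>\<^sub>M M) (\<lambda>z. \<psi> (\<lambda>i\<in>I. Y i z))"
        proof (rule MM.integrable_const_bound[of _ 1])
          show "(\<lambda>z. \<psi> (\<lambda>i\<in>I. Y i z)) \<in> borel_measurable (M \<Otimes>\<^sub>M M)"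
            using Ym by (intro measurable_compose[OF measurable_restrict \<psi>]) auto
        qed (use \<psi>01 in auto)
        from MM.integral_fst'[OF this] show ?thesis by simp
      qed
      also have "\<dots> = (LINT x|M. ?N \<psi> x)"
      proof (intro Bochner_Integration.integral_cong refl)
        fix x assume x: "x \<in> space M"
        have [measurable]: "(\<lambda>t. \<psi> (\<lambda>i\<in>I. R i x + s i / V * t)) \<in> borel_measurable borel"
          by measurable
        have "(LINT y|M. \<psi> (\<lambda>i\<in>I. Y i (x, y))) = (LINT t|distr M borel Z. \<psi> (\<lambda>i\<in>I. R i x + s i / V * t))"
          by (subst integral_distr) (auto simp: Y_def)
        also have "\<dots> = ?N \<psi> x"
          unfolding Zlaw by (subst integral_distr) auto
        finally show "(LINT y|M. \<psi> (\<lambda>i\<in>I. Y i (x, y))) = ?N \<psi> x" .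
      qed
      finally show ?thesis .
    qed
    have "(LINT x|M. \<phi> (\<lambda>i\<in>I. s i + X i x)) = (LINT x|M. (\<lambda>y. \<phi> (\<lambda>i\<in>I. s i + y i)) (\<lambda>i\<in>I. X i x))"
      by (intro Bochner_Integration.integral_cong refl arg_cong[of _ _ \<phi>] restrict_ext) simp
    also have "\<dots> = (LINT x|M. LINT \<xi>|std_normal. F x (\<xi> + sqrt V))"
    proof -
      have [measurable]: "(\<lambda>y. \<phi> (\<lambda>i\<in>I. s i + y i)) \<in> borel_measurable ?R" by measurable
      \<comment> \<open>Moving X by s moves Z by its variance V, hence the standard normal variable
        Z / sqrt V by sqrt V.\<close>
      have sV: "s i / V * (sqrt V * (\<xi> + sqrt V)) = s i + s i / V * (sqrt V * \<xi>)" for i \<xi>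
        using Vpos by (simp add: field_simps)
      show ?thesis unfolding F_def sV
        by (subst rep) (auto simp: \<phi>01 add_ac intro!: Bochner_Integration.integral_cong arg_cong[of _ _ \<phi>] restrict_ext)
    qed
    finally have E1: "(LINT x|M. \<phi> (\<lambda>i\<in>I. s i + X i x)) = \<dots>" .
    have E2: "(LINT x|M. \<phi> (\<lambda>i\<in>I. X i x)) = (LINT x|M. LINT \<xi>|std_normal. F x \<xi>)"
      unfolding F_def using \<phi>01 by (intro rep) auto
    interpret G: real_distribution std_normal by (rule real_dist_normal_dist)
    have int: "integrable M (\<lambda>x. LINT \<xi>|std_normal. F x (\<xi> + t))" for t
    proof (rule M.integrable_const_bound[of _ 1])
      have "\<bar>LINT \<xi>|std_normal. F x (\<xi> + t)\<bar> \<le> (LINT \<xi>|std_normal. 1)" if x: "x \<in> space M" for x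
      proof (rule order_trans[OF integral_abs_bound])
        note Fx[OF x, measurable]
        show "(LINT \<xi>|std_normal. \<bar>F x (\<xi> + t)\<bar>) \<le> (LINT \<xi>|std_normal. 1)"
          by (intro Bochner_Integration.integral_mono G.integrable_const_bound[of _ 1])
            (use \<phi>01 in \<open>auto simp: F_def[abs_def]\<close>)
      qed
      then show "AE x in M. norm (LINT \<xi>|std_normal. F x (\<xi> + t)) \<le> 1"
        using G.prob_space by simp
      show "(\<lambda>x. LINT \<xi>|std_normal. F x (\<xi> + t)) \<in> borel_measurable M"
        by measurable
    qed
    have d: "\<bar>(LINT \<xi>|std_normal. F x (\<xi> + sqrt V)) - (LINT \<xi>|std_normal. F x \<xi>)\<bar>
        \<le> sqrt (exp V - 1)" if x: "x \<in> space M" for x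
      using std_normal_shift[OF Fx[OF x], of "sqrt V"] \<phi>01 V0 by (simp add: F_def)
    have "\<bar>(LINT x|M. \<phi> (\<lambda>i\<in>I. s i + X i x)) - (LINT x|M. \<phi> (\<lambda>i\<in>I. X i x))\<bar>
        = \<bar>LINT x|M. (LINT \<xi>|std_normal. F x (\<xi> + sqrt V)) - (LINT \<xi>|std_normal. F x (\<xi> + 0))\<bar>"
      unfolding E1 E2 using int[of "sqrt V"] int[of 0] by simp
    also have "\<dots> \<le> (LINT x|M. \<bar>(LINT \<xi>|std_normal. F x (\<xi> + sqrt V)) - (LINT \<xi>|std_normal. F x (\<xi> + 0))\<bar>)"
      by (rule integral_abs_bound)
    also have "\<dots> \<le> (LINT x|M. sqrt (exp V - 1))"
      using int[of "sqrt V"] int[of 0] d by (intro Bochner_Integration.integral_mono integrable_abs Bochner_Integration.integrable_diff) simp_all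
    also have "\<dots> = sqrt (exp V - 1)" using M.prob_space by simp
    finally show ?thesis .
  qed
  also have "\<dots> \<le> sqrt (exp (S / l) - 1)" using VS by simp
  finally show ?thesis by (simp add: S_def)
qed

section \<open>The path space\<close>

abbreviation C01 :: "(real \<Rightarrow> real) metric" where
  "C01 \<equiv> cfunspace (top_of_set {0..1::real}) (euclidean_metric :: real metric)"

lemma mspace_C01: "mspace C01 = {y \<in> extensional {0..1}. continuous_on {0..1} y}"
proof -
  have "compactin (top_of_set {0..1::real}) (topspace (top_of_set {0..1::real}))"
    by (simp add: compactin_subtopology)
  from compactin_mspace_cfunspace[OF this, of "euclidean_metric :: real metric"] show ?thesis by auto
qed

lemma mdist_C01_le:
  assumes "y \<in> mspace C01" "z \<in> mspace C01"
  shows "mdist C01 y z \<le> a \<longleftrightarrow> (\<forall>t\<in>{0..1}. \<bar>y t - z t\<bar> \<le> a)"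
  using cfunspace_mdist_le[OF assms] by (simp add: dist_real_def)

text \<open>Closed balls are chosen because a supremum distance of at most r is a condition at each
  point separately.\<close>

lemma openin_C01:
  "openin (mtopology_of C01) U \<longleftrightarrow> U \<subseteq> mspace C01 \<and>
    (\<forall>y\<in>U. \<exists>r>0. \<forall>z\<in>mspace C01. (\<forall>t\<in>{0..1}. \<bar>y t - z t\<bar> \<le> r) \<longrightarrow> z \<in> U)"
proof -
  have "openin (mtopology_of C01) U \<longleftrightarrow> U \<subseteq> mspace C01 \<and>
    (\<forall>y\<in>U. \<exists>r>0. Metric_space.mcball (mspace C01) (mdist C01) y r \<subseteq> U)"
    unfolding mtopology_of_def
    by (subst Metric_space.openin_mtopology_mcball[OF Metric_space_mspace_mdist]) blast
  also have "\<dots> \<longleftrightarrow> U \<subseteq> mspace C01 \<and>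
    (\<forall>y\<in>U. \<exists>r>0. \<forall>z\<in>mspace C01. (\<forall>t\<in>{0..1}. \<bar>y t - z t\<bar> \<le> r) \<longrightarrow> z \<in> U)"
  proof (intro conj_cong refl ball_cong ex_cong1)
    fix y r assume "U \<subseteq> mspace C01" "y \<in> U"
    then have y: "y \<in> mspace C01" by blast
    show "Metric_space.mcball (mspace C01) (mdist C01) y r \<subseteq> U \<longleftrightarrow>
        (\<forall>z\<in>mspace C01. (\<forall>t\<in>{0..1}. \<bar>y t - z t\<bar> \<le> r) \<longrightarrow> z \<in> U)"
      unfolding subset_iff Metric_space.in_mcball[OF Metric_space_mspace_mdist]
      using y mdist_C01_le[OF y] by blast
  qed
  finally show ?thesis .
qed

lemma space_borel_C01: "space borel_C01 = mspace C01"
  by (auto simp: borel_C01_def Let_def openin_C01 intro!: space_measure_of)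

lemma sets_borel_C01: "openin (mtopology_of C01) U \<Longrightarrow> U \<in> sets borel_C01"
  unfolding borel_C01_def Let_def by (subst sets_measure_of) (auto simp: openin_C01)

text \<open>Every open set is a union of sets from a countable family, and by continuity membership
  of a path in such a set is decided at rational times; so measurability of the single coordinates
  suffices.\<close>

lemma measurable_borel_C01I:
  fixes Y :: "real \<Rightarrow> 'a \<Rightarrow> real"
  assumes Y: "\<And>t. t \<in> {0..1} \<Longrightarrow> Y t \<in> borel_measurable M"
    and cont: "\<And>x. x \<in> space M \<Longrightarrow> continuous_on {0..1} (\<lambda>t. Y t x)"
  shows "(\<lambda>x. \<lambda>t\<in>{0..1}. Y t x) \<in> measurable M borel_C01"
proof -
  let ?I = "\<lambda>n i. {real i / real n..real (Suc i) / real n} :: real set"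
  define path where "path x = (\<lambda>t\<in>{0..1}. Y t x)" for x
  have path: "path x \<in> mspace C01" if "x \<in> space M" for x
  proof -
    have "continuous_on {0..1} (path x)"
      by (rule continuous_on_eq[OF cont[OF that]]) (simp add: path_def)
    then show ?thesis unfolding mspace_C01 by (simp add: path_def)
  qed
  \<comment> \<open>A countable family of cylinders \<open>B c\<close> replaces separability: \<open>c = (n, q, d)\<close> prescribes
    the values on each of \<open>n\<close> cells up to \<open>d\<close>.\<close>
  define B :: "nat \<times> rat list \<times> rat \<Rightarrow> (real \<Rightarrow> real) set" where
    "B = (\<lambda>(n, q, d). {z \<in> mspace C01. \<forall>i<n. \<forall>t\<in>?I n i. \<bar>z t - of_rat (q ! i)\<bar> \<le> of_rat d})"
  have cell01: "?I n i \<subseteq> {0..1}" if "i < n" for i n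
  proof -
    have "real (Suc i) / real n \<le> 1" using that by simp
    moreover have "0 \<le> real i / real n" by simp
    ultimately show ?thesis by (simp only: atLeastatMost_subset_iff simp_thms)
  qed
  have meas: "path -` B c \<inter> space M \<in> sets M" for c
  proof -
    obtain n q d where c: "c = (n, q, d)" by (cases c)
    have dense: "closure (?I n i \<inter> \<rat>) = ?I n i" if "i < n" for i
    proof -
      have "real i / real n < real (Suc i) / real n" using that by (simp add: divide_strict_right_mono)
      then have "closure (?I n i \<inter> \<rat>) = closure (?I n i)"
        by (intro closure_convex_Int_superset) (auto simp: Rats_closure_real)
      then show ?thesis by simp
    qed
    have "path -` B c \<inter> space M
        = {x \<in> space M. \<forall>i\<in>{..<n}. \<forall>t\<in>?I n i \<inter> \<rat>. \<bar>Y t x - of_rat (q ! i)\<bar> \<le> of_rat d}"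
    proof (intro set_eqI iffI)
      fix x assume "x \<in> path -` B c \<inter> space M"
      then show "x \<in> {x \<in> space M. \<forall>i\<in>{..<n}. \<forall>t\<in>?I n i \<inter> \<rat>. \<bar>Y t x - of_rat (q ! i)\<bar> \<le> of_rat d}"
        using cell01[of _ n] by (auto simp: B_def c path_def subset_eq)
    next
      fix x assume x: "x \<in> {x \<in> space M. \<forall>i\<in>{..<n}. \<forall>t\<in>?I n i \<inter> \<rat>. \<bar>Y t x - of_rat (q ! i)\<bar> \<le> of_rat d}"
      have "norm (Y t x - of_rat (q ! i)) \<le> of_rat d" if i: "i < n" and t: "t \<in> ?I n i" for i t
      proof (rule continuous_on_closure_norm_le[of "?I n i \<inter> \<rat>" "\<lambda>t. Y t x - of_rat (q ! i)"])
        show "continuous_on (closure (?I n i \<inter> \<rat>)) (\<lambda>t. Y t x - of_rat (q ! i))"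
          unfolding dense[OF i] using x cell01[OF i]
          by (intro continuous_on_diff continuous_on_const continuous_on_subset[OF cont[of x]]) auto
        show "\<forall>t\<in>?I n i \<inter> \<rat>. norm (Y t x - of_rat (q ! i)) \<le> of_rat d" using x i by auto
        show "t \<in> closure (?I n i \<inter> \<rat>)" unfolding dense[OF i] by (rule t)
      qed
      then show "x \<in> path -` B c \<inter> space M"
        using x path[of x] cell01[of _ n] by (auto simp: B_def c path_def subset_eq)
    qed
    also have "\<dots> \<in> sets M"
    proof -
      have "Measurable.pred M (\<lambda>x. \<bar>Y t x - of_rat (q ! i)\<bar> \<le> of_rat d)" if "i < n" "t \<in> ?I n i" for i t
      proof -
        have [measurable]: "Y t \<in> borel_measurable M"
          using subsetD[OF cell01[OF that(1)] that(2)] by (rule Y)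
        show ?thesis by measurable
      qed
      then have "Measurable.pred M (\<lambda>x. \<forall>i\<in>{..<n}. \<forall>t\<in>?I n i \<inter> \<rat>. \<bar>Y t x - of_rat (q ! i)\<bar> \<le> of_rat d)"
        by (intro pred_intros_countable_bounded) (auto simp: countable_rat intro: countable_subset[OF _ countable_rat])
      then show ?thesis by (simp add: pred_def)
    qed
    finally show ?thesis .
  qed
  have cover: "\<exists>c. y \<in> B c \<and> B c \<subseteq> U" if U: "openin (mtopology_of C01) U" and y: "y \<in> U" for U y
  proof -
    obtain r where r: "0 < r" "\<And>z. z \<in> mspace C01 \<Longrightarrow> (\<forall>t\<in>{0..1}. \<bar>y t - z t\<bar> \<le> r) \<Longrightarrow> z \<in> U"
      using U y unfolding openin_C01 by blast
    have yC: "y \<in> mspace C01" using U y unfolding openin_C01 by blast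
    then have "uniformly_continuous_on {0..1} y"
      by (intro compact_uniformly_continuous) (auto simp: mspace_C01)
    \<comment> \<open>Two paths within d of the same step function are within 2d < r of each other.
      Of the distance d between y and its step function, one half covers the oscillation on a cell
      and the other the rational approximation.\<close>
    obtain d where d: "0 < real_of_rat d" "real_of_rat d < r / 2"
      using of_rat_dense[of 0 "r / 2"] r(1) by auto
    obtain e where e: "0 < e" "\<And>s t. s \<in> {0..1} \<Longrightarrow> t \<in> {0..1} \<Longrightarrow> \<bar>t - s\<bar> < e \<Longrightarrow> \<bar>y t - y s\<bar> < of_rat d / 2"
      using \<open>uniformly_continuous_on {0..1} y\<close> d(1) unfolding uniformly_continuous_on_def dist_real_def
      by (metis half_gt_zero)
    obtain n where n: "1 / e < real n" using reals_Archimedean2 by blast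
    have n0: "0 < n" using n e(1) by (metis divide_pos_pos less_trans of_nat_0_less_iff zero_less_one)
    have ne: "1 / real n < e" using n e(1) n0 by (simp add: field_simps)
    have "\<exists>q. \<bar>y (real i / real n) - of_rat q\<bar> < of_rat d / 2" for i
    proof -
      obtain q where "y (real i / real n) - of_rat d / 2 < of_rat q" "of_rat q < y (real i / real n) + of_rat d / 2"
        using of_rat_dense[of "y (real i / real n) - of_rat d / 2" "y (real i / real n) + of_rat d / 2"] d(1) by auto
      then show ?thesis by (intro exI[of _ q]) (auto simp: abs_if)
    qed
    then obtain qq where qq: "\<And>i. \<bar>y (real i / real n) - of_rat (qq i)\<bar> < of_rat d / 2" by metis
    define c where "c = (n, map qq [0..<n], d)"
    have "\<bar>y t - of_rat (qq i)\<bar> \<le> of_rat d"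
      if i: "i < n" and t: "t \<in> ?I n i" for i t
    proof -
      have t01: "t \<in> {0..1}" using cell01[OF i] t by blast
      have s01: "real i / real n \<in> {0..1}" using i by simp
      have "\<bar>t - real i / real n\<bar> < e" using t ne by (simp add: add_divide_distrib)
      from e(2)[OF s01 t01 this] qq[of i] show ?thesis by linarith
    qed
    then have yB: "y \<in> B c" using yC unfolding B_def c_def by simp
    have "B c \<subseteq> U"
    proof
      fix z assume z: "z \<in> B c"
      have "\<bar>y t - z t\<bar> \<le> r" if t: "t \<in> {0..1}" for t
      proof -
        obtain i where i: "i < n" "t \<in> ?I n i"
        \<comment> \<open>The right endpoint belongs to the last cell, whereas the integer part of t
          n would be n there.\<close>
        proof (cases "t = 1")
          case True
          show thesis using n0 True by (intro that[of "n - 1"]) (auto simp: of_nat_diff field_simps)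
        next
          case False
          define i where "i = nat \<lfloor>t * real n\<rfloor>"
          have ti: "real i \<le> t * real n" "t * real n < real i + 1" using t by (simp_all add: i_def)
          have "t * real n < 1 * real n" using t False n0 by (intro mult_strict_right_mono) auto
          with ti(1) have "real i < real n" by linarith
          moreover have "t \<in> ?I n i" using ti n0 by (simp add: field_simps)
          ultimately have "i < n" "t \<in> ?I n i" by simp_all
          then show thesis by (rule that)
        qed
        then have "\<bar>y t - of_rat (qq i)\<bar> \<le> of_rat d" "\<bar>z t - of_rat (qq i)\<bar> \<le> of_rat d"
          using yB z by (auto simp: B_def c_def)
        then show ?thesis using d(2) by linarith
      qed
      then show "z \<in> U" using z by (intro r(2)) (auto simp: B_def c_def)
    qed
    then show ?thesis using yB by blast
  qed
  show ?thesis
    unfolding borel_C01_def Let_def path_def[symmetric]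
  proof (rule measurable_measure_of)
    show "{U. openin (mtopology_of C01) U} \<subseteq> Pow (mspace C01)" by (auto simp: openin_C01)
    show "path \<in> space M \<rightarrow> mspace C01" using path by auto
    fix U assume "U \<in> {U. openin (mtopology_of C01) U}"
    then have "path -` U \<inter> space M = (\<Union>c\<in>{c. B c \<subseteq> U}. path -` B c \<inter> space M)"
      using cover[of U] by fastforce
    also have "\<dots> \<in> sets M" using meas by (intro sets.countable_UN') auto
    finally show "path -` U \<inter> space M \<in> sets M" .
  qed
qed

section \<open>The alternating sum of increments as a test statistic\<close>

text \<open>The nodes start at the centre of symmetry 1/2, where the cosine in the antiderivative of
  sin(\<omega>(2t - 1)) has phase 0. The step h is later set to half a period of the frequency to be
  detected.\<close>

definition alt_increments :: "nat \<Rightarrow> real \<Rightarrow> (real \<Rightarrow> real) \<Rightarrow> real" where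
  "alt_increments J h y = (\<Sum>i<J. (-1) ^ i * (y (1/2 + real (Suc i) * h) - y (1/2 + real i * h)))"

lemma alt_increments_nodes:
  assumes "0 \<le> h" "real J * h \<le> 1 / 2" "i \<le> J"
  shows "1/2 + real i * h \<in> {0..1}"
proof -
  have "real i * h \<le> real J * h" using assms by (intro mult_right_mono) auto
  then show ?thesis using assms by auto
qed

text \<open>Moving the path by r in the supremum norm moves the statistic by at most 2 J r, so the
  rejection region is open.\<close>

lemma alt_increments_pos_sets:
  assumes h: "0 \<le> h" "real J * h \<le> 1 / 2"
  shows "{y \<in> mspace C01. 0 < alt_increments J h y} \<in> sets borel_C01"
proof (rule sets_borel_C01, unfold openin_C01, intro conjI ballI)
  fix y assume "y \<in> {y \<in> mspace C01. 0 < alt_increments J h y}"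
  then have y: "0 < alt_increments J h y" by simp
  define r where "r = alt_increments J h y / (2 * real J + 1) / 2"
  have r: "0 < r" using y by (simp add: r_def)
  have "0 < alt_increments J h z" if z: "\<forall>t\<in>{0..1}. \<bar>y t - z t\<bar> \<le> r" for z
  proof -
    note t = alt_increments_nodes[OF h]
    have "alt_increments J h y - alt_increments J h z \<le> (\<Sum>i<J. 2 * r)"
      unfolding alt_increments_def sum_subtractf[symmetric]
    proof (rule sum_mono)
      fix i assume "i \<in> {..<J}"
      then have "\<bar>y (1/2 + real (Suc i) * h) - z (1/2 + real (Suc i) * h)\<bar> \<le> r" "\<bar>y (1/2 + real i * h) - z (1/2 + real i * h)\<bar> \<le> r"
        using z t[of i] t[of "Suc i"] by auto
      then show "(-1) ^ i * (y (1/2 + real (Suc i) * h) - y (1/2 + real i * h))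
          - (-1) ^ i * (z (1/2 + real (Suc i) * h) - z (1/2 + real i * h)) \<le> 2 * r"
        by (cases "even i") (simp_all del: of_nat_Suc add: abs_le_iff)
    qed
    also have "\<dots> = 2 * real J * r" by simp
    also have "\<dots> < (2 * real J + 1) * 2 * r"
    proof -
      have "0 \<le> real J * r" using r by simp
      then have "2 * (real J * r) < 4 * (real J * r) + 2 * r" using r by linarith
      then show ?thesis by (simp add: algebra_simps)
    qed
    also have "\<dots> = alt_increments J h y" unfolding r_def by (simp add: field_simps)
    finally show ?thesis by simp
  qed
  then show "\<exists>r>0. \<forall>z\<in>mspace C01. (\<forall>t\<in>{0..1}. \<bar>y t - z t\<bar> \<le> r) \<longrightarrow> z \<in> {y \<in> mspace C01. 0 < alt_increments J h y}"
    using r by auto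
qed auto

section \<open>Finite sine sums\<close>

text \<open>The real form of a finite antisymmetric series: each summand is odd about t =
  1/2.\<close>

definition sine_sum :: "(int \<Rightarrow> real) \<Rightarrow> int set \<Rightarrow> (int \<Rightarrow> real) \<Rightarrow> real \<Rightarrow> real" where
  "sine_sum \<omega> S b = (\<lambda>t\<in>{0..1}. \<Sum>k\<in>S. b k * sin (\<omega> k * (2 * t - 1)))"

lemma sum_symmetric_support:
  fixes g :: "int \<Rightarrow> 'b::comm_monoid_add"
  assumes S: "finite S" "S \<subseteq> {1..}" and A: "finite A" "S \<subseteq> A" "uminus ` S \<subseteq> A"
    and g: "\<And>k. k \<notin> S \<Longrightarrow> - k \<notin> S \<Longrightarrow> g k = 0"
  shows "(\<Sum>k\<in>A. g k) = (\<Sum>k\<in>S. g k + g (- k))"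
proof -
  have "(\<Sum>k\<in>A. g k) = (\<Sum>k\<in>S \<union> uminus ` S. g k)"
  proof (rule sum.mono_neutral_right)
    show "\<forall>k\<in>A - (S \<union> uminus ` S). g k = 0"
    proof
      fix k assume "k \<in> A - (S \<union> uminus ` S)"
      then have "k \<notin> S" "k \<notin> uminus ` S" by auto
      moreover have "- k \<notin> S" using imageI[of "- k" S uminus] \<open>k \<notin> uminus ` S\<close> by auto
      ultimately show "g k = 0" by (intro g)
    qed
  qed (use A in auto)
  also have "\<dots> = (\<Sum>k\<in>S. g k) + (\<Sum>k\<in>uminus ` S. g k)"
  proof (intro sum.union_disjoint)
    show "S \<inter> uminus ` S = {}"
    proof (rule ccontr)
      assume "S \<inter> uminus ` S \<noteq> {}"
      then obtain k where "k \<in> S" "- k \<in> S" by auto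
      then have "1 \<le> k" "1 \<le> - k" using S(2) by auto
      then show False by simp
    qed
  qed (use S in auto)
  also have "(\<Sum>k\<in>uminus ` S. g k) = (\<Sum>k\<in>S. g (- k))"
    by (subst sum.reindex) (auto simp: inj_on_def)
  finally show ?thesis by (simp add: sum.distrib)
qed

lemma sine_sum_continuous: "continuous_on {0..1} (sine_sum \<omega> S b)"
proof -
  have "continuous_on {0..1} (\<lambda>t. \<Sum>k\<in>S. b k * sin (\<omega> k * (2 * t - 1)))"
    by (intro continuous_intros)
  then show ?thesis by (rule continuous_on_eq) (simp add: sine_sum_def)
qed

text \<open>By Euler's formula the coefficients at k and -k have modulus |b_k|/2, so the squared
  Sobolev norm is half the weighted sum of the b_k^2, whence the bound 2 C^2. The factor of modulus
  1 in \<theta> converts the variable 2t - 1 into 2t.\<close>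

lemma sine_sum_in_sobolev_ball_sym:
  assumes \<omega>: "\<And>k. \<omega> (- k) = - \<omega> k" and S: "finite S" "S \<subseteq> {1..}"
    and C: "(\<Sum>k\<in>S. (1 + real_of_int k) powr (2 * \<alpha>) * (b k)\<^sup>2) \<le> 2 * C\<^sup>2"
  shows "sine_sum \<omega> S b \<in> sobolev_ball_sym \<omega> \<alpha> C"
proof -
  define \<theta> :: "int \<Rightarrow> complex" where
    "\<theta> k = (if k \<in> S then - (\<i> / 2) * b k * iexp (- \<omega> k)
      else if - k \<in> S then (\<i> / 2) * b (- k) * iexp (\<omega> (- k)) else 0)" for k
  have neg: "- k \<notin> S" if k: "k \<in> S" for k
  proof
    assume "- k \<in> S"
    then have "1 \<le> k" "1 \<le> - k" using k S(2) by auto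
    then show False by simp
  qed
  have \<theta>S: "\<theta> k = - (\<i> / 2) * b k * iexp (- \<omega> k)" "\<theta> (- k) = (\<i> / 2) * b k * iexp (\<omega> k)"
    if "k \<in> S" for k using that neg[OF that] by (auto simp: \<theta>_def)
  have \<theta>0: "\<theta> k = 0" if "k \<notin> S" "- k \<notin> S" for k using that by (simp add: \<theta>_def)
  have cnj: "\<theta> k = cnj (\<theta> (- k))" for k
  proof -
    consider "k \<in> S" | "- k \<in> S" | "k \<notin> S" "- k \<notin> S" by blast
    then show ?thesis
    proof cases
      case 1
      then show ?thesis by (simp add: \<theta>S exp_cnj)
    next
      case 2
      then show ?thesis using \<theta>S[OF 2] by (simp add: exp_cnj)
    qed (simp_all add: \<theta>0)
  qed
  let ?w = "\<lambda>k. (1 + \<bar>real_of_int k\<bar>) powr (2 * \<alpha>) * (cmod (\<theta> k))\<^sup>2"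
  have w0: "?w k = 0" if "k \<notin> S" "- k \<notin> S" for k using \<theta>0[OF that] by simp
  have w0': "?w k = 0" if "k \<in> UNIV - (S \<union> uminus ` S)" for k
  proof (rule w0)
    show "k \<notin> S" "- k \<notin> S" using that imageI[of "- k" S uminus] by auto
  qed
  have "finite (S \<union> uminus ` S)" using S by simp
  then have "?w summable_on (S \<union> uminus ` S)" by (rule summable_on_finite)
  then have summ: "?w summable_on UNIV"
    by (rule summable_on_cong_neutral[THEN iffD1, rotated -1]) (use w0' in auto)
  have "(\<Sum>\<^sub>\<infinity>k. ?w k) = (\<Sum>\<^sub>\<infinity>k\<in>S \<union> uminus ` S. ?w k)"
    by (rule infsum_cong_neutral) (use w0' in auto)
  also have "\<dots> = (\<Sum>k\<in>S \<union> uminus ` S. ?w k)" using S by simp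
  also have "\<dots> = (\<Sum>k\<in>S. ?w k + ?w (- k))"
    using S w0 by (intro sum_symmetric_support) auto
  also have "\<dots> = (\<Sum>k\<in>S. (1 + real_of_int k) powr (2 * \<alpha>) * (b k)\<^sup>2) / 2"
    unfolding sum_divide_distrib
  proof (intro sum.cong refl)
    fix k assume k: "k \<in> S"
    then have "1 \<le> k" using S by auto
    moreover have c: "(cmod (\<theta> k))\<^sup>2 = (b k)\<^sup>2 / 4" "(cmod (\<theta> (- k)))\<^sup>2 = (b k)\<^sup>2 / 4"
      using k by (simp_all add: \<theta>S norm_mult norm_divide power_divide)
    ultimately show "?w k + ?w (- k) = (1 + real_of_int k) powr (2 * \<alpha>) * (b k)\<^sup>2 / 2"
      unfolding c by simp
  qed
  finally have inf: "(\<Sum>\<^sub>\<infinity>k. ?w k) \<le> C\<^sup>2" using C by simp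
  have lim: "(\<lambda>n. \<Sum>k\<in>{- int n..int n}. \<theta> k * exp (2 * \<i> * of_real (\<omega> k) * of_real t))
      \<longlonglongrightarrow> complex_of_real (sine_sum \<omega> S b t)" if t: "t \<in> {0..1}" for t
  proof (rule tendsto_eventually)
    let ?e = "\<lambda>x. exp (2 * \<i> * of_real x * of_real t) :: complex"
    obtain n0 :: nat where n0: "\<And>k. k \<in> S \<Longrightarrow> k \<le> int n0"
    proof -
      have "k \<le> int (nat (\<Sum>k\<in>S. \<bar>k\<bar>))" if "k \<in> S" for k
        using member_le_sum[of k S abs] S that by auto
      then show thesis using that by blast
    qed
    show "\<forall>\<^sub>F n in sequentially. (\<Sum>k\<in>{- int n..int n}. \<theta> k * ?e (\<omega> k))
        = complex_of_real (sine_sum \<omega> S b t)"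
      using eventually_ge_at_top[of n0]
    proof eventually_elim
      case (elim n)
      have "(\<Sum>k\<in>{- int n..int n}. \<theta> k * ?e (\<omega> k))
          = (\<Sum>k\<in>S. \<theta> k * ?e (\<omega> k)
              + \<theta> (- k) * ?e (\<omega> (- k)))"
      proof (rule sum_symmetric_support)
        show "S \<subseteq> {- int n..int n}" "uminus ` S \<subseteq> {- int n..int n}"
          using S(2) n0 elim by force+
      qed (use S \<theta>0 in auto)
      also have "\<dots> = (\<Sum>k\<in>S. complex_of_real (b k * sin (\<omega> k * (2 * t - 1))))"
      proof (intro sum.cong refl)
        fix k assume k: "k \<in> S"
        define x where "x = \<omega> k * (2 * t - 1)"
        have e1: "iexp (- \<omega> k) * ?e (\<omega> k) = iexp x"
          and e2: "iexp (\<omega> k) * ?e (- \<omega> k) = iexp (- x)"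
          by (simp_all add: exp_add[symmetric] x_def algebra_simps)
        have s: "complex_of_real (sin x) = - (\<i> / 2) * (iexp x - iexp (- x))"
        proof -
          have e: "iexp y = of_real (cos y) + \<i> * of_real (sin y)" for y
            using exp_Euler[of "complex_of_real y"] by (simp only: cos_of_real sin_of_real)
          show ?thesis unfolding e[of x] e[of "- x"] by (simp add: algebra_simps)
        qed
        have "\<theta> k * ?e (\<omega> k) = - (\<i> / 2) * b k * iexp x"
          unfolding \<theta>S(1)[OF k] mult.assoc e1[unfolded mult.assoc] ..
        moreover have "\<theta> (- k) * ?e (\<omega> (- k)) = (\<i> / 2) * b k * iexp (- x)"
          unfolding \<theta>S(2)[OF k] \<omega> mult.assoc e2[unfolded mult.assoc] ..
        ultimately show "\<theta> k * ?e (\<omega> k)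
              + \<theta> (- k) * ?e (\<omega> (- k))
            = complex_of_real (b k * sin (\<omega> k * (2 * t - 1)))"
          unfolding x_def[symmetric] of_real_mult s by (simp add: algebra_simps)
      qed
      also have "\<dots> = complex_of_real (sine_sum \<omega> S b t)" using t by (simp add: sine_sum_def)
      finally show ?case .
    qed
  qed
  have si: "set_integrable lborel {0..1} (sine_sum \<omega> S b)"
    by (rule borel_integrable_atLeastAtMost'[OF sine_sum_continuous])
  have ext: "sine_sum \<omega> S b \<in> extensional {0..1}" by (simp add: sine_sum_def)
  have "sine_sum \<omega> S b \<in> sobolev_ball \<omega> \<alpha> C"
    unfolding sobolev_ball_def mem_Collect_eq
    by (intro conjI exI[of _ \<theta>] ballI allI ext si cnj summ inf lim)
  moreover have "sine_sum \<omega> S b t = - sine_sum \<omega> S b (1 - t)" if "t \<in> {0..1}" for t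
  proof -
    have s: "sin (\<omega> k * (2 * t - 1)) = - sin (\<omega> k * (2 * (1 - t) - 1))" for k
    proof -
      have "\<omega> k * (2 * t - 1) = - (\<omega> k * (2 * (1 - t) - 1))" by (simp add: algebra_simps)
      then show ?thesis by (simp only: sin_minus)
    qed
    have "(\<Sum>k\<in>S. b k * sin (\<omega> k * (2 * t - 1))) = - (\<Sum>k\<in>S. b k * sin (\<omega> k * (2 * (1 - t) - 1)))"
      unfolding sum_negf[symmetric] by (intro sum.cong refl) (subst s, simp)
    then show ?thesis using that by (simp add: sine_sum_def)
  qed
  ultimately show ?thesis unfolding sobolev_ball_sym_def by blast
qed

lemma integral_sine_sum:
  assumes S: "finite S" "\<And>k. k \<in> S \<Longrightarrow> \<omega> k \<noteq> 0" and t: "t \<in> {0..1}"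
  shows "(LBINT u:{0..t}. sine_sum \<omega> S b u)
      = (\<Sum>k\<in>S. b k * ((cos (\<omega> k) - cos (\<omega> k * (2 * t - 1))) / (2 * \<omega> k)))"
proof -
  define F where "F x = (\<Sum>k\<in>S. - (b k / (2 * \<omega> k)) * cos (\<omega> k * (2 * x - 1)))" for x
  have "(LBINT u:{0..t}. sine_sum \<omega> S b u) = F t - F 0"
    unfolding set_lebesgue_integral_def
  proof (rule integral_FTC_atLeastAtMost)
    show "continuous_on {0..t} (sine_sum \<omega> S b)"
      using t by (intro continuous_on_subset[OF sine_sum_continuous]) auto
    fix x assume x: "0 \<le> x" "x \<le> t"
    have "(F has_real_derivative (\<Sum>k\<in>S. b k * sin (\<omega> k * (2 * x - 1)))) (at x within {0..t})"
      unfolding F_def using S(2)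
      by (intro DERIV_sum) (auto intro!: derivative_eq_intros simp: field_simps)
    then show "(F has_vector_derivative sine_sum \<omega> S b x) (at x within {0..t})"
      using x t by (simp add: sine_sum_def has_real_derivative_iff_has_vector_derivative)
  qed (use t in simp)
  also have "\<dots> = (\<Sum>k\<in>S. b k * ((cos (\<omega> k) - cos (\<omega> k * (2 * t - 1))) / (2 * \<omega> k)))"
    unfolding F_def sum_subtractf[symmetric]
    by (intro sum.cong refl) (simp add: diff_divide_distrib right_diff_distrib)
  finally show ?thesis .
qed

section \<open>Resonance of alternating cosine increments\<close>

text \<open>The response of the statistic to a frequency whose phase advances by \<beta> per step:
  -2J at the resonance \<beta> = pi, but bounded in J for 0 <= \<beta> <= pi/2.\<close>

definition alt_cos_sum :: "nat \<Rightarrow> real \<Rightarrow> real" where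
  "alt_cos_sum J \<beta> = (\<Sum>i<J. (-1) ^ i * (cos (\<beta> * real (Suc i)) - cos (\<beta> * real i)))"

lemma alt_cos_sum_pi: "alt_cos_sum J pi = - 2 * real J"
proof -
  have "(-1) ^ i * (cos (pi * real (Suc i)) - cos (pi * real i)) = - 2" for i
    by (cases "even i") (simp_all add: cos_npi mult.commute[of pi] del: of_nat_Suc)
  then show ?thesis by (simp add: alt_cos_sum_def)
qed

text \<open>Multiplied by cos(\<beta>/2) the sum telescopes to sin(\<beta>/2) (-1)^J sin(\<beta> J),
  so its modulus is at most tan(\<beta>/2) <= 1.\<close>

lemma abs_alt_cos_sum_le:
  assumes "0 \<le> \<beta>" "\<beta> \<le> pi / 2"
  shows "\<bar>alt_cos_sum J \<beta>\<bar> \<le> 1"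
proof -
  let ?c = "cos (\<beta> / 2)" and ?s = "sin (\<beta> / 2)"
  have "?c * alt_cos_sum J \<beta> = ?s * ((-1) ^ J * sin (\<beta> * real J))"
  proof (induction J)
    case (Suc J)
    define x where "x = \<beta> * real J + \<beta> / 2"
    have x: "\<beta> * real (Suc J) = x + \<beta> / 2" "\<beta> * real J = x - \<beta> / 2" by (simp_all add: x_def algebra_simps)
    have "?c * alt_cos_sum (Suc J) \<beta> = ?s * ((-1) ^ J * sin (x - \<beta> / 2)) + ?c * ((-1) ^ J * (cos (x + \<beta> / 2) - cos (x - \<beta> / 2)))"
      using Suc unfolding alt_cos_sum_def x(1)[symmetric] x(2)[symmetric] by (simp add: distrib_left del: of_nat_Suc)
    also have "\<dots> = ?s * ((-1) ^ Suc J * sin (x + \<beta> / 2))"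
      by (simp add: sin_add sin_diff cos_add cos_diff algebra_simps)
    finally show ?case unfolding x(1) .
  qed (simp add: alt_cos_sum_def)
  then have "\<bar>?c\<bar> * \<bar>alt_cos_sum J \<beta>\<bar> = \<bar>?s\<bar> * \<bar>sin (\<beta> * real J)\<bar>"
    by (drule_tac arg_cong[of _ _ abs]) (simp add: abs_mult)
  also have "\<dots> \<le> \<bar>?s\<bar> * 1" by (intro mult_left_mono) auto
  also have "\<dots> \<le> \<bar>?c\<bar> * 1"
  proof -
    have "?s \<le> sin (pi / 4)" using assms by (intro sin_monotone_2pi_le) auto
    moreover have "cos (pi / 4) \<le> ?c" using assms by (intro cos_monotone_0_pi_le) auto
    moreover have "0 \<le> ?s" using assms by (intro sin_ge_zero) auto
    ultimately show ?thesis by (simp add: sin_45 cos_45)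
  qed
  finally have "\<bar>?c\<bar> * \<bar>alt_cos_sum J \<beta>\<bar> \<le> \<bar>?c\<bar> * 1" .
  moreover have "0 < ?c" using assms pi_gt_zero by (intro cos_gt_zero_pi) linarith+
  ultimately show ?thesis by (simp add: mult_le_cancel_left)
qed

text \<open>At the node 1/2 + i h the phase \<omega>(2t - 1) equals 2\<omega>h i, and the constants
  cos \<omega> cancel in every increment.\<close>

lemma alt_increments_integral_sine_sum:
  assumes S: "finite S" "\<And>k. k \<in> S \<Longrightarrow> \<omega> k \<noteq> 0" and h: "0 \<le> h" "real J * h \<le> 1 / 2"
  shows "alt_increments J h (\<lambda>t. LBINT u:{0..t}. sine_sum \<omega> S b u)
      = - (\<Sum>k\<in>S. b k / (2 * \<omega> k) * alt_cos_sum J (2 * \<omega> k * h))"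
proof -
  let ?c = "\<lambda>k i. cos (2 * \<omega> k * h * real i)"
  note t = alt_increments_nodes[OF h]
  have "(LBINT u:{0..1/2 + real (Suc i) * h}. sine_sum \<omega> S b u) - (LBINT u:{0..1/2 + real i * h}. sine_sum \<omega> S b u)
      = - (\<Sum>k\<in>S. b k / (2 * \<omega> k) * (?c k (Suc i) - ?c k i))"
    if i: "i < J" for i
  proof -
    have x: "\<omega> k * (2 * (1/2 + real i * h) - 1) = 2 * \<omega> k * h * real i" for k i by (simp add: algebra_simps)
    have "1/2 + real i * h \<in> {0..1}" "1/2 + real (Suc i) * h \<in> {0..1}" using t[of i] t[of "Suc i"] i by auto
    then show ?thesis
      unfolding sum_negf[symmetric]
      by (subst (1 2) integral_sine_sum[OF S]; (assumption | simp only: x sum_subtractf[symmetric]))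
        (auto intro!: sum.cong simp: right_diff_distrib diff_divide_distrib simp del: of_nat_Suc)
  qed
  then have "alt_increments J h (\<lambda>t. LBINT u:{0..t}. sine_sum \<omega> S b u)
      = (\<Sum>i<J. (-1) ^ i * - (\<Sum>k\<in>S. b k / (2 * \<omega> k) * (?c k (Suc i) - ?c k i)))"
    unfolding alt_increments_def by (intro sum.cong refl) (simp only: lessThan_iff)
  also have "\<dots> = - (\<Sum>i<J. \<Sum>k\<in>S. b k / (2 * \<omega> k) * ((-1) ^ i * (?c k (Suc i) - ?c k i)))"
    by (simp add: sum_negf sum_distrib_left mult_ac del: of_nat_Suc)
  also have "\<dots> = - (\<Sum>k\<in>S. b k / (2 * \<omega> k) * alt_cos_sum J (2 * \<omega> k * h))"
    unfolding alt_cos_sum_def sum_distrib_left by (subst sum.swap) simp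
  finally show ?thesis .
qed

section \<open>Testing\<close>

text \<open>Increments over steps of length h have the covariance of h^H times fractional Gaussian
  noise. A single one has variance h^(2H) for every H; for several, the bound rests on the
  alternating estimate for H >= 1/2.\<close>

lemma fbm_alt_increments_law:
  assumes B: "fractional_brownian_motion H M B" and H: "0 < H" "H < 1" and h: "0 < h"
    and J: "J = 1 \<or> 1/2 \<le> H"
  obtains v where "0 \<le> v" "v \<le> real J * h powr (2 * H)"
    "distr M borel (\<lambda>x. alt_increments J h (\<lambda>t. B t x)) = normal_law 0 v"
proof -
  let ?K = "\<lambda>s t. (\<bar>t\<bar> powr (2 * H) + \<bar>s\<bar> powr (2 * H) - \<bar>t - s\<bar> powr (2 * H)) / 2 :: real"
  have G: "centered_gaussian_process M {0..} B ?K"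
    using B by (simp add: fractional_brownian_motion_def)
  define p where "p i = 1/2 + real i * h" for i :: nat
  define S where "S = p ` {..J}"
  have S: "finite S" "S \<subseteq> {0..}" using h by (auto simp: S_def p_def)
  \<comment> \<open>The i-th increment as a weight vector on the common set \<open>S\<close> of
    nodes, namely a difference of two indicators.\<close>
  define a where "a i t = (if t = p (Suc i) then 1 else 0) - (if t = p i then 1 else 0 :: real)" for i t
  have delta: "(\<Sum>t\<in>S. a i t * f t) = f (p (Suc i)) - f (p i)" if "i < J" for i and f :: "real \<Rightarrow> real"
  proof -
    have "p i \<in> S" "p (Suc i) \<in> S" using that by (auto simp: S_def)
    have "(\<Sum>t\<in>S. a i t * f t) = (\<Sum>t\<in>S. if t = p (Suc i) then f t else 0) - (\<Sum>t\<in>S. if t = p i then f t else 0)"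
      unfolding sum_subtractf[symmetric] by (intro sum.cong refl) (simp add: a_def)
    then show ?thesis using S(1) \<open>p i \<in> S\<close> \<open>p (Suc i) \<in> S\<close> by simp
  qed
  let ?Kd = "\<lambda>i k. \<Sum>s\<in>S. \<Sum>t\<in>S. a i s * a k t * ?K s t"
  have D: "centered_gaussian_process M {..<J} (\<lambda>i x. \<Sum>t\<in>S. a i t * B t x) ?Kd"
    by (rule gaussian_combinations[OF G S])
  have Kd: "?Kd i k = h powr (2 * H) * fgn_cov H i k" if "i < J" "k < J" for i k
  proof -
    have "?Kd i k = (\<Sum>s\<in>S. a i s * (\<Sum>t\<in>S. a k t * ?K s t))" by (simp add: sum_distrib_left mult.assoc)
    also have "\<dots> = (\<Sum>s\<in>S. a i s * (?K s (p (Suc k)) - ?K s (p k)))"       by (intro sum.cong refl) (subst delta[OF that(2)], rule refl)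
    also have "\<dots> = (?K (p (Suc i)) (p (Suc k)) - ?K (p (Suc i)) (p k)) - (?K (p i) (p (Suc k)) - ?K (p i) (p k))"
      by (rule delta[OF that(1)])
    also have "\<dots> = (\<bar>p k - p (Suc i)\<bar> powr (2 * H) + \<bar>p (Suc k) - p i\<bar> powr (2 * H)
        - \<bar>p (Suc k) - p (Suc i)\<bar> powr (2 * H) - \<bar>p k - p i\<bar> powr (2 * H)) / 2"
      by (simp add: field_simps)
    also have "\<dots> = h powr (2 * H) * fgn_cov H i k"
    proof -
      have dist: "\<bar>p l - p m\<bar> powr (2 * H) = \<bar>real l - real m\<bar> powr (2 * H) * h powr (2 * H)" for l m
      proof -
        have "\<bar>p l - p m\<bar> = \<bar>real l - real m\<bar> * h"
          using h by (simp add: p_def abs_mult flip: left_diff_distrib)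
        then show ?thesis using h by (simp add: powr_mult)
      qed
      have "\<bar>real_of_int (int i - int k) + 1\<bar> = \<bar>real k - real (Suc i)\<bar>"
        "\<bar>real_of_int (int i - int k) - 1\<bar> = \<bar>real (Suc k) - real i\<bar>"
        "\<bar>real_of_int (int i - int k)\<bar> = \<bar>real k - real i\<bar>" "\<bar>real (Suc k) - real (Suc i)\<bar> = \<bar>real k - real i\<bar>"
        by simp_all
      then show ?thesis unfolding dist fgn_autocovariance_def by (simp only:) (simp add: field_simps)
    qed
    finally show ?thesis .
  qed
  have eq: "alt_increments J h (\<lambda>t. B t x) = (\<Sum>i<J. (-1) ^ i * (\<Sum>t\<in>S. a i t * B t x))" for x
    unfolding alt_increments_def by (intro sum.cong refl) (simp add: delta p_def del: of_nat_Suc)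
  let ?v = "cov_form ?Kd {..<J} (\<lambda>i. (-1) ^ i)"
  note law = gaussian_linear_law[OF D finite_lessThan order_refl, of "\<lambda>i. (-1) ^ i"]
  have v: "?v = h powr (2 * H) * (\<Sum>i<J. \<Sum>k<J. (-1) ^ i * (-1) ^ k * fgn_cov H i k)"
    unfolding cov_form_def sum_distrib_left[of "h powr (2 * H)"]
  proof (intro sum.cong refl)
    fix i k assume "i \<in> {..<J}" "k \<in> {..<J}"
    then have "?Kd i k = h powr (2 * H) * fgn_cov H i k"
      by (intro Kd) simp_all
    then show "(-1) ^ i * (-1) ^ k * ?Kd i k
        = h powr (2 * H) * ((-1) ^ i * (-1) ^ k * fgn_cov H i k)"
      by (simp only: mult_ac)
  qed
  have "(\<Sum>i<J. \<Sum>k<J. (-1) ^ i * (-1) ^ k * fgn_cov H i k) \<le> real J"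
    using J fgn_alternating_form_le[of H J] H by (auto simp: fgn_autocovariance_0)
  then have "?v \<le> h powr (2 * H) * real J" unfolding v by (intro mult_left_mono) auto
  then show ?thesis using law by (intro that[of ?v]) (simp_all only: eq mult.commute)
qed

text \<open>\<kappa> is the standard normal mass of (-c, 0]. For x in this interval sqrt v x > -c
  \<sigma> >= -\<mu>, so adding \<mu> makes all of it favourable; v is bounded from above only, and
  \<kappa> depends on c alone.\<close>

lemma normal_law_shift_gap:
  assumes c: "0 < c"
  obtains \<kappa> where "0 < \<kappa>" "\<And>v \<sigma> \<mu>. 0 \<le> v \<Longrightarrow> v \<le> \<sigma>\<^sup>2 \<Longrightarrow> 0 < \<sigma> \<Longrightarrow> c * \<sigma> \<le> \<mu> \<Longrightarrow>
    \<kappa> \<le> measure (normal_law 0 v) {z. 0 < \<mu> + z} - measure (normal_law 0 v) {z. 0 < z}"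
proof
  interpret G: real_distribution std_normal by (rule real_dist_normal_dist)
  define \<kappa> where "\<kappa> = measure std_normal {-c<..0}"
  have "emeasure std_normal {-c<..0} \<noteq> 0"
  proof
    assume "emeasure std_normal {-c<..0} = 0"
    then have "{-c<..0} \<in> null_sets (density lborel (\<lambda>x. ennreal (std_normal_density x)))" by auto
    then have "AE x in lborel. x \<in> {-c<..0} \<longrightarrow> ennreal (std_normal_density x) = 0"
      by (subst (asm) null_sets_density_iff) auto
    then have "AE x in lborel. x \<notin> {-c<..0}"
    proof eventually_elim
      case (elim x)
      moreover have "0 < std_normal_density x" by (simp add: normal_density_pos)
      ultimately show ?case by (auto simp: ennreal_eq_0_iff)
    qed
    then have "{-c<..0} \<in> null_sets lborel" by (subst AE_iff_null_sets) auto
    then have "emeasure lborel {-c<..0} = 0" by auto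
    then show False using c by simp
  qed
  then show "0 < \<kappa>" unfolding \<kappa>_def by (simp add: G.emeasure_eq_measure zero_less_measure_iff)
  fix v \<sigma> \<mu> :: real assume v: "0 \<le> v" "v \<le> \<sigma>\<^sup>2" and s: "0 < \<sigma>" "c * \<sigma> \<le> \<mu>"
  have sv: "sqrt v \<le> \<sigma>" using v s(1) by (intro real_le_lsqrt) auto
  have m: "measure (normal_law 0 v) {z. 0 < \<mu>' + z} = measure std_normal {x. 0 < \<mu>' + sqrt v * x}" for \<mu>'
  proof -
    have "measure (normal_law 0 v) {z. 0 < \<mu>' + z}
        = measure std_normal ((\<lambda>x. 0 + sqrt v * x) -` {z. 0 < \<mu>' + z} \<inter> space std_normal)"
      unfolding normal_law_eq_distr[OF v(1)] by (rule measure_distr) auto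
    then show ?thesis by (simp add: vimage_def)
  qed
  have "\<kappa> + measure std_normal {x. 0 < 0 + sqrt v * x}
      = measure std_normal ({-c<..0} \<union> {x. 0 < 0 + sqrt v * x})"
    unfolding \<kappa>_def using v by (intro G.finite_measure_Union[symmetric]) (auto simp: zero_less_mult_iff)
  also have "\<dots> \<le> measure std_normal {x. 0 < \<mu> + sqrt v * x}"
  proof (rule G.finite_measure_mono)
    have \<mu>: "0 < \<mu>" using c s mult_pos_pos[of c \<sigma>] by linarith
    have "0 < \<mu> + sqrt v * x" if "-c < x" "x \<le> 0" for x
    proof -
      have "sqrt v * - x \<le> \<sigma> * - x" using that sv by (intro mult_right_mono) auto
      also have "\<dots> < \<sigma> * c" using that s by (intro mult_strict_left_mono) auto
      finally show ?thesis using s(2) by (simp add: mult.commute)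
    qed
    then show "{-c<..0} \<union> {x. 0 < 0 + sqrt v * x} \<subseteq> {x. 0 < \<mu> + sqrt v * x}" using \<mu> by auto
  qed auto
  finally show "\<kappa> \<le> measure (normal_law 0 v) {z. 0 < \<mu> + z} - measure (normal_law 0 v) {z. 0 < z}"
    using m[of \<mu>] m[of 0] by simp
qed

section \<open>From deficiency to tests\<close>

text \<open>Closeness in total variation, stated for tests with values in [0,1] instead of events,
  because a Markov kernel turns an event of the other experiment into such a test.\<close>

definition tests_close :: "'x measure \<Rightarrow> real \<Rightarrow> 'x measure \<Rightarrow> 'x measure \<Rightarrow> bool" where
  "tests_close \<Omega> \<delta> P Q \<longleftrightarrow> (\<forall>\<phi>\<in>borel_measurable \<Omega>. (\<forall>y. 0 \<le> \<phi> y \<and> \<phi> y \<le> (1::real)) \<longrightarrow>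
     \<bar>(LINT y|P. \<phi> y) - (LINT y|Q. \<phi> y)\<bar> \<le> \<delta>)"

text \<open>The factor n^(H-1) is positive and drops out of the sign of the statistic; the sign of
  \<mu> plus a centered normal variable is left.\<close>

lemma continuous_law_test:
  assumes B: "fractional_brownian_motion H M B" and n: "0 < n"
    and f: "set_integrable lborel {0..1} f"
    and h: "0 \<le> h" "real J * h \<le> 1 / 2"
    and law: "distr M borel (\<lambda>x. alt_increments J h (\<lambda>t. B t x)) = normal_law 0 v"
    and \<mu>: "alt_increments J h (\<lambda>t. LBINT u:{0..t}. f u) = real n powr (H - 1) * \<mu>"
  shows "measure (continuous_law H M B n f) {y \<in> mspace C01. 0 < alt_increments J h y}
      = measure (normal_law 0 v) {z. 0 < \<mu> + z}"
proof -
  let ?K = "\<lambda>s t. (\<bar>t\<bar> powr (2 * H) + \<bar>s\<bar> powr (2 * H) - \<bar>t - s\<bar> powr (2 * H)) / 2 :: real"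
  let ?r = "real n powr (H - 1)"
  have G: "centered_gaussian_process M {0..} B ?K"
    and cont: "\<And>x. x \<in> space M \<Longrightarrow> continuous_on {0..} (\<lambda>t. B t x)"
    using B by (simp_all add: fractional_brownian_motion_def)
  interpret M: prob_space M by (rule gaussian_prob_space[OF G])
  have Bm: "B t \<in> borel_measurable M" if "0 \<le> t" for t using gaussian_measurable[OF G] that by simp
  define Y where "Y t x = (LBINT u:{0..t}. f u) + ?r * B t x" for t x
  have "continuous_on {0..1} (\<lambda>t. integral {0..t} f)"
    using f by (intro indefinite_integral_continuous_1) (simp add: set_borel_integral_eq_integral)
  moreover have "integral {0..t} f = (LBINT u:{0..t}. f u)" if "t \<in> {0..1}" for t
    using that by (intro set_borel_integral_eq_integral(2)[symmetric] set_integrable_subset[OF f]) auto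
  ultimately have F: "continuous_on {0..1} (\<lambda>t. LBINT u:{0..t}. f u)"
    by (rule continuous_on_eq)
  have meas: "(\<lambda>x. \<lambda>t\<in>{0..1}. Y t x) \<in> measurable M borel_C01"
  proof (rule measurable_borel_C01I)
    show "Y t \<in> borel_measurable M" if "t \<in> {0..1}" for t
      unfolding Y_def using Bm[of t] that by (intro borel_measurable_add borel_measurable_times) auto
    show "continuous_on {0..1} (\<lambda>t. Y t x)" if "x \<in> space M" for x
      unfolding Y_def using continuous_on_subset[OF cont[OF that], of "{0..1}"]
      by (intro continuous_on_add F continuous_on_mult continuous_on_const) auto
  qed
  have cl: "continuous_law H M B n f = distr M borel_C01 (\<lambda>x. \<lambda>t\<in>{0..1}. Y t x)"
    by (simp add: continuous_law_def Y_def)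
  note t = alt_increments_nodes[OF h]
  have alt: "alt_increments J h (\<lambda>t\<in>{0..1}. Y t x) = ?r * (\<mu> + alt_increments J h (\<lambda>t. B t x))" for x
  proof -
    have "alt_increments J h (\<lambda>t\<in>{0..1}. Y t x) = alt_increments J h (\<lambda>t. LBINT u:{0..t}. f u) + ?r * alt_increments J h (\<lambda>t. B t x)"
      unfolding alt_increments_def sum_distrib_left sum.distrib[symmetric]
    proof (intro sum.cong refl)
      fix i assume "i \<in> {..<J}"
      then have "1/2 + real i * h \<in> {0..1}" "1/2 + real (Suc i) * h \<in> {0..1}" using t[of i] t[of "Suc i"] by auto
      then show "(-1) ^ i * ((\<lambda>t\<in>{0..1}. Y t x) (1/2 + real (Suc i) * h) - (\<lambda>t\<in>{0..1}. Y t x) (1/2 + real i * h))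
          = (-1) ^ i * ((LBINT u:{0..1/2 + real (Suc i) * h}. f u) - (LBINT u:{0..1/2 + real i * h}. f u))
            + ?r * ((-1) ^ i * (B (1/2 + real (Suc i) * h) x - B (1/2 + real i * h) x))"
        by (simp only: restrict_apply' Y_def) (simp add: algebra_simps)
    qed
    then show ?thesis by (simp add: \<mu> distrib_left)
  qed
  have Lm: "(\<lambda>x. alt_increments J h (\<lambda>t. B t x)) \<in> borel_measurable M"
    unfolding alt_increments_def using h
    by (intro borel_measurable_sum borel_measurable_times borel_measurable_diff borel_measurable_const Bm) auto
  have "measure (continuous_law H M B n f) {y \<in> mspace C01. 0 < alt_increments J h y}
      = measure M ((\<lambda>x. \<lambda>t\<in>{0..1}. Y t x) -` {y \<in> mspace C01. 0 < alt_increments J h y} \<inter> space M)"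
    unfolding cl by (intro measure_distr meas alt_increments_pos_sets h)
  also have "(\<lambda>x. \<lambda>t\<in>{0..1}. Y t x) -` {y \<in> mspace C01. 0 < alt_increments J h y} \<inter> space M
      = (\<lambda>x. alt_increments J h (\<lambda>t. B t x)) -` {z. 0 < \<mu> + z} \<inter> space M"
    using measurable_space[OF meas] n by (auto simp: space_borel_C01 alt zero_less_mult_iff)
  also have "measure M \<dots> = measure (normal_law 0 v) {z. 0 < \<mu> + z}"
    unfolding law[symmetric] by (rule measure_distr[symmetric, OF Lm]) auto
  finally show "measure (continuous_law H M B n f) {y \<in> mspace C01. 0 < alt_increments J h y}
      = measure (normal_law 0 v) {z. 0 < \<mu> + z}" .
qed

lemma discrete_observation_measurable:
  assumes N: "fractional_gaussian_noise H M N"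
  shows "(\<lambda>x. \<lambda>i\<in>{1..n}. f (real i / real n) + N i x) \<in> measurable M (borel_Rn n)"
  using N unfolding fractional_gaussian_noise_def borel_Rn_def
  by (intro measurable_restrict borel_measurable_add borel_measurable_const gaussian_measurable[of M "{1..}"]) auto

lemma discrete_law_shift:
  assumes N: "fractional_gaussian_noise H M N" and l: "0 < l"
    and form: "\<And>v. l * (\<Sum>i\<in>{1..n}. (v i)\<^sup>2) \<le> cov_form (fgn_cov H) {1..n} v"
    and f0: "\<And>i. i \<in> {1..n} \<Longrightarrow> f0 (real i / real n) = 0"
  shows "tests_close (borel_Rn n) (sqrt (exp ((\<Sum>i\<in>{1..n}. (f (real i / real n))\<^sup>2) / l) - 1))
    (discrete_law M N n f) (discrete_law M N n f0)"
  unfolding tests_close_def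
proof (intro ballI impI)
  fix \<phi> :: "(nat \<Rightarrow> real) \<Rightarrow> real"
  assume \<phi>: "\<phi> \<in> borel_measurable (borel_Rn n)" "\<forall>y. 0 \<le> \<phi> y \<and> \<phi> y \<le> 1"
  have G: "centered_gaussian_process M {1..} N (fgn_cov H)"
    using N by (simp add: fractional_gaussian_noise_def)
  have int: "(LINT y|discrete_law M N n g. \<phi> y) = (LINT x|M. \<phi> (\<lambda>i\<in>{1..n}. g (real i / real n) + N i x))" for g
    unfolding discrete_law_def by (rule integral_distr[OF discrete_observation_measurable[OF N] \<phi>(1)])
  have "(LINT y|discrete_law M N n f0. \<phi> y) = (LINT x|M. \<phi> (\<lambda>i\<in>{1..n}. N i x))"
    unfolding int by (intro Bochner_Integration.integral_cong refl arg_cong[of _ _ \<phi>] restrict_ext) (simp add: f0)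
  moreover have "\<bar>(LINT x|M. \<phi> (\<lambda>i\<in>{1..n}. f (real i / real n) + N i x)) - (LINT x|M. \<phi> (\<lambda>i\<in>{1..n}. N i x))\<bar>
      \<le> sqrt (exp ((\<Sum>i\<in>{1..n}. (f (real i / real n))\<^sup>2) / l) - 1)"
    using \<phi> form by (intro gaussian_shift[OF G _ _ l]) (auto simp: borel_Rn_def)
  ultimately show "\<bar>(LINT y|discrete_law M N n f. \<phi> y) - (LINT y|discrete_law M N n f0. \<phi> y)\<bar>
      \<le> sqrt (exp ((\<Sum>i\<in>{1..n}. (f (real i / real n))\<^sup>2) / l) - 1)" by (simp only: int)
qed

lemma discrete_law_prob:
  assumes N: "fractional_gaussian_noise H M N"
  shows "discrete_law M N n f \<in> space (prob_algebra (borel_Rn n))"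
proof -
  have G: "centered_gaussian_process M {1..} N (fgn_cov H)"
    using N by (simp add: fractional_gaussian_noise_def)
  interpret M: prob_space M by (rule gaussian_prob_space[OF G])
  show ?thesis
    unfolding discrete_law_def space_prob_algebra
    using M.prob_space_distr[OF discrete_observation_measurable[OF N]] by auto
qed

lemma tv_dist_bound:
  assumes "tv_dist P Q < ennreal e" "A \<in> sets P"
  shows "\<bar>measure P A - measure Q A\<bar> < e"
proof -
  have "ennreal \<bar>measure P A - measure Q A\<bar> \<le> tv_dist P Q"
    unfolding tv_dist_def using assms(2) by (rule SUP_upper)
  then have "ennreal \<bar>measure P A - measure Q A\<bar> < ennreal e" using assms(1) by (rule le_less_trans)
  then show ?thesis by (simp add: ennreal_less_iff)
qed

text \<open>The kernel pulls A back to the test that maps y to the mass of A under K y; this test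
  hardly separates P f from P g. The error of the kernel is paid once for f and once for g.\<close>

lemma deficiency_less_imp_tests_close:
  assumes def: "deficiency \<Theta> \<Omega> P \<Omega>' Q < ennreal e" and fg: "f \<in> \<Theta>" "g \<in> \<Theta>"
    and P: "P f \<in> space (prob_algebra \<Omega>)" "P g \<in> space (prob_algebra \<Omega>)"
    and A: "A \<in> sets \<Omega>'"
    and close: "tests_close \<Omega> \<delta> (P f) (P g)"
  shows "\<bar>measure (Q f) A - measure (Q g) A\<bar> \<le> 2 * e + \<delta>"
proof -
  from def obtain K where K: "K \<in> \<Omega> \<rightarrow>\<^sub>M prob_algebra \<Omega>'"
    and sup: "(SUP f\<in>\<Theta>. tv_dist (Giry_Monad.bind (P f) K) (Q f)) < ennreal e"
    unfolding deficiency_def INF_less_iff by blast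
  have tv: "\<bar>measure (Giry_Monad.bind (P k) K) A - measure (Q k) A\<bar> < e"
    if "k \<in> \<Theta>" "P k \<in> space (prob_algebra \<Omega>)" for k
  proof (rule tv_dist_bound)
    show "tv_dist (Giry_Monad.bind (P k) K) (Q k) < ennreal e"
      using SUP_upper[OF that(1), of "\<lambda>f. tv_dist (Giry_Monad.bind (P f) K) (Q f)"] sup by (rule le_less_trans)
    show "A \<in> sets (Giry_Monad.bind (P k) K)" using sets_bind'[OF that(2) K] A by simp
  qed
  \<comment> \<open>K y is a probability measure only for y in the sample space; the minimum keeps
    the test in [0,1] everywhere.\<close>
  define \<phi> where "\<phi> y = min 1 (measure (K y) A)" for y
  have Km: "(\<lambda>y. measure (K y) A) \<in> borel_measurable \<Omega>"
    using measurable_measure_prob_algebra[OF A] K by (rule measurable_compose[rotated])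
  then have \<phi>m: "\<phi> \<in> borel_measurable \<Omega>" unfolding \<phi>_def by measurable
  have int: "measure (Giry_Monad.bind (P k) K) A = (LINT y|P k. \<phi> y)"
    if Pk: "P k \<in> space (prob_algebra \<Omega>)" for k
  proof -
    have sets: "sets (P k) = sets \<Omega>" and "prob_space (P k)" using Pk by (auto simp: space_prob_algebra)
    then interpret Pk: prob_space "P k" by simp
    interpret B: prob_space "Giry_Monad.bind (P k) K" by (rule prob_space_bind'[OF Pk K])
    have "emeasure (K y) A = ennreal (\<phi> y)" if "y \<in> space (P k)" for y
    proof -
      have "K y \<in> space (prob_algebra \<Omega>')"
        using measurable_space[OF K] that sets_eq_imp_space_eq[OF sets] by simp
      then interpret Ky: prob_space "K y" by (simp add: space_prob_algebra)
      show ?thesis by (simp add: \<phi>_def Ky.emeasure_eq_measure min_absorb2)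
    qed
    then have "emeasure (Giry_Monad.bind (P k) K) A = (\<integral>\<^sup>+ y. ennreal (\<phi> y) \<partial>P k)"
      unfolding emeasure_bind_prob_algebra[OF Pk K A] by (intro nn_integral_cong)
    also have "\<dots> = ennreal (LINT y|P k. \<phi> y)"
    proof (rule nn_integral_eq_integral)
      show "integrable (P k) \<phi>"
        using \<phi>m sets by (intro Pk.integrable_const_bound[of _ 1]) (auto simp: \<phi>_def cong: measurable_cong_sets)
    qed (simp add: \<phi>_def)
    finally show ?thesis
      by (simp add: B.emeasure_eq_measure \<phi>_def)
  qed
  have "\<bar>(LINT y|P f. \<phi> y) - (LINT y|P g. \<phi> y)\<bar> \<le> \<delta>"
  proof -
    have "\<forall>y. 0 \<le> \<phi> y \<and> \<phi> y \<le> 1" by (simp add: \<phi>_def)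
    then show ?thesis using close \<phi>m unfolding tests_close_def by blast
  qed
  then show ?thesis
    using tv[OF fg(1) P(1)] tv[OF fg(2) P(2)] unfolding int[OF P(1)] int[OF P(2)] by linarith
qed

definition separated ::
  "'p set \<Rightarrow> 'x measure \<Rightarrow> ('p \<Rightarrow> 'x measure) \<Rightarrow> 'y measure \<Rightarrow> ('p \<Rightarrow> 'y measure) \<Rightarrow> 'p \<Rightarrow> real \<Rightarrow> real \<Rightarrow> bool" where
  "separated \<Theta> \<Omega> P \<Omega>' Q g \<kappa> \<delta> \<longleftrightarrow>
     (\<exists>f\<in>\<Theta>. \<exists>A\<in>sets \<Omega>'. \<kappa> \<le> measure (Q f) A - measure (Q g) A \<and> tests_close \<Omega> \<delta> (P f) (P g))"

text \<open>One deficiency is enough: the first experiment cannot imitate a test of the second that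
  separates f from g. Deficiency below \<kappa>/8 and tolerance \<kappa>/4 would limit the gain of
  that test to \<kappa>/2. It matters that \<kappa> is fixed before \<delta>.\<close>

lemma not_asymptotically_equivalentI:
  assumes \<kappa>: "0 < \<kappa>" and g: "g \<in> \<Theta>"
    and P: "\<And>n f. P n f \<in> space (prob_algebra (\<Omega> n))"
    and sep: "\<And>\<delta>. 0 < \<delta> \<Longrightarrow> \<forall>\<^sub>F n in sequentially. separated \<Theta> (\<Omega> n) (P n) (\<Omega>' n) (Q n) g \<kappa> \<delta>"
  shows "\<not> asymptotically_equivalent \<Theta> \<Omega> P \<Omega>' Q"
proof
  assume "asymptotically_equivalent \<Theta> \<Omega> P \<Omega>' Q"
  then have "\<forall>\<^sub>F n in sequentially. le_cam_distance \<Theta> (\<Omega> n) (P n) (\<Omega>' n) (Q n) < ennreal (\<kappa> / 8)"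
    unfolding asymptotically_equivalent_def using \<kappa> by (intro order_tendstoD) auto
  moreover have "\<forall>\<^sub>F n in sequentially. separated \<Theta> (\<Omega> n) (P n) (\<Omega>' n) (Q n) g \<kappa> (\<kappa> / 4)"
    using \<kappa> by (intro sep) simp
  ultimately have "\<forall>\<^sub>F n in sequentially. False"
  proof eventually_elim
    case (elim n)
    then obtain f A where f: "f \<in> \<Theta>" "A \<in> sets (\<Omega>' n)" "\<kappa> \<le> measure (Q n f) A - measure (Q n g) A"
      "tests_close (\<Omega> n) (\<kappa> / 4) (P n f) (P n g)" unfolding separated_def by blast
    have "deficiency \<Theta> (\<Omega> n) (P n) (\<Omega>' n) (Q n) < ennreal (\<kappa> / 8)"
      using elim(1) by (simp add: le_cam_distance_def)
    from deficiency_less_imp_tests_close[OF this f(1) g P P f(2,4)]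
    have "\<bar>measure (Q n f) A - measure (Q n g) A\<bar> \<le> 2 * (\<kappa> / 8) + \<kappa> / 4" .
    then show False using f(3) \<kappa> by linarith
  qed
  then show False by simp
qed

section \<open>Two aliasing frequencies\<close>

text \<open>Since \<open>\<omega> (j + n)\<close> is close to \<open>\<omega> j + \<pi> n\<close>, the two summands nearly cancel on the grid \<open>i / n\<close>.\<close>

definition alias_pair :: "(int \<Rightarrow> real) \<Rightarrow> nat \<Rightarrow> nat \<Rightarrow> real \<Rightarrow> real \<Rightarrow> real" where
  "alias_pair \<omega> j n a =
    sine_sum \<omega> {int j, int j + int n} (\<lambda>k. if k = int j then - ((-1) ^ n * a) else a)"

text \<open>At t = i/n the part pi n of the high frequency contributes the phase 2 pi i - pi n, that
  is the sign (-1)^n also carried by the low-frequency coefficient. Up to the amplitude, two sines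
  are left whose arguments differ by the drift times x, with |x| <= 1.\<close>

lemma alias_pair_grid:
  assumes i: "i \<in> {1..n}"
  shows "\<bar>alias_pair \<omega> j n a (real i / real n)\<bar> \<le> \<bar>a\<bar> * \<bar>zero_drift \<omega> j n\<bar>"
proof -
  define x where "x = 2 * (real i / real n) - 1"
  define e where "e = zero_drift \<omega> j n"
  have n: "0 < n" using i by auto
  have x: "\<bar>x\<bar> \<le> 1" using i by (auto simp: x_def abs_le_iff divide_simps)
  have nx: "pi * real n * x = 2 * pi * real i - real n * pi" using n by (simp add: x_def field_simps)
  define y where "y = (\<omega> (int j) + e) * x"
  have "\<omega> (int j + int n) * x = (y - real n * pi) + 2 * pi * real i"
    using nx by (simp add: y_def e_def algebra_simps)
  then have "sin (\<omega> (int j + int n) * x) = sin ((y - real n * pi) + 2 * pi * real i)" by simp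
  also have "\<dots> = sin (y - real n * pi)"
  proof -
    have "sin (2 * pi * real i) = 0" "cos (2 * pi * real i) = 1"
      using sin_2npi[of i] cos_2npi[of i] by (simp_all add: mult_ac)
    then show ?thesis by (simp only: sin_add mult_1_right mult_zero_right add_0_right)
  qed
  also have "\<dots> = (-1) ^ n * sin y" by (simp add: sin_diff)
  finally have hi: "sin (\<omega> (int j + int n) * x) = (-1) ^ n * sin y" .
  have "alias_pair \<omega> j n a (real i / real n)
      = - ((-1) ^ n * a) * sin (\<omega> (int j) * x) + a * sin (\<omega> (int j + int n) * x)"
    unfolding x_def using i n by (simp add: alias_pair_def sine_sum_def divide_le_eq_1)
  also have "\<dots> = a * (-1) ^ n * (sin y - sin (\<omega> (int j) * x))"
    unfolding hi by (simp add: right_diff_distrib)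
  finally have "alias_pair \<omega> j n a (real i / real n) = \<dots>" .
  then have "\<bar>alias_pair \<omega> j n a (real i / real n)\<bar> = \<bar>a\<bar> * \<bar>sin y - sin (\<omega> (int j) * x)\<bar>"
    by (simp add: abs_mult)
  also have "\<bar>sin y - sin (\<omega> (int j) * x)\<bar> \<le> \<bar>e\<bar>"
  proof -
    have "\<bar>sin y - sin (\<omega> (int j) * x)\<bar> = 2 * \<bar>sin (e * x / 2)\<bar> * \<bar>cos ((y + \<omega> (int j) * x) / 2)\<bar>"
      unfolding sin_diff_sin by (simp add: abs_mult y_def algebra_simps)
    also have "\<dots> \<le> 2 * \<bar>e * x / 2\<bar> * 1"
      using abs_sin_x_le_abs_x[of "e * x / 2"] by (intro mult_mono mult_left_mono) auto
    also have "\<dots> \<le> \<bar>e\<bar>" using mult_left_mono[OF x, of "\<bar>e\<bar>"] by (simp add: abs_mult)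
    finally show ?thesis .
  qed
  finally show ?thesis unfolding e_def by (simp add: mult_left_mono)
qed

lemma alias_pair_grid_sum:
  "(\<Sum>i\<in>{1..n}. (alias_pair \<omega> j n a (real i / real n))\<^sup>2)
    \<le> real n * (a * zero_drift \<omega> j n)\<^sup>2"
proof -
  have "(\<Sum>i\<in>{1..n}. (alias_pair \<omega> j n a (real i / real n))\<^sup>2)
      \<le> (\<Sum>i\<in>{1..n}. (a * zero_drift \<omega> j n)\<^sup>2)"
    using alias_pair_grid[of _ n \<omega> j a] by (intro sum_mono abs_le_square_iff[THEN iffD1]) (simp add: abs_mult)
  then show ?thesis by simp
qed

lemma alias_pair_in_sobolev_ball_sym:
  assumes \<omega>: "\<And>k. \<omega> (- k) = - \<omega> k" and j: "0 < j" and n: "0 < n"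
    and C: "a\<^sup>2 * ((1 + real j) powr (2 * \<alpha>) + (1 + real j + real n) powr (2 * \<alpha>)) \<le> 2 * C\<^sup>2"
  shows "alias_pair \<omega> j n a \<in> sobolev_ball_sym \<omega> \<alpha> C"
proof -
  have "((-1) ^ n)\<^sup>2 = (1 :: real)" by (cases "even n") simp_all
  then show ?thesis
    unfolding alias_pair_def
    using \<omega> j n C by (intro sine_sum_in_sobolev_ball_sym) (auto simp: power_mult_distrib algebra_simps)
qed

lemma alt_increments_alias_pair:
  assumes "\<omega> (int j) \<noteq> 0" "\<omega> (int j + int n) \<noteq> 0" "0 < n" "0 \<le> h" "real J * h \<le> 1 / 2"
  shows "alt_increments J h (\<lambda>t. LBINT u:{0..t}. alias_pair \<omega> j n a u)
    = (-1) ^ n * a / (2 * \<omega> (int j)) * alt_cos_sum J (2 * \<omega> (int j) * h)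
      - a / (2 * \<omega> (int j + int n)) * alt_cos_sum J (2 * \<omega> (int j + int n) * h)"
  unfolding alias_pair_def
  using assms by (subst alt_increments_integral_sine_sum) auto

text \<open>The part common to both regimes: n^(H-1) \<sigma> bounds the standard deviation of the
  statistic, c is the signal-to-noise ratio, and the choice of the step h and the number J of
  increments is left to the regime.\<close>

lemma alias_pair_separation:
  assumes B: "fractional_brownian_motion H M\<^sub>B B" and N: "fractional_gaussian_noise H M\<^sub>N N"
    and H: "0 < H" "H < 1" and n: "0 < n"
    and gap: "\<And>v \<sigma> \<mu>. 0 \<le> v \<Longrightarrow> v \<le> \<sigma>\<^sup>2 \<Longrightarrow> 0 < \<sigma> \<Longrightarrow> c * \<sigma> \<le> \<mu> \<Longrightarrow>
      \<kappa> \<le> measure (normal_law 0 v) {z. 0 < \<mu> + z} - measure (normal_law 0 v) {z. 0 < z}"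
    and l: "0 < l" "\<And>v. l * (\<Sum>i\<in>{1..n}. (v i)\<^sup>2)
      \<le> cov_form (fgn_cov H) {1..n} v"
    and \<delta>: "sqrt (exp (real n * (a * zero_drift \<omega> j n)\<^sup>2 / l) - 1) \<le> \<delta>"
    and h: "0 < h" "real J * h \<le> 1 / 2" and J: "J = 1 \<or> 1/2 \<le> H"
    and \<sigma>: "0 < \<sigma>" "real J * h powr (2 * H) \<le> \<sigma>\<^sup>2"
    and alt: "real n powr (H - 1) * (c * \<sigma>) \<le> alt_increments J h (\<lambda>t. LBINT u:{0..t}. alias_pair \<omega> j n a u)"
    and mem: "alias_pair \<omega> j n a \<in> \<Theta>"
  shows "separated \<Theta> (borel_Rn n) (discrete_law M\<^sub>N N n) borel_C01 (continuous_law H M\<^sub>B B n) (sine_sum \<omega> {} b) \<kappa> \<delta>"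
  unfolding separated_def
proof (intro bexI[OF _ mem] bexI conjI)
  let ?f = "alias_pair \<omega> j n a" and ?g = "sine_sum \<omega> {} b"
  let ?A = "{y \<in> mspace C01. 0 < alt_increments J h y}"
  show "?A \<in> sets borel_C01" using h by (intro alt_increments_pos_sets) auto
  obtain v where v: "0 \<le> v" "v \<le> real J * h powr (2 * H)"
    "distr M\<^sub>B borel (\<lambda>x. alt_increments J h (\<lambda>t. B t x)) = normal_law 0 v"
    using fbm_alt_increments_law[OF B H h(1) J] by blast
  let ?r = "real n powr (H - 1)"
  define \<mu> where "\<mu> = alt_increments J h (\<lambda>t. LBINT u:{0..t}. ?f u) / ?r"
  have int: "set_integrable lborel {0..1} (sine_sum \<omega> S b')" for S b'
    by (rule borel_integrable_atLeastAtMost'[OF sine_sum_continuous])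
  have "measure (continuous_law H M\<^sub>B B n ?f) ?A = measure (normal_law 0 v) {z. 0 < \<mu> + z}"
    by (rule continuous_law_test[OF B n _ _ h(2) v(3)])
      (use int[of "{int j, int j + int n}"] h n in \<open>auto simp: \<mu>_def alias_pair_def\<close>)
  moreover have "measure (continuous_law H M\<^sub>B B n ?g) ?A = measure (normal_law 0 v) {z. 0 < 0 + z}"
  proof (rule continuous_law_test[OF B n int _ h(2) v(3)])
    show "alt_increments J h (\<lambda>t. LBINT u:{0..t}. ?g u) = ?r * 0"
      using alt_increments_integral_sine_sum[of "{}" \<omega> h J b] h by simp
  qed (use h in simp)
  moreover have "\<kappa> \<le> measure (normal_law 0 v) {z. 0 < \<mu> + z} - measure (normal_law 0 v) {z. 0 < z}"
  proof (rule gap[OF v(1) order_trans[OF v(2) \<sigma>(2)] \<sigma>(1)])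
    show "c * \<sigma> \<le> \<mu>" using alt n by (simp add: \<mu>_def field_simps)
  qed
  ultimately show "\<kappa> \<le> measure (continuous_law H M\<^sub>B B n ?f) ?A - measure (continuous_law H M\<^sub>B B n ?g) ?A"
    by simp
  have "sqrt (exp ((\<Sum>i\<in>{1..n}. (?f (real i / real n))\<^sup>2) / l) - 1)
      \<le> sqrt (exp (real n * (a * zero_drift \<omega> j n)\<^sup>2 / l) - 1)"
    using alias_pair_grid_sum[of \<omega> j n a] l(1) by (simp add: divide_right_mono)
  also note \<delta>
  finally show "tests_close (borel_Rn n) \<delta> (discrete_law M\<^sub>N N n ?f) (discrete_law M\<^sub>N N n ?g)"
    using discrete_law_shift[OF N l, of ?g ?f] unfolding tests_close_def
    by (force simp: sine_sum_def intro: order_trans)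
qed

lemma sqrt_exp_diff_small:
  fixes X :: "nat \<Rightarrow> real"
  assumes "X \<longlonglongrightarrow> 0" "0 < \<delta>"
  shows "\<forall>\<^sub>F j in sequentially. sqrt (exp (X j) - 1) \<le> \<delta>"
proof -
  have "(\<lambda>j. sqrt (exp (X j) - 1)) \<longlonglongrightarrow> sqrt (exp 0 - 1)"
    by (intro tendsto_intros assms)
  then have "\<forall>\<^sub>F j in sequentially. sqrt (exp (X j) - 1) < \<delta>"
    using assms(2) by (intro order_tendstoD(2)) auto
  then show ?thesis by eventually_elim simp
qed

lemma eventually_real_ge: "\<forall>\<^sub>F n in sequentially. R \<le> real n"
  using filterlim_real_sequentially by (simp add: filterlim_at_top)

section \<open>Choice of the parameters for long and for short memory\<close>

theorem lemma6:
  fixes H \<alpha> C :: real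
    and \<omega> :: "int \<Rightarrow> real"
    and M\<^sub>N :: "'a measure" and N :: "nat \<Rightarrow> 'a \<Rightarrow> real"
    and M\<^sub>B :: "'b measure" and B :: "real \<Rightarrow> 'b \<Rightarrow> real"
  assumes "0 < H" and "H < 1" and "0 < C"
    and "\<alpha> = 1 / 2 \<or> \<alpha> < 1 - H"
    and "ordered_bessel_zeros (1 - H) \<omega>"
    and "fractional_gaussian_noise H M\<^sub>N N"
    and "fractional_brownian_motion H M\<^sub>B B"
  shows "\<not> asymptotically_equivalent (sobolev_ball_sym \<omega> \<alpha> C)
            borel_Rn (discrete_law M\<^sub>N N)
            (\<lambda>_. borel_C01) (continuous_law H M\<^sub>B B)"
proof -
  note H = assms(1,2) and C = assms(3) and \<omega>zeros = assms(5) and fGN = assms(6) and fBM = assms(7)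
  have \<nu>: "0 < 1 - H" "1 - H < 1" using H by auto
  note odd = ordered_bessel_zeros_odd[OF \<nu>(1) \<omega>zeros]
  obtain g where g: "0 < g" "\<And>k. 1 \<le> k \<Longrightarrow> g * real_of_int k \<le> \<omega> k"
    using bessel_zero_linear_lower[OF \<nu> \<omega>zeros] by blast
  obtain D k0 where D: "0 < D" "1 \<le> k0"
    and spacing: "\<And>j n :: nat. k0 \<le> j \<Longrightarrow> \<bar>zero_drift \<omega> j n\<bar> \<le> D / real j"
    using bessel_zero_spacing[OF \<nu> \<omega>zeros] by blast
  have near: "\<bar>zero_drift \<omega> j n\<bar> \<le> D / real j"
    "\<omega> (int j) + pi * real n - 1 \<le> \<omega> (int j + int n)" "\<omega> (int j + int n) \<le> \<omega> (int j) + pi * real n + 1"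
    if j: "k0 \<le> j" "0 < j" "D \<le> real j" for j n
  proof -
    show "\<bar>zero_drift \<omega> j n\<bar> \<le> D / real j" by (rule spacing[OF j(1)])
    also have "\<dots> \<le> 1" using j by simp
    finally show "\<omega> (int j) + pi * real n - 1 \<le> \<omega> (int j + int n)" "\<omega> (int j + int n) \<le> \<omega> (int j) + pi * real n + 1"
      by (simp_all add: abs_le_iff)
  qed
  have zero: "sine_sum \<omega> {} b \<in> sobolev_ball_sym \<omega> \<alpha> C" for b
    by (rule sine_sum_in_sobolev_ball_sym[where \<omega> = \<omega>, OF odd]) auto
  let ?sep = "\<lambda>\<kappa> \<delta> n. separated (sobolev_ball_sym \<omega> \<alpha> C) (borel_Rn n) (discrete_law M\<^sub>N N n)
    borel_C01 (continuous_law H M\<^sub>B B n) (sine_sum \<omega> {} (\<lambda>_. 0)) \<kappa> \<delta>"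
  note reduce = not_asymptotically_equivalentI[OF _ zero[of "\<lambda>_. 0"] discrete_law_prob[OF fGN]]
  \<comment> \<open>The bound 4 limits the low-frequency remainder to a/8 for long memory, and for
    short memory makes half a period of \<omega>_j shorter than 1/2.\<close>
  have large: "\<forall>\<^sub>F j in sequentially. k0 \<le> j \<and> 0 < j \<and> D \<le> real j \<and> 4 \<le> \<omega> (int j)"
    using eventually_ge_at_top[of k0] eventually_real_ge[of D] eventually_real_ge[of "4 / g"]
  proof eventually_elim
    case (elim j)
    have "4 \<le> g * real j" using elim(3) g(1) by (simp add: field_simps)
    then show ?case using elim D(2) g(2)[of "int j"] by auto
  qed
  show ?thesis
  proof (cases "1 / 2 \<le> H")
    case long: True
    have \<alpha>: "\<alpha> \<le> 1 / 2" using assms(4) long by auto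
    obtain l where l: "0 < l" "\<And>n v. l * (\<Sum>i\<in>{1..n}. (v i)\<^sup>2)
        \<le> cov_form (fgn_cov H) {1..n} v"
      using fgn_form_lower_bound_long_memory[OF long H(2)] by blast
    \<comment> \<open>The signal will be at least a/8 with a >= C/(2 sqrt n), against noise of size
      1/sqrt n.\<close>
    define c where "c = C / 16"
    have "0 < c" using C by (simp add: c_def)
    then obtain \<kappa> where \<kappa>: "0 < \<kappa>" and gap: "\<And>v \<sigma> \<mu>. 0 \<le> v \<Longrightarrow> v \<le> \<sigma>\<^sup>2 \<Longrightarrow> 0 < \<sigma> \<Longrightarrow> c * \<sigma> \<le> \<mu> \<Longrightarrow>
      \<kappa> \<le> measure (normal_law 0 v) {z. 0 < \<mu> + z} - measure (normal_law 0 v) {z. 0 < z}"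
      using normal_law_shift_gap[of c] by blast
    show ?thesis
    proof (rule reduce[OF \<kappa>])
      fix \<delta> :: real assume \<delta>: "0 < \<delta>"
      \<comment> \<open>This bound for the discrete side is free of n, so j can be fixed in terms of
        \<delta> before n grows.\<close>
      have "(\<lambda>j. (C * D / real j)\<^sup>2 / l) \<longlonglongrightarrow> 0\<^sup>2 / l"
        using l(1) by (intro tendsto_intros lim_const_over_n) auto
      then have "\<forall>\<^sub>F j in sequentially. sqrt (exp ((C * D / real j)\<^sup>2 / l) - 1) \<le> \<delta>"
        using \<delta> by (intro sqrt_exp_diff_small) simp_all
      from eventually_happens[OF eventually_conj[OF large this]]
      obtain j where j: "k0 \<le> j" "0 < j" "D \<le> real j" "4 \<le> \<omega> (int j)"
        "sqrt (exp ((C * D / real j)\<^sup>2 / l) - 1) \<le> \<delta>" by auto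
      let ?w = "\<omega> (int j)" and ?L = "\<lambda>n a J h. alt_increments J h (\<lambda>t. LBINT u:{0..t}. alias_pair \<omega> j n a u)"
      show "\<forall>\<^sub>F n in sequentially. ?sep \<kappa> \<delta> n"
        using eventually_real_ge[of "1 + real j"] eventually_real_ge[of "(?w + 1) / (4 - pi)"] eventually_real_ge[of "2 * ?w / pi"]
      proof eventually_elim
        case (elim n)
        have n: "0 < n" using elim(1) by (cases n) auto
        let ?W = "\<omega> (int j + int n)"
        note near = near[OF j(1-3), of n]
        have "?w + 1 \<le> (4 - pi) * real n" using elim(2) pi_less_4 by (simp add: field_simps)
        moreover have "2 * ?w \<le> pi * real n" using elim(3) by (simp add: field_simps)
        ultimately have W: "pi * real n \<le> ?W" "?W \<le> 4 * real n" "2 * ?w \<le> ?W"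
          using near j(4) by (simp_all add: algebra_simps)
        have Wpos: "0 < ?W" using W j(4) by linarith
        \<comment> \<open>Both Sobolev weights are at most q because \<alpha> <= 1/2, so a^2 =
          C^2/q, of order 1/n, is admissible.\<close>
        define q where "q = 1 + real j + real n"
        have q: "0 < q" "real n \<le> q" "q \<le> 2 * real n" using elim(1) by (simp_all add: q_def)
        define a where "a = C / sqrt q"
        have a: "0 < a" "a\<^sup>2 = C\<^sup>2 / q" using C q by (simp_all add: a_def power_divide)
        have "(1 + real k) powr (2 * \<alpha>) \<le> q" if "k \<le> j + n" for k
        proof -
          have "(1 + real k) powr (2 * \<alpha>) \<le> (1 + real k) powr 1" using \<alpha> by (intro powr_mono) auto
          also have "\<dots> \<le> q" using that by (simp add: q_def)
          finally show ?thesis .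
        qed
        from this[of j] this[of "j + n"]
        have "a\<^sup>2 * ((1 + real j) powr (2 * \<alpha>) + (1 + real j + real n) powr (2 * \<alpha>)) \<le> a\<^sup>2 * (q + q)"
          by (intro mult_left_mono add_mono) (auto simp: add.assoc)
        also have "\<dots> = 2 * C\<^sup>2" using q by (simp add: a)
        finally have mem: "alias_pair \<omega> j n a \<in> sobolev_ball_sym \<omega> \<alpha> C"
          by (rule alias_pair_in_sobolev_ball_sym[where \<omega> = \<omega>, OF odd j(2) n])
        \<comment> \<open>Half a period of the high frequency. As \<open>?W\<close> >= pi n, the n
          increments fit into [1/2, 1]; as \<open>?W\<close> >= 2 \<open>?w\<close>, the low
          frequency advances by at most pi/2 per step and stays off resonance.\<close>
        define h where "h = pi / (2 * ?W)"
        have h: "0 < h" "real n * h \<le> 1 / 2" "h \<le> 1 / real n"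
          using W(1) Wpos n pi_gt_zero by (simp_all add: h_def field_simps)
        define \<sigma> where "\<sigma> = real n powr (1/2 - H)"
        have \<sigma>: "0 < \<sigma>" "\<sigma>\<^sup>2 = real n powr (1 - 2 * H)"
          using n by (simp_all add: \<sigma>_def powr_numeral[symmetric] powr_powr algebra_simps)
        have "real n * h powr (2 * H) \<le> real n * (1 / real n) powr (2 * H)"
          using h H by (intro mult_left_mono powr_mono2) auto
        also have "\<dots> = \<sigma>\<^sup>2" using n by (simp add: \<sigma>(2) powr_diff powr_divide)
        finally have var: "real n * h powr (2 * H) \<le> \<sigma>\<^sup>2" .
        \<comment> \<open>The resonant term is a n / \<open>?W\<close> >= a/4; the low-frequency
          term is at most a/8 in modulus, so its sign does not matter.\<close>
        have alt: "real n powr (H - 1) * (c * \<sigma>)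
            \<le> ?L n a n h"
        proof -
          have "2 * ?W * h = pi" using Wpos by (simp add: h_def)
          then have "?L n a n h
              = (-1) ^ n * a / (2 * ?w) * alt_cos_sum n (2 * ?w * h) + a * (real n / ?W)"
            using alt_increments_alias_pair[of \<omega> j n h n a] Wpos j(4) n h by (simp add: alt_cos_sum_pi)
          moreover have "\<bar>(-1) ^ n * a / (2 * ?w) * alt_cos_sum n (2 * ?w * h)\<bar> \<le> a / 8"
          proof -
            have "2 * ?w * h \<le> pi / 2" using W(3) Wpos by (simp add: h_def field_simps)
            then have "\<bar>alt_cos_sum n (2 * ?w * h)\<bar> \<le> 1" using j(4) h by (intro abs_alt_cos_sum_le) auto
            then have "\<bar>(-1) ^ n * a / (2 * ?w)\<bar> * \<bar>alt_cos_sum n (2 * ?w * h)\<bar> \<le> (a / 8) * 1"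
            proof (intro mult_mono)
              have "\<bar>(-1) ^ n * a / (2 * ?w)\<bar> = a / (2 * ?w)" using a(1) j(4) by (simp add: abs_mult)
              also have "\<dots> \<le> a / 8" using a(1) j(4) by (intro divide_left_mono) auto
              finally show "\<bar>(-1) ^ n * a / (2 * ?w)\<bar> \<le> a / 8" .
            qed (use a(1) in auto)
            then show ?thesis by (simp only: abs_mult mult_1_right)
          qed
          moreover have "a * (1 / 4) \<le> a * (real n / ?W)"
            using W(2) Wpos a by (intro mult_left_mono) (auto simp: field_simps)
          ultimately have "a / 8 \<le> ?L n a n h" by linarith
          moreover have "real n powr (H - 1) * (c * \<sigma>) \<le> a / 8"
          proof -
            have "real n powr (H - 1) * (c * \<sigma>) = c * real n powr (- 1 / 2)"
              by (simp add: \<sigma>_def powr_add[symmetric])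
            also have "\<dots> = c / sqrt (real n)" using n by (simp add: powr_minus_divide powr_half_sqrt)
            also have "\<dots> \<le> a / 8"
            proof -
              have "sqrt q \<le> sqrt (4 * real n)" using q by (intro real_sqrt_le_mono) auto
              then have "sqrt q \<le> 2 * sqrt (real n)" by (simp add: real_sqrt_mult)
              then have "C * sqrt q \<le> C * (2 * sqrt (real n))" using C by (intro mult_left_mono) auto
              then show ?thesis using n q by (simp add: a_def c_def field_simps)
            qed
            finally show ?thesis .
          qed
          ultimately show ?thesis by linarith
        qed
        have "sqrt (exp (real n * (a * zero_drift \<omega> j n)\<^sup>2 / l) - 1) \<le> sqrt (exp ((C * D / real j)\<^sup>2 / l) - 1)"
        proof -
          have "real n * (a * zero_drift \<omega> j n)\<^sup>2 = (real n / q) * (C * zero_drift \<omega> j n)\<^sup>2" by (simp add: power_mult_distrib a)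
          also have "\<dots> \<le> 1 * (C * (D / real j))\<^sup>2"
          proof (intro mult_mono abs_le_square_iff[THEN iffD1])
            show "\<bar>C * zero_drift \<omega> j n\<bar> \<le> \<bar>C * (D / real j)\<bar>"
              using mult_left_mono[OF near(1), of C] C D(1) by (simp add: abs_mult)
          qed (use q in auto)
          finally show ?thesis using l(1) by (simp add: divide_right_mono)
        qed
        also note j(5)
        finally have close: "sqrt (exp (real n * (a * zero_drift \<omega> j n)\<^sup>2 / l) - 1) \<le> \<delta>" .
        show ?case
          by (rule alias_pair_separation[OF fBM fGN H n _ l close h(1,2) disjI2[OF long] \<sigma>(1) var alt mem])
            (rule gap)
      qed
    qed
  next
    case False
    then have short: "H < 1 / 2" by simp
    have \<alpha>: "\<alpha> < 1 - H" using assms(4) short by auto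
    \<comment> \<open>Bounding (1 + k)^(2\<alpha>) by a power of 2n requires a nonnegative exponent,
      so a negative \<alpha> is raised to 0.\<close>
    define \<beta> where "\<beta> = max \<alpha> 0"
    have \<beta>: "0 \<le> \<beta>" "\<alpha> \<le> \<beta>" "\<beta> < 1 - H" using \<alpha> H by (auto simp: \<beta>_def)
    \<comment> \<open>The amplitude will be proportional to \<omega>_j^(1-H), so the zeros also need
      an upper bound linear in j.\<close>
    define G where "G = \<omega> (int k0) + pi + D"
    have \<omega>k0: "0 < \<omega> (int k0)"
    proof -
      have "0 < g * real_of_int (int k0)" using g(1) D(2) by simp
      then show ?thesis using g(2)[of "int k0"] D(2) by simp
    qed
    have G: "0 < G" unfolding G_def using \<omega>k0 D(1) pi_gt_zero by linarith
    have growth: "\<omega> (int j) \<le> G * real j" if j: "k0 \<le> j" for j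
    proof -
      define m where "m = j - k0"
      have m: "int j = int k0 + int m" "real m \<le> real j" "1 \<le> real j" using j D(2) by (simp_all add: m_def)
      have "\<omega> (int j) \<le> \<omega> (int k0) + pi * real m + D / real k0"
        using spacing[of k0 m] m(1) by (simp add: abs_le_iff)
      also have "\<dots> \<le> \<omega> (int k0) * real j + pi * real j + D * real j"
      proof (intro add_mono)
        show "\<omega> (int k0) \<le> \<omega> (int k0) * real j" using \<omega>k0 m(3) by simp
        show "pi * real m \<le> pi * real j" using m(2) by simp
        have "D / real k0 \<le> D * 1" using D by (simp add: divide_le_eq)
        also have "\<dots> \<le> D * real j" using D(1) m(3) by (intro mult_left_mono) auto
        finally show "D / real k0 \<le> D * real j" .
      qed
      finally show ?thesis by (simp add: G_def algebra_simps)
    qed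
    obtain \<kappa> where \<kappa>: "0 < \<kappa>" and gap: "\<And>v \<sigma> \<mu>. 0 \<le> v \<Longrightarrow> v \<le> \<sigma>\<^sup>2 \<Longrightarrow> 0 < \<sigma> \<Longrightarrow> 1 / 4 * \<sigma> \<le> \<mu> \<Longrightarrow>
      \<kappa> \<le> measure (normal_law 0 v) {z. 0 < \<mu> + z} - measure (normal_law 0 v) {z. 0 < z}"
      using normal_law_shift_gap[of "1 / 4"] by auto
    \<comment> \<open>It collects (G j)^(2-2H) from the amplitude, D/j from the drift and 2H
      n^(2H-1) from the covariance; the powers of n cancel and j^(-2H) remains as the only
      dependence on j.\<close>
    let ?c = "G powr (2 - 2 * H) * D\<^sup>2 / (2 * H)"
    show ?thesis
    proof (rule reduce[OF \<kappa>])
      fix \<delta> :: real assume \<delta>: "0 < \<delta>"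
      have "(\<lambda>j. ?c * real j powr (- 2 * H)) \<longlonglongrightarrow> ?c * 0"
        using H by (intro tendsto_mult tendsto_const tendsto_neg_powr filterlim_real_sequentially) auto
      then have "\<forall>\<^sub>F j in sequentially. sqrt (exp (?c * real j powr (- 2 * H)) - 1) \<le> \<delta>"
        using \<delta> by (intro sqrt_exp_diff_small) simp_all
      from eventually_happens[OF eventually_conj[OF large this]]
      obtain j where j: "k0 \<le> j" "0 < j" "D \<le> real j" "4 \<le> \<omega> (int j)"
        "sqrt (exp (?c * real j powr (- 2 * H)) - 1) \<le> \<delta>" by auto
      let ?w = "\<omega> (int j)" and ?L = "\<lambda>n a J h. alt_increments J h (\<lambda>t. LBINT u:{0..t}. alias_pair \<omega> j n a u)"
      \<comment> \<open>With this factor the signal is of order n^(H-1) \<omega>_j^(-H), the size of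
        the noise in one increment over half a period of \<omega>_j; so the power of the test does
        not depend on j.\<close>
      define K where "K = ?w powr (1 - H)"
      have K: "0 < K" using j(4) by (simp add: K_def)
      have K2: "K\<^sup>2 = ?w powr (2 - 2 * H)"
        using j(4) by (simp add: K_def powr_numeral[symmetric] powr_powr algebra_simps)
      have "(\<lambda>n. K\<^sup>2 * 2 powr (2 * \<beta>) * real n powr (2 * H - 2 + 2 * \<beta>)) \<longlonglongrightarrow> K\<^sup>2 * 2 powr (2 * \<beta>) * 0"
        using \<beta>(3) by (intro tendsto_mult tendsto_const tendsto_neg_powr filterlim_real_sequentially) auto
      \<comment> \<open>Here \<alpha> < 1 - H enters: for fixed j the Sobolev norm of the pair tends
        to 0, however large K is.\<close>
      then have ev: "\<forall>\<^sub>F n in sequentially. K\<^sup>2 * 2 powr (2 * \<beta>) * real n powr (2 * H - 2 + 2 * \<beta>) < C\<^sup>2"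
        using C by (intro order_tendstoD(2)) auto
      show "\<forall>\<^sub>F n in sequentially. ?sep \<kappa> \<delta> n"
        using eventually_real_ge[of "1 + real j"] eventually_real_ge[of "(?w + 1) / pi"] ev
      proof eventually_elim
        case (elim n)
        have n: "0 < n" using elim(1) by (cases n) auto
        let ?W = "\<omega> (int j + int n)"
        note near = near[OF j(1-3), of n]
        have "?w + 1 \<le> pi * real n" using elim(2) by (simp add: field_simps)
        then have W: "2 * ?w \<le> ?W" using near(2) by linarith
        have Wpos: "0 < ?W" using W j(4) by linarith
        let ?r = "real n powr (H - 1)"
        \<comment> \<open>The sign (-1)^n cancels the one in the low-frequency coefficient, and the
          minus sign there together with the minus sign here and the response -2 at phase pi makes
          the signal positive.\<close>
        define a where "a = - ((-1) ^ n * (K * ?r))"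
        have sgn: "((-1) ^ n)\<^sup>2 = (1 :: real)" by (cases "even n") simp_all
        have a2: "a\<^sup>2 = K\<^sup>2 * real n powr (2 * H - 2)"
          using n by (simp add: a_def power_mult_distrib sgn powr_numeral[symmetric] powr_powr algebra_simps)
        have pw: "(1 + real k) powr (2 * \<alpha>) \<le> (2 * real n) powr (2 * \<beta>)" if "k \<le> j + n" for k
        proof -
          have "(1 + real k) powr (2 * \<alpha>) \<le> (1 + real k) powr (2 * \<beta>)" using \<beta> by (intro powr_mono) auto
          also have "\<dots> \<le> (2 * real n) powr (2 * \<beta>)" using that elim(1) \<beta> by (intro powr_mono2) auto
          finally show ?thesis .
        qed
        have "a\<^sup>2 * ((1 + real j) powr (2 * \<alpha>) + (1 + real j + real n) powr (2 * \<alpha>))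
            \<le> a\<^sup>2 * ((2 * real n) powr (2 * \<beta>) + (2 * real n) powr (2 * \<beta>))"
          using pw[of j] pw[of "j + n"] by (intro mult_left_mono add_mono) (auto simp: add.assoc)
        also have "\<dots> = 2 * (K\<^sup>2 * 2 powr (2 * \<beta>) * real n powr (2 * H - 2 + 2 * \<beta>))"
          by (simp add: a2 powr_mult powr_add)
        also have "\<dots> \<le> 2 * C\<^sup>2" using elim(3) by simp
        finally have mem: "alias_pair \<omega> j n a \<in> sobolev_ball_sym \<omega> \<alpha> C"
          by (rule alias_pair_in_sobolev_ball_sym[where \<omega> = \<omega>, OF odd j(2) n])
        define h where "h = pi / (2 * ?w)"
        have h: "0 < h" "real 1 * h \<le> 1 / 2"
          using j(4) pi_less_4 by (simp_all add: h_def field_simps)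
        define \<sigma> where "\<sigma> = h powr H"
        have \<sigma>: "0 < \<sigma>" using h by (simp add: \<sigma>_def)
        have var: "real 1 * h powr (2 * H) \<le> \<sigma>\<^sup>2"
          using h by (simp add: \<sigma>_def powr_numeral[symmetric] powr_powr mult.commute)
        have alt: "?r * (1 / 4 * \<sigma>) \<le> ?L n a 1 h"
        proof -
          have "2 * ?w * h = pi" using j(4) by (simp add: h_def)
          moreover have "(-1) ^ n * a = - (K * ?r)" by (simp add: a_def flip: mult.assoc power_mult_distrib)
          ultimately have "?L n a 1 h
              = K * ?r / ?w - a / (2 * ?W) * alt_cos_sum 1 (2 * ?W * h)"
            using alt_increments_alias_pair[of \<omega> j n h 1 a] Wpos j(4) n h by (simp add: alt_cos_sum_pi)
          \<comment> \<open>The high frequency is at least twice the low one, so it can cancel at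
            most half of the signal.\<close>
          moreover have "\<bar>a / (2 * ?W) * alt_cos_sum 1 (2 * ?W * h)\<bar> \<le> K * ?r / (2 * ?w)"
          proof -
            have "\<bar>alt_cos_sum 1 (2 * ?W * h)\<bar> \<le> 2"
              using abs_cos_le_one[of "2 * ?W * h"] by (simp add: alt_cos_sum_def)
            then have "\<bar>a / (2 * ?W)\<bar> * \<bar>alt_cos_sum 1 (2 * ?W * h)\<bar> \<le> K * ?r / (2 * ?W) * 2"
              using K Wpos by (intro mult_mono) (auto simp: a_def abs_mult)
            also have "\<dots> = K * ?r / ?W" by simp
            also have "\<dots> \<le> K * ?r / (2 * ?w)" using W K j(4) Wpos by (intro divide_left_mono) auto
            finally show ?thesis by (simp only: abs_mult)
          qed
          ultimately have "K * ?r / ?w - K * ?r / (2 * ?w) \<le> ?L n a 1 h"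
            by linarith
          then have "?r * (K / ?w / 2) \<le> ?L n a 1 h"
            by (simp add: field_simps)
          \<comment> \<open>The origin of the ratio 1/4: half of the signal remains, and \<sigma> =
            (pi/2)^H \<open>?w\<close>^(-H) is at most 2 \<open>?w\<close>^(-H).\<close>
          moreover have "?r * (1 / 4 * \<sigma>) \<le> ?r * (K / ?w / 2)"
          proof (intro mult_left_mono)
            have "K / ?w = ?w powr (- H)" using j(4) by (simp add: K_def powr_diff powr_minus_divide)
            moreover have "\<sigma> \<le> 2 * ?w powr (- H)"
            proof -
              have "\<sigma> = (pi / 2) powr H * ?w powr (- H)"
                using j(4) by (simp add: \<sigma>_def h_def powr_divide powr_mult powr_minus_divide)
              also have "\<dots> \<le> 2 * ?w powr (- H)"
              proof (intro mult_right_mono)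
                have "(pi / 2) powr H \<le> 2 powr H" using pi_less_4 H by (intro powr_mono2) auto
                also have "\<dots> \<le> 2 powr 1" using H by (intro powr_mono) auto
                finally show "(pi / 2) powr H \<le> 2" by simp
              qed simp
              finally show ?thesis .
            qed
            ultimately show "1 / 4 * \<sigma> \<le> K / ?w / 2" by simp
          qed simp
          ultimately show ?thesis by linarith
        qed
        define l where "l = 2 * H * real n powr (2 * H - 1)"
        have l: "0 < l" using H n by (simp add: l_def)
        have form: "l * (\<Sum>i\<in>{1..n}. (v i)\<^sup>2)
            \<le> cov_form (fgn_cov H) {1..n} v" for v
          unfolding l_def by (rule fgn_form_lower_bound_short_memory[OF H(1) short])
        have "real n * (a * zero_drift \<omega> j n)\<^sup>2 / l \<le> ?c * real j powr (- 2 * H)"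
        proof -
          have "real n * real n powr (2 * H - 2) = real n powr (2 * H - 1)"
            using n powr_mult_base[of "real n" "2 * H - 2"] by simp
          then have "real n * (a * zero_drift \<omega> j n)\<^sup>2 = real n powr (2 * H - 1) * (K\<^sup>2 * (zero_drift \<omega> j n)\<^sup>2)"
            by (simp add: power_mult_distrib a2 mult_ac)
          then have "real n * (a * zero_drift \<omega> j n)\<^sup>2 / l = (K\<^sup>2 * (zero_drift \<omega> j n)\<^sup>2) / (2 * H)"
            using n by (simp add: l_def)
          also have "\<dots> \<le> ((G * real j) powr (2 - 2 * H) * (D / real j)\<^sup>2) / (2 * H)"
          proof (intro divide_right_mono mult_mono)
            show "K\<^sup>2 \<le> (G * real j) powr (2 - 2 * H)"
              unfolding K2 using growth[OF j(1)] j(4) H by (intro powr_mono2) auto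
            show "(zero_drift \<omega> j n)\<^sup>2 \<le> (D / real j)\<^sup>2"
              using near(1) D(1) by (intro abs_le_square_iff[THEN iffD1]) simp
          qed (use H in auto)
          also have "\<dots> = ?c * real j powr (- 2 * H)"
          proof -
            have "real j powr (2 - 2 * H) / (real j)\<^sup>2 = real j powr (- 2 * H)"
            proof -
              have "real j powr (2 - 2 * H) / real j powr 2 = real j powr (- 2 * H)"
                unfolding powr_diff[symmetric] by simp
              then show ?thesis using j(2) by simp
            qed
            moreover have "(G * real j) powr (2 - 2 * H) * (D / real j)\<^sup>2 / (2 * H)
                = ?c * (real j powr (2 - 2 * H) / (real j)\<^sup>2)"
              using G by (simp add: powr_mult power_divide mult_ac)
            ultimately show ?thesis by simp
          qed
          finally show ?thesis .
        qed
        then have "sqrt (exp (real n * (a * zero_drift \<omega> j n)\<^sup>2 / l) - 1)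
            \<le> sqrt (exp (?c * real j powr (- 2 * H)) - 1)" by simp
        then have close: "sqrt (exp (real n * (a * zero_drift \<omega> j n)\<^sup>2 / l) - 1) \<le> \<delta>"
          using j(5) by linarith
        show ?case
          by (rule alias_pair_separation[OF fBM fGN H n _ l form close h(1,2) disjI1[OF refl] \<sigma> var alt mem])
            (rule gap)
      qed
    qed
  qed
qed

end
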